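(* Let $\tilde W_m := W_{T_m}$. (a) For every $d \ge 1$, $\dfrac{\tilde W_m}{\ln m} \to 1 - d^{-1}$ in probability as $m \to \infty$. (b) If $d \ge 2$, then almost surely \[ \liminf_{m\to\infty} \frac{\tilde W_m}{\ln m} = 1 - d^{-1}, \qquad \limsup_{m\to\infty} \frac{\tilde W_m}{\ln m} = 1; \] in particular $\tilde W_m = \Theta(\ln m)$ almost surely.
   Context: Fix an integer $d \ge 1$. Let $X^{(1)}, X^{(2)}, \dots$ be i.i.d. random vectors in $\mathbb{R}^d$ with independent Exponential$(1)$ coordinates. For $x,y \in \mathbb{R}^d$ write $x \prec y$ if $x_j<y_j$ for all $j$, $x \le y$ if $x_j \le y_j$ for all $j$, and $x_+ := \sum_j x_j$. The record-setting region at time $n$ is $\mathrm{RS}_n := \{x \in \mathbb{R}^d : 0 \le x,\ x \not\prec X^{(i)} \text{ for all } 1 \le i \le n\}$, with frontier $F_n$ (its topological boundary relative to $[0,\infty)^d$). Define $F_n^- := \min\{x_+ : x \in F_n\}$, $F_n^+ := \max\{x_+ : x \in F_n\}$, and $W_n := F_n^+ - F_n^-$. $X^{(k)}$ is a (Pareto) record if $X^{(k)} \not\prec X^{(i)}$ for all $1 \le i < k$, and $T_m$ is the index at which the $m$th record is set. *)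

theory Defs
  imports "HOL-Probability.Probability" "HOL-Library.Infinite_Set"
begin

text \<open>Vectors in R^d are modelled as real^'d with a finite index type 'd, d = CARD('d).
A sample path is x :: nat => real^'d; only indices i >= 1 are used (x 1, x 2, ...).\<close>

definition strict_less :: "real^'d \<Rightarrow> real^'d \<Rightarrow> bool" where
  "strict_less x y \<longleftrightarrow> (\<forall>j. x $ j < y $ j)"

definition nonneg_orthant :: "(real^'d) set" where
  "nonneg_orthant = {z. \<forall>j. 0 \<le> z $ j}"

definition coord_sum :: "real^'d \<Rightarrow> real" where
  "coord_sum z = (\<Sum>j\<in>UNIV. z $ j)"

definition RS :: "(nat \<Rightarrow> real^'d) \<Rightarrow> nat \<Rightarrow> (real^'d) set" where
  "RS x n = {z \<in> nonneg_orthant. \<forall>i\<in>{1..n}. \<not> strict_less z (x i)}"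

definition frontierRS :: "(nat \<Rightarrow> real^'d) \<Rightarrow> nat \<Rightarrow> (real^'d) set" where
  "frontierRS x n = (top_of_set nonneg_orthant) frontier_of (RS x n)"

definition Fminus :: "(nat \<Rightarrow> real^'d) \<Rightarrow> nat \<Rightarrow> real" where
  "Fminus x n = Inf (coord_sum ` frontierRS x n)"

definition Fplus :: "(nat \<Rightarrow> real^'d) \<Rightarrow> nat \<Rightarrow> real" where
  "Fplus x n = Sup (coord_sum ` frontierRS x n)"

definition Wwidth :: "(nat \<Rightarrow> real^'d) \<Rightarrow> nat \<Rightarrow> real" where
  "Wwidth x n = Fplus x n - Fminus x n"

definition is_record :: "(nat \<Rightarrow> real^'d) \<Rightarrow> nat \<Rightarrow> bool" where
  "is_record x k \<longleftrightarrow> 1 \<le> k \<and> (\<forall>i\<in>{1..<k}. \<not> strict_less (x k) (x i))"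

definition record_time :: "(nat \<Rightarrow> real^'d) \<Rightarrow> nat \<Rightarrow> nat" where
  "record_time x m = enumerate {k. is_record x k} (m - 1)"

definition Wtilde :: "(nat \<Rightarrow> real^'d) \<Rightarrow> nat \<Rightarrow> real" where
  "Wtilde x m = Wwidth x (record_time x m)"

end

theory Submission
  imports Defs "HOL-Real_Asymp.Real_Asymp"
begin

text \<open>The upper end of the frontier at time \<open>n\<close> is the maximum of the coordinate sums observed so far,
  and its lower end is the least coordinate sum of a nonnegative undominated point. At time \<open>n = 2 ^ j\<close> all lattice points
  below \<open>ln n - e ln ln n\<close> are dominated, while those on the level \<open>ln n + e ln ln n\<close> are mostly not: by a
  Chernoff bound there are too few observations above that level, and each of them dominates only
  polylogarithmically (in \<open>j\<close>) many of these lattice points. So the lower end is \<open>ln n + o (ln ln n)\<close>. The upper end is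
  typically \<open>ln n + (d - 1) ln ln n\<close>, and by Borel--Cantelli its largest fluctuations reach
  \<open>ln n + d ln ln n\<close>.

  The first observation dominating a lattice point is a record, and a record is the first dominator of
  polylogarithmically many lattice points only. Counting lattice points therefore bounds the number of records below,
  over every short window of time, and gives that the \<open>m\<close>th record time satisfies \<open>d ln ln T = ln m + o (ln m)\<close>.

  Convergence in probability at the random time \<open>T\<close> is the delicate point, because outliers do occur within
  the range of possible values of \<open>T\<close>. But an outlier in the \<open>j\<close>th dyadic block can matter for the \<open>m\<close>th record only if
  the record count before that block lies in a short interval below \<open>m\<close>. These two events are independent,
  the count stays in the interval for few \<open>j\<close> by the lower bound on windows, and so the union bound over \<open>j\<close>
  tends to 0.\<close>

section \<open>The frontier\<close>

text \<open>At time \<open>2 ^ j\<close> every relevant height is \<open>j * ln 2\<close> plus a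
  multiple of \<open>ln j\<close>, and the record count \<open>m\<close> reached by then satisfies
  \<open>ln m = d * ln j\<close> up to lower order. Widths near \<open>(d - 1) * ln j\<close> and
  \<open>d * ln j\<close> therefore produce the constants \<open>1 - 1/d\<close> and
  \<open>1\<close>. Unit lattice spacing displaces a height only by a constant, which is invisible
  on this scale, and it makes the union bounds over points finite.

  In probability the obstacle is the size of the union. A priori the \<open>m\<close>th record may
  fall in any of about \<open>m powr (1/d)\<close> blocks, while a block reaches
  \<open>a * ln j\<close> above the typical maximum with probability about
  \<open>j powr (-a)\<close>, that is \<open>m powr (-a/d)\<close>. For \<open>a < 1\<close> a plain
  union bound diverges. Since the count grows by about \<open>j powr (d - 1)\<close> per block,
  knowing it to within that order leaves only a small power of \<open>m\<close> of candidate blocks,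
  and independence allows the two factors to be multiplied.

  Such a bound at a given \<open>m\<close> needs thresholds common to all paths considered. The
  pathwise part is therefore stated for a fixed error \<open>e\<close> and a fixed starting block
  \<open>J\<close>.\<close>

definition dominated :: "(nat \<Rightarrow> real^'d) \<Rightarrow> nat \<Rightarrow> real^'d \<Rightarrow> bool" where
  "dominated x n z \<longleftrightarrow> (\<exists>i\<in>{1..n}. strict_less z (x i))"

lemma dominated_mono: "dominated x m z \<Longrightarrow> m \<le> n \<Longrightarrow> dominated x n z"
  unfolding dominated_def by (meson atLeastAtMost_iff order_trans)

lemma strict_less_trans: "strict_less x y \<Longrightarrow> strict_less y z \<Longrightarrow> strict_less x z"
  unfolding strict_less_def by (meson order_less_trans)

lemma coord_sum_strict_mono: "strict_less x y \<Longrightarrow> coord_sum x < coord_sum y"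
  unfolding strict_less_def coord_sum_def by (intro sum_strict_mono) auto

lemma coord_sum_mono: "(\<And>j. x $ j \<le> y $ j) \<Longrightarrow> coord_sum x \<le> coord_sum y"
  unfolding coord_sum_def by (intro sum_mono) auto

lemma RS_eq: "RS x n = {z \<in> nonneg_orthant. \<not> dominated x n z}"
  unfolding RS_def dominated_def by auto

lemma is_record_iff: "is_record x k \<longleftrightarrow> 1 \<le> k \<and> \<not> dominated x (k - 1) (x k)"
proof -
  have "{1..k - 1} = {1..<k}" by auto
  then show ?thesis unfolding is_record_def dominated_def by simp
qed

text \<open>Not lying strictly below \<open>x i\<close> is a finite union of closed half-spaces.
  Closedness makes frontier points undominated.\<close>

lemma closedin_RS: "closedin (top_of_set nonneg_orthant) (RS x n)"
proof -
  have "closed {z. \<not> strict_less z (x i)}" for i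
  proof -
    have "{z. \<not> strict_less z (x i)} = (\<Union>j. {z. x i $ j \<le> z $ j})"
      by (auto simp: strict_less_def not_less)
    then show ?thesis by (auto intro!: closed_UN closed_Collect_le continuous_intros)
  qed
  then have "closed (\<Inter>i\<in>{1..n}. {z. \<not> strict_less z (x i)})" by auto
  moreover have "RS x n = nonneg_orthant \<inter> (\<Inter>i\<in>{1..n}. {z. \<not> strict_less z (x i)})"
    unfolding RS_def by auto
  ultimately show ?thesis by (auto simp: closedin_closed)
qed

lemma frontierRS_subset: "frontierRS x n \<subseteq> RS x n"
  unfolding frontierRS_def by (rule frontier_of_subset_closedin[OF closedin_RS])

text \<open>A point lying weakly below no observation violates, for each \<open>i\<close>, some
  coordinate inequality strictly. These are finitely many open conditions, so the point is interior
  to \<open>RS x n\<close>. The sums of the observations thereby bound those on the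
  frontier.\<close>

lemma frontierRS_below:
  assumes "z \<in> frontierRS x n"
  shows "\<exists>i\<in>{1..n}. \<forall>j. z $ j \<le> x i $ j"
proof (rule ccontr)
  assume *: "\<not> ?thesis"
  define T where "T = (\<Inter>i\<in>{1..n}. \<Union>j. {z. x i $ j < z $ j})"
  have "open {z. x i $ j < z $ j}" for i j
    by (rule open_Collect_less) (auto intro: continuous_intros)
  then have "open T" unfolding T_def by (intro open_INT open_UN) blast+
  then have "openin (top_of_set nonneg_orthant) (nonneg_orthant \<inter> T)" by (rule openin_open_Int)
  moreover have "nonneg_orthant \<inter> T \<subseteq> RS x n"
  proof
    fix w assume w: "w \<in> nonneg_orthant \<inter> T"
    have "\<not> strict_less w (x i)" if "i \<in> {1..n}" for i
    proof -
      have "w \<in> (\<Union>j. {z. x i $ j < z $ j})" using w that unfolding T_def by simp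
      then obtain j where "x i $ j < w $ j" by auto
      then have "\<not> w $ j < x i $ j" by simp
      then show ?thesis unfolding strict_less_def by blast
    qed
    then show "w \<in> RS x n" using w unfolding RS_def by blast
  qed
  ultimately have "nonneg_orthant \<inter> T \<subseteq> (top_of_set nonneg_orthant) interior_of (RS x n)"
    by (meson interior_of_maximal)
  moreover have "z \<in> nonneg_orthant \<inter> T"
  proof -
    have "z \<in> nonneg_orthant" using frontierRS_subset[of x n] assms unfolding RS_def by blast
    moreover have "z \<in> T" unfolding T_def using * by (simp add: not_le)
    ultimately show ?thesis by blast
  qed
  ultimately show False using assms unfolding frontierRS_def frontier_of_def by auto
qed

text \<open>The segment is connected, meets the region at \<open>b\<close> and leaves it at
  \<open>a\<close>. All frontier points used below are produced in this way, with coordinate sums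
  controlled through the endpoints.\<close>

lemma segment_meets_frontierRS:
  assumes "a \<in> nonneg_orthant" "dominated x n a" "b \<in> RS x n"
  shows "\<exists>w \<in> closed_segment a b. w \<in> frontierRS x n"
proof -
  have conv: "convex nonneg_orthant"
    unfolding nonneg_orthant_def convex_def by auto
  have b: "b \<in> nonneg_orthant" using assms(3) unfolding RS_def by auto
  have sub: "closed_segment a b \<subseteq> nonneg_orthant"
    using conv assms(1) b by (rule closed_segment_subset[rotated 2])
  have "connectedin (top_of_set nonneg_orthant) (closed_segment a b)"
    using sub by (simp add: connectedin_subtopology connected_segment)
  then have "closed_segment a b \<inter> frontierRS x n \<noteq> {}"
    unfolding frontierRS_def
  proof (rule connectedin_Int_frontier_of)
    show "closed_segment a b \<inter> RS x n \<noteq> {}" using assms(3) by auto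
    show "closed_segment a b - RS x n \<noteq> {}" using assms(2) unfolding RS_eq by auto
  qed
  then show ?thesis by auto
qed

lemma coord_sum_segment:
  assumes "w \<in> closed_segment a b"
  shows "min (coord_sum a) (coord_sum b) \<le> coord_sum w" "coord_sum w \<le> max (coord_sum a) (coord_sum b)"
proof -
  obtain u where u: "0 \<le> u" "u \<le> 1" "w = (1 - u) *\<^sub>R a + u *\<^sub>R b"
    using assms by (auto simp: closed_segment_def)
  have e: "coord_sum w = (1 - u) * coord_sum a + u * coord_sum b"
    unfolding u(3) coord_sum_def by (simp add: sum.distrib sum_distrib_left)
  have "coord_sum w \<in> closed_segment (coord_sum a) (coord_sum b)"
    unfolding e closed_segment_def using u by auto
  then show "min (coord_sum a) (coord_sum b) \<le> coord_sum w" "coord_sum w \<le> max (coord_sum a) (coord_sum b)"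
    by (auto simp: closed_segment_eq_real_ivl split: if_splits)
qed

lemma RS_nonempty: "\<exists>z. z \<in> RS x n"
proof -
  define z where "z = (\<chi> j. \<Sum>i\<in>{1..n}. \<bar>x i $ j\<bar>)"
  have "x i $ j \<le> z $ j" if "i \<in> {1..n}" for i j
  proof -
    have "\<bar>x i $ j\<bar> \<le> z $ j" unfolding z_def vec_lambda_beta using that by (intro member_le_sum) auto
    then show ?thesis by linarith
  qed
  then have "\<not> strict_less z (x i)" if "i \<in> {1..n}" for i
    using that unfolding strict_less_def by (meson leD)
  moreover have "z \<in> nonneg_orthant" unfolding nonneg_orthant_def z_def by (simp add: sum_nonneg)
  ultimately show ?thesis unfolding RS_def by blast
qed

text \<open>Strict positivity, an almost sure property, makes the origin dominated from time 1 on
  and leaves room to move below an observation without leaving the orthant.\<close>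

locale positive_path =
  fixes x :: "nat \<Rightarrow> real^'d"
  assumes pos: "\<And>i j. 1 \<le> i \<Longrightarrow> 0 < x i $ j"
begin

lemma zero_dominated: "1 \<le> n \<Longrightarrow> dominated x n 0"
  unfolding dominated_def strict_less_def using pos by (intro bexI[of _ 1]) auto

lemma in_orthant: "1 \<le> i \<Longrightarrow> x i \<in> nonneg_orthant"
  by (simp add: nonneg_orthant_def pos less_imp_le)

lemma zero_in_orthant: "0 \<in> nonneg_orthant"
  unfolding nonneg_orthant_def by auto

lemma orthant_sum_nonneg: "z \<in> nonneg_orthant \<Longrightarrow> 0 \<le> coord_sum z"
  unfolding nonneg_orthant_def coord_sum_def by (auto intro: sum_nonneg)

lemma frontierRS_nonempty:
  assumes "1 \<le> n" shows "frontierRS x n \<noteq> {}"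
  using RS_nonempty[of x n] segment_meets_frontierRS[OF zero_in_orthant zero_dominated[OF assms]] by blast

lemma bdd_below_frontier: "bdd_below (coord_sum ` frontierRS x n)"
proof (rule bdd_belowI2)
  fix w assume "w \<in> frontierRS x n"
  then have "w \<in> RS x n" using frontierRS_subset by blast
  then show "0 \<le> coord_sum w" unfolding RS_def using orthant_sum_nonneg by blast
qed

lemma frontier_sum_le:
  assumes "w \<in> frontierRS x n" "\<And>i. i \<in> {1..n} \<Longrightarrow> coord_sum (x i) \<le> B"
  shows "coord_sum w \<le> B"
proof -
  obtain i where "i \<in> {1..n}" "\<forall>j. w $ j \<le> x i $ j" using frontierRS_below[OF assms(1)] by blast
  then have "coord_sum w \<le> coord_sum (x i)" "coord_sum (x i) \<le> B"
    using coord_sum_mono[of w "x i"] assms(2)[of i] by blast+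
  then show ?thesis by linarith
qed

lemma bdd_above_frontier: "bdd_above (coord_sum ` frontierRS x n)"
proof (rule bdd_aboveI2)
  fix w assume "w \<in> frontierRS x n"
  then show "coord_sum w \<le> Max ((\<lambda>i. coord_sum (x i)) ` {1..n})"
    by (rule frontier_sum_le) (auto intro!: Max_ge)
qed

lemma Fplus_le:
  assumes "1 \<le> n" "\<And>i. i \<in> {1..n} \<Longrightarrow> coord_sum (x i) \<le> B"
  shows "Fplus x n \<le> B"
  unfolding Fplus_def
proof (rule cSUP_least)
  show "frontierRS x n \<noteq> {}" using frontierRS_nonempty[OF assms(1)] .
  show "coord_sum w \<le> B" if "w \<in> frontierRS x n" for w
    using frontier_sum_le[OF that assms(2)] .
qed

text \<open>An observation with the largest coordinate sum is undominated, since a dominator has a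
  larger sum. Lowering all its coordinates slightly gives a dominated point, so the frontier is met
  within any \<open>e\<close> of that sum.\<close>

lemma Fplus_ge:
  assumes "i \<in> {1..n}"
  shows "coord_sum (x i) \<le> Fplus x n"
proof -
  obtain k where k: "k \<in> {1..n}" "\<And>i. i \<in> {1..n} \<Longrightarrow> coord_sum (x i) \<le> coord_sum (x k)"
  proof -
    let ?S = "(\<lambda>i. coord_sum (x i)) ` {1..n}"
    have "Max ?S \<in> ?S" using assms by (intro Max_in) auto
    then obtain k where "k \<in> {1..n}" "coord_sum (x k) = Max ?S" by auto
    moreover have "coord_sum (x i) \<le> Max ?S" if "i \<in> {1..n}" for i
      using that by (intro Max_ge) auto
    ultimately show ?thesis using that by metis
  qed
  have xk: "x k \<in> RS x n"
  proof -
    have "\<not> strict_less (x k) (x i)" if "i \<in> {1..n}" for i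
      using k(2)[OF that] coord_sum_strict_mono[of "x k" "x i"] by linarith
    then show ?thesis unfolding RS_def using in_orthant k(1) by simp
  qed
  have "coord_sum (x k) \<le> Fplus x n"
  proof (rule field_le_epsilon)
    fix e :: real assume e: "0 < e"
    define m where "m = Min (range (\<lambda>j. x k $ j))"
    have m: "m \<le> x k $ j" for j unfolding m_def by simp
    have "m \<in> range (\<lambda>j. x k $ j)" unfolding m_def by (intro Min_in) auto
    then have "0 < m" using pos k(1) by auto
    \<comment> \<open>The cap \<open>m\<close> keeps the lowered point in the orthant, and
      \<open>e / d\<close> keeps the total loss at most \<open>e\<close>.\<close>
    define t where "t = min m (e / real CARD('d))"
    have t: "0 < t" "t \<le> m" "real CARD('d) * t \<le> e"
      using e \<open>0 < m\<close> unfolding t_def by (auto simp: field_simps min_def)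
    define a where "a = (\<chi> j. x k $ j - t)"
    have "a \<in> nonneg_orthant" unfolding a_def nonneg_orthant_def
      using t m by (auto intro: order_trans)
    moreover have "dominated x n a"
      unfolding dominated_def a_def strict_less_def using k(1) t(1) by (intro bexI[of _ k]) auto
    ultimately obtain w where w: "w \<in> closed_segment a (x k)" "w \<in> frontierRS x n"
      using segment_meets_frontierRS xk by blast
    have "coord_sum a = coord_sum (x k) - real CARD('d) * t"
      unfolding a_def coord_sum_def by (simp add: sum_subtractf)
    then have "coord_sum (x k) - e \<le> coord_sum w"
      using coord_sum_segment(1)[OF w(1)] t(3) e by (auto simp: min_def split: if_splits)
    also have "coord_sum w \<le> Fplus x n"
      unfolding Fplus_def using w(2) bdd_above_frontier by (intro cSUP_upper) auto
    finally show "coord_sum (x k) \<le> Fplus x n + e" by simp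
  qed
  then show ?thesis using k(2)[OF assms] by simp
qed

lemma Fminus_ge:
  assumes "1 \<le> n" "\<And>z. z \<in> nonneg_orthant \<Longrightarrow> coord_sum z \<le> b \<Longrightarrow> dominated x n z"
  shows "b \<le> Fminus x n"
  unfolding Fminus_def
proof (rule cINF_greatest)
  show "frontierRS x n \<noteq> {}" using frontierRS_nonempty[OF assms(1)] .
  fix w assume "w \<in> frontierRS x n"
  then have "w \<in> RS x n" using frontierRS_subset by auto
  then have "w \<in> nonneg_orthant" "\<not> dominated x n w" unfolding RS_eq by simp_all
  then have "\<not> coord_sum w \<le> b" using assms(2) by blast
  then show "b \<le> coord_sum w" by simp
qed

text \<open>The frontier is met on the segment from the dominated origin to \<open>z\<close>, along
  which the coordinate sum never exceeds that of \<open>z\<close>.\<close>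

lemma Fminus_le:
  assumes "1 \<le> n" "z \<in> RS x n"
  shows "Fminus x n \<le> coord_sum z"
proof -
  obtain w where w: "w \<in> closed_segment 0 z" "w \<in> frontierRS x n"
    using segment_meets_frontierRS[OF zero_in_orthant zero_dominated[OF assms(1)] assms(2)] by blast
  have "Fminus x n \<le> coord_sum w"
    unfolding Fminus_def using w(2) bdd_below_frontier by (intro cINF_lower) auto
  also have "0 \<le> coord_sum z" using assms(2) orthant_sum_nonneg unfolding RS_def by auto
  then have "coord_sum w \<le> coord_sum z"
    using coord_sum_segment(2)[OF w(1)] by (simp add: coord_sum_def)
  finally show ?thesis .
qed

text \<open>On the line the frontier sits at the maximal observation. Dimension one is settled
  separately, because the estimates on undominated lattice points below have no room there.\<close>

lemma Wwidth_one_dim: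
  assumes "CARD('d) = 1" "1 \<le> n"
  shows "Wwidth x n = 0"
proof -
  obtain j0 :: 'd where j0: "UNIV = {j0}" using assms(1) by (rule card_1_singletonE)
  have s: "coord_sum z = z $ j0" for z :: "real^'d" unfolding coord_sum_def j0 by simp
  have l: "strict_less y z \<longleftrightarrow> y $ j0 < z $ j0" for y z :: "real^'d"
  proof
    show "y $ j0 < z $ j0" if "strict_less y z" using that by (simp add: strict_less_def)
    show "strict_less y z" if "y $ j0 < z $ j0"
      unfolding strict_less_def
    proof
      fix j
      have "j = j0" using j0 by blast
      then show "y $ j < z $ j" using that by simp
    qed
  qed
  have "coord_sum w = Max ((\<lambda>i. x i $ j0) ` {1..n})" if w: "w \<in> frontierRS x n" for w
  proof (rule antisym)
    have "coord_sum (x i) \<le> Max ((\<lambda>i. x i $ j0) ` {1..n})" if "i \<in> {1..n}" for i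
      unfolding s using that by (intro Max_ge) auto
    with w show "coord_sum w \<le> Max ((\<lambda>i. x i $ j0) ` {1..n})" by (rule frontier_sum_le)
    have "w \<in> RS x n" using w frontierRS_subset by blast
    then have "x i $ j0 \<le> w $ j0" if "i \<in> {1..n}" for i
      using that unfolding RS_def l by (simp add: not_less)
    then show "Max ((\<lambda>i. x i $ j0) ` {1..n}) \<le> coord_sum w"
      unfolding s using assms(2) by (intro Max.boundedI) auto
  qed
  then have "coord_sum ` frontierRS x n = {Max ((\<lambda>i. x i $ j0) ` {1..n})}"
    using frontierRS_nonempty[OF assms(2)] by (simp add: image_constant_conv cong: image_cong)
  then show ?thesis unfolding Wwidth_def Fplus_def Fminus_def by simp
qed

end

section \<open>Counting records and lattice points\<close>

text \<open>With \<open>n = 2 ^ j\<close> the level \<open>lev s j\<close> is \<open>ln n + s * ln (ln n)\<close> up to a constant; the expected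
  number of the first \<open>n\<close> observations above a point on it is \<open>j powr (- s)\<close>.\<close>

definition lev :: "real \<Rightarrow> nat \<Rightarrow> real" where
  "lev s j = real j * ln 2 + s * ln (real j)"

definition Rcount :: "(nat \<Rightarrow> real^'d) \<Rightarrow> nat \<Rightarrow> nat" where
  "Rcount x n = card {k \<in> {1..n}. is_record x k}"

definition gvec :: "('d \<Rightarrow> nat) \<Rightarrow> real^'d" where
  "gvec g = (\<chi> i. real (g i))"

lemma coord_sum_gvec: "coord_sum (gvec g) = real (sum g UNIV)"
  unfolding coord_sum_def gvec_def by simp

lemma gvec_orthant: "gvec g \<in> nonneg_orthant"
  unfolding nonneg_orthant_def gvec_def by simp

lemma box_eq_PiE: "{g :: 'd::finite \<Rightarrow> nat. \<forall>i. g i \<le> B} = PiE UNIV (\<lambda>_. {..B})"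
  unfolding PiE_UNIV_domain by auto

lemma finite_box: "finite {g :: 'd::finite \<Rightarrow> nat. \<forall>i. g i \<le> B}"
  unfolding box_eq_PiE by (rule finite_PiE) auto

lemma card_box: "card {g :: 'd::finite \<Rightarrow> nat. \<forall>i. g i \<le> B} = (B + 1) ^ CARD('d)"
  unfolding box_eq_PiE by (subst card_PiE) auto

lemma coord_le_sum: "g i \<le> sum g UNIV" for g :: "'d::finite \<Rightarrow> nat"
  by (rule member_le_sum) auto

lemma finite_simplex: "finite {g :: 'd::finite \<Rightarrow> nat. sum g UNIV \<le> N}"
  by (rule finite_subset[OF _ finite_box[of N]]) (auto intro: order_trans[OF coord_le_sum])

lemma finite_level: "finite {g :: 'd::finite \<Rightarrow> nat. sum g UNIV = N}"
  by (rule finite_subset[OF _ finite_simplex[of N]]) auto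

lemma finite_below: "finite {g :: 'd::finite \<Rightarrow> nat. strict_less (gvec g) y}"
proof -
  have *: "g i \<le> nat \<lceil>Max (range (\<lambda>i. y $ i))\<rceil>" if "strict_less (gvec g) y" for g i
  proof -
    have "real (g i) < y $ i" using that unfolding strict_less_def gvec_def by simp
    also have "y $ i \<le> Max (range (\<lambda>i. y $ i))" by (intro Max_ge) auto
    finally show ?thesis by linarith
  qed
  show ?thesis
    by (rule finite_subset[OF _ finite_box[of "nat \<lceil>Max (range (\<lambda>i. y $ i))\<rceil>"]]) (use * in auto)
qed

lemma div_bound: "0 < d \<Longrightarrow> real N / real d \<le> real (N div d + 1)"
  by (metis Suc_eq_plus1 add.commute add_mult_distrib2 dividend_less_div_times less_imp_le mult.commute
      mult.right_neutral of_nat_0_less_iff of_nat_le_iff of_nat_mult pos_divide_le_eq)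

text \<open>The cube of side \<open>N div d\<close> lies inside the simplex.\<close>

lemma card_simplex_ge:
  "(real N / real CARD('d)) ^ CARD('d) \<le> real (card {g :: 'd::finite \<Rightarrow> nat. sum g UNIV \<le> N})"
proof -
  have "{g :: 'd \<Rightarrow> nat. \<forall>i. g i \<le> N div CARD('d)} \<subseteq> {g. sum g UNIV \<le> N}"
  proof safe
    fix g :: "'d \<Rightarrow> nat" assume "\<forall>i. g i \<le> N div CARD('d)"
    then have "sum g UNIV \<le> CARD('d) * (N div CARD('d))"
      using sum_bounded_above[of UNIV g "N div CARD('d)"] by simp
    then show "sum g UNIV \<le> N" by (meson order_trans times_div_less_eq_dividend)
  qed
  from card_mono[OF finite_simplex this] have "(N div CARD('d) + 1) ^ CARD('d) \<le> card {g :: 'd \<Rightarrow> nat. sum g UNIV \<le> N}"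
    unfolding card_box .
  then have "real (N div CARD('d) + 1) ^ CARD('d) \<le> real (card {g :: 'd \<Rightarrow> nat. sum g UNIV \<le> N})"
    by (metis of_nat_le_iff of_nat_power)
  moreover have "(real N / real CARD('d)) ^ CARD('d) \<le> real (N div CARD('d) + 1) ^ CARD('d)"
    by (intro power_mono div_bound) auto
  ultimately show ?thesis by linarith
qed

text \<open>\<open>d - 1\<close> coordinates range freely over a cube of side
  \<open>N div d\<close>, and the coordinate \<open>i0\<close> takes up the remainder.\<close>

lemma card_level_ge:
  "(real N / real CARD('d)) ^ (CARD('d) - 1) \<le> real (card {g :: 'd::finite \<Rightarrow> nat. sum g UNIV = N})"
proof -
  obtain i0 :: 'd where True by blast
  define S where "S = PiE (UNIV - {i0}) (\<lambda>_. {..N div CARD('d)})"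
  define p where "p h = (\<lambda>i. if i = i0 then N - sum h (UNIV - {i0}) else h i)" for h :: "'d \<Rightarrow> nat"
  have "inj_on p S"
  proof (rule inj_onI)
    fix h h' assume hh: "h \<in> S" "h' \<in> S" "p h = p h'"
    have "h i = h' i" if "i \<in> UNIV - {i0}" for i
      using fun_cong[OF hh(3), of i] that unfolding p_def by simp
    then show "h = h'" using hh(1,2) unfolding S_def by (rule PiE_ext[rotated 2])
  qed
  moreover have "p ` S \<subseteq> {g. sum g UNIV = N}"
  proof safe
    fix h assume "h \<in> S"
    then have "\<And>i. i \<in> UNIV - {i0} \<Longrightarrow> h i \<le> N div CARD('d)" unfolding S_def by (auto simp: PiE_iff)
    then have "sum h (UNIV - {i0}) \<le> card (UNIV - {i0}) * (N div CARD('d))"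
      using sum_bounded_above[of "UNIV - {i0}" h "N div CARD('d)"] by simp
    also have "\<dots> \<le> CARD('d) * (N div CARD('d))" by (intro mult_right_mono card_mono) auto
    also have "\<dots> \<le> N" by simp
    finally have le: "sum h (UNIV - {i0}) \<le> N" .
    have "sum (p h) UNIV = p h i0 + sum (p h) (UNIV - {i0})" by (rule sum.remove) auto
    also have "sum (p h) (UNIV - {i0}) = sum h (UNIV - {i0})" unfolding p_def by (intro sum.cong) auto
    finally show "sum (p h) UNIV = N" using le unfolding p_def by simp
  qed
  ultimately have "card S \<le> card {g :: 'd \<Rightarrow> nat. sum g UNIV = N}"
    using card_inj_on_le finite_level by metis
  moreover have "card S = (N div CARD('d) + 1) ^ (CARD('d) - 1)"
    unfolding S_def by (subst card_PiE) (auto simp: card_Diff_singleton)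
  ultimately have "real (N div CARD('d) + 1) ^ (CARD('d) - 1) \<le> real (card {g :: 'd \<Rightarrow> nat. sum g UNIV = N})"
    by (metis of_nat_le_iff of_nat_power)
  moreover have "(real N / real CARD('d)) ^ (CARD('d) - 1) \<le> real (N div CARD('d) + 1) ^ (CARD('d) - 1)"
    by (intro power_mono div_bound) auto
  ultimately show ?thesis by linarith
qed

text \<open>The map \<open>g \<mapsto> \<lceil>y\<rceil> - 1 - g\<close> embeds the set into a cube of side \<open>c\<close>.\<close>

lemma card_just_below:
  fixes y :: "real^'d"
  assumes "0 \<le> c"
  shows "real (card {g. strict_less (gvec g) y \<and> coord_sum y - c \<le> real (sum g UNIV)}) \<le> (c + 1) ^ CARD('d)"
proof -
  define S where "S = {g. strict_less (gvec g) y \<and> coord_sum y - c \<le> real (sum g UNIV)}"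
  define t where "t i = nat \<lceil>y $ i\<rceil> - 1" for i
  define p where "p g = (\<lambda>i. t i - g i)" for g
  have gt: "g i \<le> t i \<and> real (t i) \<le> y $ i" if "g \<in> S" for g i
  proof -
    have "real (g i) < y $ i" using that unfolding S_def strict_less_def gvec_def by simp
    then show ?thesis unfolding t_def by linarith
  qed
  have "inj_on p S"
  proof (rule inj_onI)
    fix g h assume *: "g \<in> S" "h \<in> S" "p g = p h"
    show "g = h"
    proof
      fix i show "g i = h i"
        using gt[OF *(1), of i] gt[OF *(2), of i] fun_cong[OF *(3), of i] unfolding p_def by linarith
    qed
  qed
  moreover have "p ` S \<subseteq> {g. \<forall>i. g i \<le> nat \<lfloor>c\<rfloor>}"
  proof safe
    fix g i assume g: "g \<in> S"
    have "p g i \<le> sum (p g) UNIV" by (rule coord_le_sum)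
    then have "real (p g i) \<le> real (sum (p g) UNIV)" by (simp only: of_nat_le_iff)
    also have "\<dots> = (\<Sum>i\<in>UNIV. real (t i) - real (g i))"
      unfolding p_def of_nat_sum by (intro sum.cong) (use gt[OF g] in \<open>auto simp: of_nat_diff\<close>)
    also have "\<dots> \<le> (\<Sum>i\<in>UNIV. y $ i - real (g i))"
      by (intro sum_mono) (use gt[OF g] in auto)
    also have "\<dots> = coord_sum y - real (sum g UNIV)" unfolding coord_sum_def by (simp add: sum_subtractf)
    also have "\<dots> \<le> c" using g unfolding S_def by simp
    finally show "p g i \<le> nat \<lfloor>c\<rfloor>" by linarith
  qed
  ultimately have "card S \<le> (nat \<lfloor>c\<rfloor> + 1) ^ CARD('d)"
    using card_inj_on_le[OF _ _ finite_box] unfolding card_box by metis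
  then have "real (card S) \<le> real (nat \<lfloor>c\<rfloor> + 1) ^ CARD('d)" by (metis of_nat_le_iff of_nat_power)
  also have "\<dots> \<le> (c + 1) ^ CARD('d)" by (intro power_mono) (use assms in linarith)+
  finally show ?thesis unfolding S_def .
qed

text \<open>Rounding up costs at most 1 per coordinate and only makes domination harder. Domination
  of all lattice points below a level thus passes to the whole orthant at a constant loss in
  level.\<close>

lemma lattice_point_above:
  fixes z :: "real^'d"
  assumes "z \<in> nonneg_orthant"
  obtains g where "real (sum g UNIV) \<le> coord_sum z + real CARD('d)"
    "\<And>x n. dominated x n (gvec g) \<Longrightarrow> dominated x n z"
proof -
  define g where "g i = nat \<lceil>z $ i\<rceil>" for i
  have g: "z $ i \<le> real (g i)" "real (g i) \<le> z $ i + 1" for i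
  proof -
    have "0 \<le> z $ i" using assms unfolding nonneg_orthant_def by simp
    then show "z $ i \<le> real (g i)" "real (g i) \<le> z $ i + 1" unfolding g_def by linarith+
  qed
  have "real (sum g UNIV) \<le> (\<Sum>i\<in>UNIV. z $ i + 1)" unfolding of_nat_sum by (intro sum_mono g)
  also have "\<dots> = coord_sum z + real CARD('d)" unfolding coord_sum_def by (simp add: sum.distrib)
  finally have s: "real (sum g UNIV) \<le> coord_sum z + real CARD('d)" .
  have "strict_less z y" if "strict_less (gvec g) y" for y
    unfolding strict_less_def
  proof
    fix i
    have "real (g i) < y $ i" using that unfolding strict_less_def gvec_def by simp
    then show "z $ i < y $ i" using g(1)[of i] by linarith
  qed
  then have "dominated x n z" if "dominated x n (gvec g)" for x n
    using that unfolding dominated_def by blast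
  then show thesis using s that by blast
qed

lemma Rcount_mono: "m \<le> n \<Longrightarrow> Rcount x m \<le> Rcount x n"
  unfolding Rcount_def by (intro card_mono) auto

lemma Rcount_diff:
  assumes "m \<le> n"
  shows "real (Rcount x n) - real (Rcount x m) = real (card {k \<in> {m<..n}. is_record x k})"
proof -
  have "{k \<in> {1..n}. is_record x k} = {k \<in> {1..m}. is_record x k} \<union> {k \<in> {m<..n}. is_record x k}"
    using assms by auto
  then have "Rcount x n = Rcount x m + card {k \<in> {m<..n}. is_record x k}"
    unfolding Rcount_def by (simp add: card_Un_disjoint disjoint_iff)
  then show ?thesis by simp
qed

text \<open>An earlier observation dominating the first dominator \<open>x k\<close> would, by
  transitivity, already dominate \<open>z\<close>. Hence \<open>x k\<close> is a record.\<close>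

lemma first_dominator:
  assumes "\<not> dominated x m z" "dominated x n z"
  shows "\<exists>k\<in>{m<..n}. is_record x k \<and> strict_less z (x k) \<and> \<not> dominated x (k - 1) z"
proof -
  define k where "k = (LEAST k. dominated x k z)"
  have k: "dominated x k z" and min: "\<And>l. l < k \<Longrightarrow> \<not> dominated x l z"
    unfolding k_def using assms(2) by (auto intro: LeastI dest: not_less_Least)
  have "m < k" using assms(1) k dominated_mono by (metis not_less)
  moreover have "k \<le> n" unfolding k_def using assms(2) by (rule Least_le)
  moreover have k1: "\<not> dominated x (k - 1) z" using min[of "k - 1"] \<open>m < k\<close> by auto
  moreover have zk: "strict_less z (x k)"
  proof -
    obtain i where i: "i \<in> {1..k}" "strict_less z (x i)" using k unfolding dominated_def by blast
    have "\<not> i \<le> k - 1" using k1 i unfolding dominated_def by auto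
    then have "i = k" using i(1) by auto
    then show ?thesis using i(2) by simp
  qed
  moreover have "is_record x k"
    unfolding is_record_iff using k1 strict_less_trans[OF zk] \<open>m < k\<close> unfolding dominated_def by fastforce
  ultimately show ?thesis by auto
qed

text \<open>Each point of \<open>Z\<close> is charged to its first dominator, a record in the
  window, and no record is charged with more than \<open>c\<close> points.\<close>

lemma card_le_records:
  assumes "finite Z" "m \<le> n"
    and Z: "\<And>g. g \<in> Z \<Longrightarrow> \<not> dominated x m (gvec g) \<and> dominated x n (gvec g)"
    and c: "\<And>k. k \<in> {m<..n} \<Longrightarrow>
      real (card {g. strict_less (gvec g) (x k) \<and> \<not> dominated x (k - 1) (gvec g)}) \<le> c"
  shows "real (card Z) \<le> (real (Rcount x n) - real (Rcount x m)) * c"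
proof -
  define G where "G k = {g. strict_less (gvec g) (x k) \<and> \<not> dominated x (k - 1) (gvec g)}" for k
  define K where "K = {k \<in> {m<..n}. is_record x k}"
  have fin: "finite (G k)" for k
    unfolding G_def by (rule finite_subset[OF _ finite_below[of "x k"]]) (simp add: Collect_mono)
  have finK: "finite K" unfolding K_def by simp
  have "Z \<subseteq> (\<Union>k\<in>K. G k)"
  proof
    fix g assume "g \<in> Z"
    then obtain k where "k \<in> K" "g \<in> G k"
      using first_dominator[of x m "gvec g" n] Z[of g] unfolding K_def G_def by blast
    then show "g \<in> (\<Union>k\<in>K. G k)" by blast
  qed
  then have "card Z \<le> card (\<Union>k\<in>K. G k)" using fin finK by (intro card_mono finite_UN_I)
  also have "\<dots> \<le> (\<Sum>k\<in>K. card (G k))" by (rule card_UN_le[OF finK])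
  finally have "real (card Z) \<le> (\<Sum>k\<in>K. real (card (G k)))"
    unfolding of_nat_sum[symmetric] of_nat_le_iff .
  also have "\<dots> \<le> (\<Sum>k\<in>K. c)"
  proof (rule sum_mono)
    fix k assume "k \<in> K"
    then show "real (card (G k)) \<le> c" unfolding G_def K_def using c[of k] by simp
  qed
  finally show ?thesis unfolding Rcount_diff[OF assms(2)] K_def by simp
qed

lemma dyadic_block:
  assumes "2 \<le> (n::nat)"
  obtains i where "2 ^ i < n" "n \<le> 2 ^ (i + 1)"
proof -
  define i where "i = (LEAST i. n \<le> 2 ^ (i + 1))"
  have "n \<le> 2 ^ (n + 1)" by (rule order_trans[OF less_imp_le[OF less_exp]]) simp
  then have i: "n \<le> 2 ^ (i + 1)" unfolding i_def by (rule LeastI)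
  have "2 ^ i < n"
  proof (cases i)
    case 0 then show ?thesis using assms by simp
  next
    case (Suc l)
    then have "\<not> n \<le> 2 ^ (l + 1)" using not_less_Least[of l "\<lambda>i. n \<le> 2 ^ (i + 1)"] unfolding i_def by simp
    then show ?thesis using Suc by simp
  qed
  then show ?thesis using i that by blast
qed

lemma polylog_le_powr:
  assumes "0 < C" "0 < e"
  shows "\<forall>\<^sub>F j in sequentially. (C * ln (real j) + 1) ^ k \<le> real j powr e"
proof -
  have "\<forall>\<^sub>F j in sequentially. (C * ln (real j) + 1) powr (real k) \<le> real j powr e"
    using assms by real_asymp
  moreover have "\<forall>\<^sub>F j in sequentially. 0 < C * ln (real j) + 1"
    using assms by real_asymp
  ultimately show ?thesis by eventually_elim (simp add: powr_realpow)
qed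

section \<open>Deterministic growth of the record count\<close>

text \<open>The expected number of the first \<open>2 ^ j\<close> observations above
  \<open>lev s j\<close> is of order \<open>j powr (d - 1 - s)\<close>. It is summable in
  \<open>j\<close> for \<open>s > d\<close> and tends to infinity for \<open>s < d - 1\<close>,
  which gives the two thresholds. In the last assumption \<open>t\<close> is positive because a few
  exceedances remain possible even where the expectation tends to 0.\<close>

locale regular_path = positive_path x for x :: "nat \<Rightarrow> real^'d" +
  assumes lattice_dominated: "\<And>e. 0 < e \<Longrightarrow> \<forall>\<^sub>F j in sequentially.
      \<forall>g. real (sum g UNIV) \<le> lev (-e) j \<longrightarrow> dominated x (2 ^ j) (gvec g)"
    and sum_upper: "\<And>s. real CARD('d) < s \<Longrightarrow> \<forall>\<^sub>F j in sequentially.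
      \<forall>i\<in>{1..2^j}. coord_sum (x i) \<le> lev s j"
    and sum_lower: "\<And>s. s < real CARD('d) - 1 \<Longrightarrow> \<forall>\<^sub>F j in sequentially.
      \<exists>i\<in>{1..2^j}. lev s j < coord_sum (x i)"
    and exceed_count: "\<And>s t. 0 < t \<Longrightarrow> real CARD('d) - 1 - s < t \<Longrightarrow> \<forall>\<^sub>F j in sequentially.
      real (card {i\<in>{1..2^j}. lev s j < coord_sum (x i)}) \<le> real j powr t"
begin

lemma d_ge_1: "1 \<le> real CARD('d)"
  using zero_less_card_finite[where ?'a = 'd] by linarith

text \<open>Rounding up to the lattice costs \<open>d\<close>, which half of \<open>e * ln j\<close>
  absorbs.\<close>

lemma orthant_dominated:
  assumes "0 < e"
  shows "\<forall>\<^sub>F j in sequentially. \<forall>z\<in>nonneg_orthant. coord_sum z \<le> lev (-e) j \<longrightarrow> dominated x (2 ^ j) z"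
proof -
  have "\<forall>\<^sub>F j in sequentially. real CARD('d) \<le> (e / 2) * ln (real j)"
    using assms by real_asymp
  moreover have "\<forall>\<^sub>F j in sequentially.
      \<forall>g. real (sum g UNIV) \<le> lev (-(e/2)) j \<longrightarrow> dominated x (2 ^ j) (gvec g)"
    using lattice_dominated[of "e / 2"] assms by simp
  ultimately show ?thesis
  proof eventually_elim
    case (elim j)
    show ?case
    proof (intro ballI impI)
      fix z :: "real^'d" assume z: "z \<in> nonneg_orthant" "coord_sum z \<le> lev (-e) j"
      obtain g where g: "real (sum g UNIV) \<le> coord_sum z + real CARD('d)"
        "\<And>x n. dominated x n (gvec g) \<Longrightarrow> dominated x n z"
        using lattice_point_above[OF z(1)] by blast
      note g(1)
      also have "coord_sum z + real CARD('d) \<le> lev (-(e/2)) j"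
        using z(2) elim(1) unfolding lev_def by (simp add: field_simps)
      finally show "dominated x (2 ^ j) z" using elim(2) g(2) by blast
    qed
  qed
qed

text \<open>By the domination of all low lattice points a record can be the first dominator only of
  lattice points within logarithmic distance below it.\<close>

lemma first_dominated_bound:
  "\<exists>J. \<forall>j1\<ge>J. \<forall>j2\<ge>j1. \<forall>k\<in>{2^j1<..2^j2}.
     real (card {g. strict_less (gvec g) (x k) \<and> \<not> dominated x (k - 1) (gvec g)})
       \<le> ((real CARD('d) + 4) * ln (real j2) + 1) ^ CARD('d)"
proof -
  have ev: "\<forall>\<^sub>F i in sequentially. 2 \<le> real i"
    by real_asymp
  have "\<forall>\<^sub>F i in sequentially.
      (\<forall>g. real (sum g UNIV) \<le> lev (-1) i \<longrightarrow> dominated x (2 ^ i) (gvec g)) \<and>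
      (\<forall>k\<in>{1..2^(i+1)}. coord_sum (x k) \<le> lev (real CARD('d) + 1) (i + 1)) \<and> 2 \<le> real i"
    using lattice_dominated[OF zero_less_one] sequentially_offset[OF sum_upper[of "real CARD('d) + 1"], of 1] ev
    by (simp add: eventually_conj_iff del: of_nat_sum)
  then obtain J where J: "\<And>i g. J \<le> i \<Longrightarrow> real (sum g UNIV) \<le> lev (-1) i \<Longrightarrow> dominated x (2 ^ i) (gvec g)"
    "\<And>i k. J \<le> i \<Longrightarrow> k \<in> {1..2^(i+1)} \<Longrightarrow> coord_sum (x k) \<le> lev (real CARD('d) + 1) (i + 1)"
    "\<And>i. J \<le> i \<Longrightarrow> 2 \<le> real i"
    unfolding eventually_sequentially by blast
  show ?thesis
  proof (intro exI[of _ J] allI impI ballI)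
    fix j1 j2 k :: nat assume j: "J \<le> j1" "j1 \<le> j2" and k: "k \<in> {2^j1<..2^j2}"
    have kk: "2 ^ j1 < k" "k \<le> 2 ^ j2" using k by auto
    have "(1::nat) \<le> 2 ^ j1" by simp
    then have "2 \<le> k" using kk(1) by linarith
    then obtain i where i: "2 ^ i < k" "k \<le> 2 ^ (i + 1)" by (rule dyadic_block)
    have "(2::nat) ^ j1 < 2 ^ (i + 1)" "(2::nat) ^ i < 2 ^ j2"
      using less_le_trans[OF kk(1) i(2)] less_le_trans[OF i(1) kk(2)] .
    then have "j1 < i + 1" "i < j2"
      by (meson one_less_numeral_iff power_less_imp_less_exp semiring_norm(76))+
    then have ij: "j1 \<le> i" "i + 1 \<le> j2" by auto
    have i2: "2 \<le> real i" "real i + 1 \<le> real j2" using J(3)[of i] ij j by simp_all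
    \<comment> \<open>The gap \<open>lev (d + 1) (i + 1) - lev (-1) i\<close> consists of at most
      \<open>d + 3\<close> terms, each bounded by \<open>ln j2\<close>; the factor
      \<open>d + 4\<close> leaves some slack.\<close>
    define c where "c = (real CARD('d) + 4) * ln (real j2)"
    have lnj: "ln 2 \<le> ln (real j2)" "ln (real i) \<le> ln (real j2)" "ln (real i + 1) \<le> ln (real j2)" "0 \<le> ln (real j2)"
      using i2 by simp_all
    have "{g. strict_less (gvec g) (x k) \<and> \<not> dominated x (k - 1) (gvec g)}
        \<subseteq> {g. strict_less (gvec g) (x k) \<and> coord_sum (x k) - c \<le> real (sum g UNIV)}"
    proof safe
      fix g assume g: "strict_less (gvec g) (x k)" "\<not> dominated x (k - 1) (gvec g)"
      have "2 ^ i \<le> k - 1" using i(1) by linarith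
      then have "\<not> dominated x (2 ^ i) (gvec g)" using g(2) dominated_mono by blast
      then have "lev (-1) i < real (sum g UNIV)" using J(1)[of i g] ij j by linarith
      moreover have "coord_sum (x k) \<le> lev (real CARD('d) + 1) (i + 1)" using J(2)[of i k] ij j i by simp
      moreover have "lev (real CARD('d) + 1) (i + 1) - lev (-1) i \<le> c"
      proof -
        have "lev (real CARD('d) + 1) (i + 1) - lev (-1) i = ln 2 + (real CARD('d) + 1) * ln (real i + 1) + ln (real i)"
          unfolding lev_def by (simp add: algebra_simps)
        also have "\<dots> \<le> ln (real j2) + (real CARD('d) + 1) * ln (real j2) + ln (real j2)"
          using lnj d_ge_1 by (intro add_mono mult_left_mono) auto
        also have "\<dots> \<le> c" unfolding c_def using lnj(4) by (simp add: algebra_simps)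
        finally show ?thesis .
      qed
      ultimately show "coord_sum (x k) - c \<le> real (sum g UNIV)" by linarith
    qed
    then have "card {g. strict_less (gvec g) (x k) \<and> \<not> dominated x (k - 1) (gvec g)}
       \<le> card {g. strict_less (gvec g) (x k) \<and> coord_sum (x k) - c \<le> real (sum g UNIV)}"
      by (rule card_mono[rotated]) (rule finite_subset[OF _ finite_below[of "x k"]], simp add: Collect_mono)
    moreover have "0 \<le> c" unfolding c_def using lnj d_ge_1 by simp
    then have "real (card {g. strict_less (gvec g) (x k) \<and> coord_sum (x k) - c \<le> real (sum g UNIV)}) \<le> (c + 1) ^ CARD('d)"
      by (rule card_just_below)
    ultimately show "real (card {g. strict_less (gvec g) (x k) \<and> \<not> dominated x (k - 1) (gvec g)})
       \<le> ((real CARD('d) + 4) * ln (real j2) + 1) ^ CARD('d)"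
      unfolding c_def by linarith
  qed
qed

text \<open>The records in the window must account for all of \<open>Z\<close>, and each accounts
  for polylogarithmically many points, bounded here by an arbitrarily small power. The threshold
  \<open>J\<close> is the same for all windows and all \<open>Z\<close>.\<close>

lemma Rcount_growth:
  assumes "0 < e"
  obtains J where "\<And>j1 j2 Z. J \<le> j1 \<Longrightarrow> j1 \<le> j2 \<Longrightarrow> finite Z \<Longrightarrow>
    (\<forall>g\<in>Z. \<not> dominated x (2^j1) (gvec g) \<and> dominated x (2^j2) (gvec g)) \<Longrightarrow>
    real (card Z) \<le> (real (Rcount x (2^j2)) - real (Rcount x (2^j1))) * real j2 powr e"
proof -
  obtain J1 where J1: "\<And>j1 j2 k. J1 \<le> j1 \<Longrightarrow> j1 \<le> j2 \<Longrightarrow> k\<in>{2^j1<..2^j2} \<Longrightarrow>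
     real (card {g. strict_less (gvec g) (x k) \<and> \<not> dominated x (k - 1) (gvec g)})
       \<le> ((real CARD('d) + 4) * ln (real j2) + 1) ^ CARD('d)"
    using first_dominated_bound by blast
  have "0 < real CARD('d) + 4" using d_ge_1 by simp
  then obtain J2 where J2: "\<And>j. J2 \<le> j \<Longrightarrow> ((real CARD('d) + 4) * ln (real j) + 1) ^ CARD('d) \<le> real j powr e"
    using polylog_le_powr[of "real CARD('d) + 4" e "CARD('d)"] assms unfolding eventually_sequentially by blast
  show thesis
  proof (rule that[of "max J1 J2"])
    fix j1 j2 :: nat and Z :: "('d \<Rightarrow> nat) set"
    assume j: "max J1 J2 \<le> j1" "j1 \<le> j2" and "finite Z"
      and Z: "\<forall>g\<in>Z. \<not> dominated x (2^j1) (gvec g) \<and> dominated x (2^j2) (gvec g)"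
    show "real (card Z) \<le> (real (Rcount x (2^j2)) - real (Rcount x (2^j1))) * real j2 powr e"
    proof (rule card_le_records[OF \<open>finite Z\<close>])
      show "(2::nat) ^ j1 \<le> 2 ^ j2" using j by simp
      show "\<not> dominated x (2^j1) (gvec g) \<and> dominated x (2^j2) (gvec g)" if "g \<in> Z" for g using Z that by blast
      show "real (card {g. strict_less (gvec g) (x k) \<and> \<not> dominated x (k - 1) (gvec g)}) \<le> real j2 powr e"
        if "k \<in> {2^j1<..2^j2}" for k
        using J1[OF _ j(2) that] J2[of j2] j by linarith
    qed
  qed
qed

end

section \<open>Record times as an inverse of the record count\<close>

lemma Rcount_record_time:
  assumes inf: "infinite {k. is_record x k}" and m: "1 \<le> m"
  shows "Rcount x (record_time x m) = m" "\<And>n. n < record_time x m \<Longrightarrow> Rcount x n < m" "1 \<le> record_time x m"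
proof -
  define S where "S = {k. is_record x k}"
  have S: "is_record x k \<longleftrightarrow> k \<in> S" for k unfolding S_def by simp
  have infS: "infinite S" unfolding S_def by (rule inf)
  have T: "record_time x m = enumerate S (m - 1)" unfolding record_time_def S_def ..
  have rec: "is_record x (record_time x m)" unfolding S T by (rule enumerate_in_set[OF infS])
  then show T1: "1 \<le> record_time x m" by (simp add: is_record_iff)
  have "{k \<in> {1..record_time x m}. is_record x k} = enumerate S ` {..<m}"
  proof (intro set_eqI iffI)
    fix k assume "k \<in> {k \<in> {1..record_time x m}. is_record x k}"
    then have k: "k \<le> enumerate S (m - 1)" "k \<in> S" unfolding T S by auto
    obtain l where l: "enumerate S l = k" using enumerate_Ex[OF infS k(2)] by blast
    then have "enumerate S l \<le> enumerate S (m - 1)" using k(1) by simp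
    then have "l < m" using infS m by (simp add: enumerate_mono_le_iff)
    then show "k \<in> enumerate S ` {..<m}" using l by blast
  next
    fix k assume "k \<in> enumerate S ` {..<m}"
    then obtain l where l: "l < m" "k = enumerate S l" by blast
    have "k \<in> S" unfolding l(2) by (rule enumerate_in_set[OF infS])
    moreover from this have "1 \<le> k" unfolding S[symmetric] is_record_iff by blast
    moreover have "k \<le> enumerate S (m - 1)" unfolding l(2) using l(1) infS by (simp add: enumerate_mono_le_iff)
    ultimately show "k \<in> {k \<in> {1..record_time x m}. is_record x k}" unfolding T S by simp
  qed
  moreover have "inj_on (enumerate S) {..<m}" using inj_enumerate[OF infS] by (rule inj_on_subset) simp
  ultimately show R: "Rcount x (record_time x m) = m" unfolding Rcount_def by (simp add: card_image)
  fix n assume n: "n < record_time x m"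
  have "record_time x m \<in> {k \<in> {1..record_time x m}. is_record x k} - {k \<in> {1..n}. is_record x k}"
    using rec n T1 by simp
  moreover have "{k \<in> {1..n}. is_record x k} \<subseteq> {k \<in> {1..record_time x m}. is_record x k}"
    using n by auto
  ultimately have "{k \<in> {1..n}. is_record x k} \<subset> {k \<in> {1..record_time x m}. is_record x k}"
    by blast
  then have "Rcount x n < Rcount x (record_time x m)"
    unfolding Rcount_def by (rule psubset_card_mono[rotated]) simp
  then show "Rcount x n < m" unfolding R .
qed

text \<open>After the last record up to time \<open>n\<close> no further point becomes dominated,
  because its first dominator would be a record. The region is thus constant between records, and a
  width at an arbitrary time can be read off along record indices.\<close>

lemma Wtilde_Rcount:
  assumes inf: "infinite {k. is_record x k}" and n: "1 \<le> Rcount x n"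
  shows "Wtilde x (Rcount x n) = Wwidth x n"
proof -
  define T where "T = record_time x (Rcount x n)"
  have R: "Rcount x T = Rcount x n" and "\<not> n < T"
    unfolding T_def using Rcount_record_time[OF inf n] by auto
  then have "T \<le> n" by simp
  have "real (card {k \<in> {T<..n}. is_record x k}) = 0" using Rcount_diff[OF \<open>T \<le> n\<close>, of x] R by simp
  then have no: "\<not> is_record x k" if "k \<in> {T<..n}" for k using that by auto
  have "dominated x n z \<longleftrightarrow> dominated x T z" for z
  proof
    show "dominated x T z" if "dominated x n z" using first_dominator[of x T z n] that no by blast
    show "dominated x n z" if "dominated x T z" using dominated_mono[OF that \<open>T \<le> n\<close>] .
  qed
  then have "RS x n = RS x T" unfolding RS_eq by simp
  then show ?thesis unfolding Wtilde_def T_def[symmetric] Wwidth_def Fplus_def Fminus_def frontierRS_def by simp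
qed

lemma finite_dominated: "finite {g. dominated x n (gvec g)}" for x :: "nat \<Rightarrow> real^'d"
proof -
  have "{g. dominated x n (gvec g)} = (\<Union>i\<in>{1..n}. {g. strict_less (gvec g) (x i)})"
    unfolding dominated_def by auto
  also have "finite \<dots>" by (intro finite_UN_I finite_below) simp
  finally show ?thesis .
qed

text \<open>As \<open>ln 2\<close> is at least 2/3, a margin of \<open>j / 6\<close> is left for the
  logarithm and for rounding.\<close>

lemma lev_ge_half: "\<forall>\<^sub>F j in sequentially. real j / 2 \<le> real (nat \<lfloor>lev s j\<rfloor>) \<and> real j / 2 \<le> lev s j"
proof -
  have "\<forall>\<^sub>F j in sequentially. real j / 2 + 1 \<le> real j * (2/3) + s * ln (real j)"
    by real_asymp
  then show ?thesis unfolding lev_def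
  proof eventually_elim
    case (elim j)
    have "real j * (2/3) \<le> real j * ln 2" using ln2_ge_two_thirds by (intro mult_left_mono) auto
    then show ?case using elim by linarith
  qed
qed

section \<open>Growth of the record count at dyadic times\<close>

context regular_path begin

text \<open>Of the order of \<open>j powr d\<close> lattice points lie below
  \<open>lev (-1) j\<close>, all dominated by time \<open>2 ^ j\<close>. Each record after time
  \<open>2 ^ J\<close> is the first dominator of at most \<open>j powr (e/3)\<close> of them. The
  finitely many points \<open>K\<close> dominated before are discarded, since the charging bound
  only starts at \<open>J\<close>.\<close>

lemma Rcount_lower:
  assumes "0 < e"
  shows "\<forall>\<^sub>F j in sequentially. real j powr (real CARD('d) - e) \<le> real (Rcount x (2^j))"
proof -
  obtain J where J: "\<And>j1 j2 Z. J \<le> j1 \<Longrightarrow> j1 \<le> j2 \<Longrightarrow> finite Z \<Longrightarrow>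
      (\<forall>g\<in>Z. \<not> dominated x (2^j1) (gvec g) \<and> dominated x (2^j2) (gvec g)) \<Longrightarrow>
    real (card Z) \<le> (real (Rcount x (2^j2)) - real (Rcount x (2^j1))) * real j2 powr (e/3)"
    using Rcount_growth[of "e/3"] assms by (metis divide_pos_pos zero_less_numeral)
  define K where "K = {g. dominated x (2^J) (gvec g)}"
  \<comment> \<open>From \<open>N \<ge> j / 2\<close> and the cube of side about
    \<open>N / d\<close> inside the simplex.\<close>
  define c where "c = (1 / (2 * real CARD('d))) ^ CARD('d)"
  have "0 < c" unfolding c_def using d_ge_1 by simp
  then have "\<forall>\<^sub>F j in sequentially. real j powr (real CARD('d) - e/3) \<le> c * real j ^ CARD('d) - real (card K)"
    using assms by real_asymp
  moreover have "\<forall>\<^sub>F j in sequentially. \<forall>g. real (sum g UNIV) \<le> lev (-1) j \<longrightarrow> dominated x (2 ^ j) (gvec g)"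
    using lattice_dominated[OF zero_less_one] .
  moreover have "\<forall>\<^sub>F j in sequentially. J \<le> j \<and> 1 \<le> j" using eventually_ge_at_top[of "max J 1"] by simp
  ultimately show ?thesis using lev_ge_half[of "-1"]
  proof eventually_elim
    case (elim j)
    define N where "N = nat \<lfloor>lev (-1) j\<rfloor>"
    define Z where "Z = {g::'d \<Rightarrow> nat. sum g UNIV \<le> N} - K"
    have "0 \<le> lev (-1) j" using elim(4) by simp
    then have N: "real N \<le> lev (-1) j" unfolding N_def by linarith
    have fin: "finite Z" unfolding Z_def using finite_simplex by blast
    have "real (card Z) \<le> (real (Rcount x (2^j)) - real (Rcount x (2^J))) * real j powr (e/3)"
    proof (rule J)
      show "\<forall>g\<in>Z. \<not> dominated x (2^J) (gvec g) \<and> dominated x (2^j) (gvec g)"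
      proof
        fix g assume "g \<in> Z"
        then have "sum g UNIV \<le> N" "g \<notin> K" unfolding Z_def by auto
        then have "real (sum g UNIV) \<le> lev (-1) j" using N of_nat_mono[of "sum g UNIV" N, where 'a=real] by linarith
        then show "\<not> dominated x (2^J) (gvec g) \<and> dominated x (2^j) (gvec g)"
          using elim(2) \<open>g \<notin> K\<close> unfolding K_def by blast
      qed
    qed (use elim fin in auto)
    also have "\<dots> \<le> real (Rcount x (2^j)) * real j powr (e/3)" by (intro mult_right_mono) auto
    finally have up: "real (card Z) \<le> real (Rcount x (2^j)) * real j powr (e/3)" .
    have "c * real j ^ CARD('d) = (real j / 2 / real CARD('d)) ^ CARD('d)"
      unfolding c_def by (simp add: power_divide power_mult_distrib)
    also have "\<dots> \<le> (real N / real CARD('d)) ^ CARD('d)"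
      using elim(4) unfolding N_def by (intro power_mono divide_right_mono) auto
    also have "\<dots> \<le> real (card {g::'d \<Rightarrow> nat. sum g UNIV \<le> N})" by (rule card_simplex_ge)
    also have "\<dots> \<le> real (card Z) + real (card K)"
    proof -
      have "card {g::'d \<Rightarrow> nat. sum g UNIV \<le> N} \<le> card (Z \<union> K)"
        unfolding Z_def K_def using finite_simplex finite_dominated by (intro card_mono) auto
      also have "\<dots> \<le> card Z + card K" by (rule card_Un_le)
      finally show ?thesis by linarith
    qed
    finally have "real j powr (real CARD('d) - e/3) \<le> real (Rcount x (2^j)) * real j powr (e/3)"
      using elim(1) up by linarith
    then have "real j powr (real CARD('d) - e/3) * real j powr (- e/3) \<le> real (Rcount x (2^j)) * real j powr (e/3) * real j powr (- e/3)"
      by (intro mult_right_mono) auto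
    also have "\<dots> = real (Rcount x (2^j))" using elim(3) by (simp add: powr_minus field_simps)
    finally have "real j powr (real CARD('d) - e/3 - e/3) \<le> real (Rcount x (2^j))" by (simp add: powr_add[symmetric])
    moreover have "real j powr (real CARD('d) - e) \<le> real j powr (real CARD('d) - e/3 - e/3)"
      using elim(3) assms by (intro powr_mono) auto
    ultimately show ?case by linarith
  qed
qed

lemma infinite_records: "infinite {k. is_record x k}"
proof
  assume fin: "finite {k. is_record x k}"
  define K where "K = real (card {k. is_record x k})"
  define q where "q = real CARD('d) - 1/2"
  have "0 < q" unfolding q_def using d_ge_1 by linarith
  then have "\<forall>\<^sub>F j in sequentially. K < real j powr q" by real_asymp
  moreover have "\<forall>\<^sub>F j in sequentially. real j powr q \<le> real (Rcount x (2^j))"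
    unfolding q_def by (rule Rcount_lower) simp
  ultimately have "\<forall>\<^sub>F j in sequentially. K < real (Rcount x (2^j))" by eventually_elim linarith
  then obtain j where "K < real (Rcount x (2^j))" using eventually_happens' sequentially_bot by blast
  moreover have "Rcount x (2^j) \<le> card {k. is_record x k}"
    unfolding Rcount_def by (rule card_mono[OF fin]) blast
  ultimately show False unfolding K_def by linarith
qed

text \<open>All points up to \<open>lev (-(e/4)) j\<close> are dominated at time
  \<open>2 ^ j\<close>, so a record in the next block lies above that level and is counted by
  \<open>exceed_count\<close> at time \<open>2 ^ (j+1)\<close>. Counting from the lower level with
  \<open>- e / 2\<close> absorbs the shift of the index, and \<open>3 * e / 4\<close> leaves room on
  either side, above \<open>e / 2\<close> and below \<open>e\<close>.\<close>

lemma block_upper: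
  assumes "0 < e"
  shows "\<forall>\<^sub>F j in sequentially. real (Rcount x (2^(j+1))) - real (Rcount x (2^j)) \<le> real j powr (real CARD('d) - 1 + e)"
proof -
  define r where "r = real CARD('d) - 1"
  have "0 \<le> r" unfolding r_def using d_ge_1 by linarith
  have "\<forall>\<^sub>F j in sequentially. real (card {i\<in>{1..2^j}. lev (-e/2) j < coord_sum (x i)}) \<le> real j powr (real CARD('d) - 1 + 3*e/4)"
    by (rule exceed_count) (use d_ge_1 assms in linarith)+
  then have "\<forall>\<^sub>F j in sequentially. real (card {i\<in>{1..2^(j+1)}. lev (-e/2) (j+1) < coord_sum (x i)}) \<le> real (j+1) powr (real CARD('d) - 1 + 3*e/4)"
    by (rule sequentially_offset)
  moreover have "\<forall>\<^sub>F j in sequentially. \<forall>z\<in>nonneg_orthant. coord_sum z \<le> lev (-(e/4)) j \<longrightarrow> dominated x (2 ^ j) z"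
    using orthant_dominated[of "e/4"] assms by simp
  moreover have "\<forall>\<^sub>F j in sequentially. lev (-e/2) (j+1) \<le> lev (-(e/4)) j"
    unfolding lev_def using assms by real_asymp
  moreover have "\<forall>\<^sub>F j in sequentially. real (j+1) powr (real CARD('d) - 1 + 3*e/4) \<le> real j powr (real CARD('d) - 1 + e)"
    unfolding r_def[symmetric] using assms \<open>0 \<le> r\<close> by real_asymp
  ultimately show ?thesis
  proof eventually_elim
    case (elim j)
    have "{k \<in> {2^j<..2^(j+1)}. is_record x k} \<subseteq> {i\<in>{1..2^(j+1)}. lev (-e/2) (j+1) < coord_sum (x i)}"
    proof
      fix k assume "k \<in> {k \<in> {2^j<..2^(j+1)}. is_record x k}"
      then have k: "2 ^ j < k" "k \<le> 2 ^ (j+1)" "1 \<le> k" "\<not> dominated x (k - 1) (x k)"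
        unfolding is_record_iff by auto
      have "2 ^ j \<le> k - 1" using k(1) by linarith
      then have "\<not> dominated x (2 ^ j) (x k)" using k(4) dominated_mono by blast
      then have "\<not> coord_sum (x k) \<le> lev (-(e/4)) j" using elim(2) in_orthant[OF k(3)] by blast
      then show "k \<in> {i\<in>{1..2^(j+1)}. lev (-e/2) (j+1) < coord_sum (x i)}" using elim(3) k by auto
    qed
    then have "card {k \<in> {2^j<..2^(j+1)}. is_record x k} \<le> card {i\<in>{1..2^(j+1)}. lev (-e/2) (j+1) < coord_sum (x i)}"
      by (rule card_mono[rotated]) simp
    moreover have "(2::nat) ^ j \<le> 2 ^ (j + 1)" by simp
    ultimately show ?case using elim(1,4) Rcount_diff[of "2^j" "2^(j+1)" x] by linarith
  qed
qed

text \<open>Summing the block bounds costs one factor \<open>j\<close>, which raises the exponent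
  from \<open>d - 1\<close> to \<open>d\<close>.\<close>

lemma Rcount_upper:
  assumes "0 < e"
  shows "\<forall>\<^sub>F j in sequentially. real (Rcount x (2^j)) \<le> real j powr (real CARD('d) + e)"
proof -
  define p where "p = real CARD('d) - 1 + e/2"
  have "0 < p" unfolding p_def using d_ge_1 assms by linarith
  obtain J where J: "\<And>j. J \<le> j \<Longrightarrow> real (Rcount x (2^(j+1))) - real (Rcount x (2^j)) \<le> real j powr p"
    using block_upper[of "e/2"] assms unfolding eventually_sequentially p_def by auto
  have bound: "real (Rcount x (2^j)) \<le> real (Rcount x (2^J)) + real j * real j powr p" if "J \<le> j" for j
    using that
  proof (induction j rule: dec_induct)
    case base then show ?case by simp
  next
    case (step j)
    have "real j powr p \<le> real (Suc j) powr p" using \<open>0 < p\<close> by (intro powr_mono2) auto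
    then have "(real j + 1) * real j powr p \<le> real (Suc j) * real (Suc j) powr p"
      by (intro mult_mono) auto
    then have "real j * real j powr p + real j powr p \<le> real (Suc j) * real (Suc j) powr p"
      by (simp add: algebra_simps)
    then show ?case using step J[of j] by (simp del: of_nat_Suc)
  qed
  define K where "K = real (Rcount x (2^J))"
  have "\<forall>\<^sub>F j in sequentially. K + real j * real j powr p \<le> real j powr (p + 1 + e/2)"
    using assms \<open>0 < p\<close> by real_asymp
  moreover have "p + 1 + e/2 = real CARD('d) + e" unfolding p_def by simp
  ultimately have "\<forall>\<^sub>F j in sequentially. K + real j * real j powr p \<le> real j powr (real CARD('d) + e)"
    by simp
  then show ?thesis using eventually_ge_at_top[of J]
  proof eventually_elim
    case (elim j)
    then show ?case using bound[of j] unfolding K_def by linarith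
  qed
qed

lemma undominated_level:
  assumes "2 \<le> CARD('d)" "0 < e0" "0 < e"
  shows "\<forall>\<^sub>F j in sequentially. real j powr (real CARD('d) - 1 - e) \<le>
    real (card {g::'d \<Rightarrow> nat. sum g UNIV = nat \<lceil>lev e0 j\<rceil> \<and> \<not> dominated x (2^j) (gvec g)})"
proof -
  have d2: "2 \<le> real CARD('d)" using assms(1) by simp
  \<comment> \<open>\<open>exceed_count\<close> needs \<open>t\<close> above both 0 and
    \<open>d - 1 - e0\<close>, while \<open>t < d - 1\<close> makes the dominated points negligible
    among the roughly \<open>j powr (d - 1)\<close> points of the level. Such a \<open>t\<close>
    exists because \<open>d \<ge> 2\<close>. The remaining gap leaves room for \<open>h\<close>,
    which pays for the polylogarithmic factor.\<close>
  define t where "t = max ((real CARD('d) - 1)/2) (real CARD('d) - 1 - e0/2)"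
  have t: "0 < t" "real CARD('d) - 1 - e0 < t" "t < real CARD('d) - 1" unfolding t_def using d2 assms(2) by (auto simp: max_def)
  define h where "h = (real CARD('d) - 1 - t) / 2"
  have h: "0 < h" "t + h < real CARD('d) - 1" unfolding h_def using t by (auto simp: field_simps)
  define u where "u = t + h"
  have u: "u < real CARD('d) - 1" unfolding u_def by (rule h(2))
  define c where "c = (1 / (2 * real CARD('d))) ^ (CARD('d) - 1)"
  have "0 < c" unfolding c_def using d_ge_1 by simp
  define r where "r = real CARD('d) - 1"
  have "\<forall>\<^sub>F j in sequentially. real j powr (r - e) \<le> c * real j powr r - real j powr u"
    using \<open>0 < c\<close> u assms(3) unfolding r_def[symmetric] by real_asymp
  moreover have "\<forall>\<^sub>F j in sequentially. ((real CARD('d) + 1) * ln (real j) + 1) ^ CARD('d) \<le> real j powr h"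
    using h(1) d2 by (intro polylog_le_powr) auto
  moreover have "\<forall>\<^sub>F j in sequentially. \<forall>i\<in>{1..2^j}. coord_sum (x i) \<le> lev (real CARD('d) + 1) j"
    by (rule sum_upper) simp
  moreover have "\<forall>\<^sub>F j in sequentially. 1 \<le> j" by (rule eventually_ge_at_top)
  ultimately show ?thesis using exceed_count[OF t(1,2)] lev_ge_half[of e0]
  proof eventually_elim
    case (elim j)
    define N where "N = nat \<lceil>lev e0 j\<rceil>"
    have N: "lev e0 j \<le> real N" "real j / 2 \<le> real N" using elim(6) unfolding N_def by linarith+
    define I where "I = {i\<in>{1..2^j}. lev e0 j < coord_sum (x i)}"
    define L where "L = {g::'d \<Rightarrow> nat. sum g UNIV = N}"
    define Dom where "Dom = {g::'d \<Rightarrow> nat. sum g UNIV = N \<and> dominated x (2^j) (gvec g)}"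
    define U where "U = {g::'d \<Rightarrow> nat. sum g UNIV = N \<and> \<not> dominated x (2^j) (gvec g)}"
    \<comment> \<open>A dominator of a point on the level has sum at most
      \<open>lev (d + 1) j\<close>, so the point lies at most \<open>b\<close> below it and
      \<open>card_just_below\<close> applies.\<close>
    define b where "b = (real CARD('d) + 1) * ln (real j)"
    have lnj: "0 \<le> ln (real j)" using elim(4) by simp
    have b0: "0 \<le> b" unfolding b_def using lnj d_ge_1 by simp
    define S where "S i = {g. strict_less (gvec g) (x i) \<and> coord_sum (x i) - b \<le> real (sum g UNIV)}" for i
    have finS: "finite (S i)" for i
      unfolding S_def by (rule finite_subset[OF _ finite_below[of "x i"]]) (simp add: Collect_mono)
    have finI: "finite I" unfolding I_def by simp
    have "Dom \<subseteq> (\<Union>i\<in>I. S i)"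
    proof
      fix g assume "g \<in> Dom"
      then have g: "sum g UNIV = N" "dominated x (2^j) (gvec g)" unfolding Dom_def by auto
      then obtain i where i: "i \<in> {1..2^j}" "strict_less (gvec g) (x i)" unfolding dominated_def by blast
      have "real N < coord_sum (x i)" using coord_sum_strict_mono[OF i(2)] g(1) unfolding coord_sum_gvec by simp
      then have "i \<in> I" using i(1) N(1) unfolding I_def by simp
      moreover have "coord_sum (x i) \<le> lev (real CARD('d) + 1) j" using elim(3) i(1) by blast
      then have "coord_sum (x i) - b \<le> lev e0 j"
        using mult_nonneg_nonneg[OF less_imp_le[OF assms(2)] lnj] unfolding b_def lev_def by linarith
      then have "coord_sum (x i) - b \<le> real (sum g UNIV)" unfolding g(1) using N(1) by linarith
      then have "g \<in> S i" unfolding S_def using i(2) by blast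
      ultimately show "g \<in> (\<Union>i\<in>I. S i)" by blast
    qed
    then have "card Dom \<le> card (\<Union>i\<in>I. S i)" using finS finI by (intro card_mono finite_UN_I)
    also have "\<dots> \<le> (\<Sum>i\<in>I. card (S i))" by (rule card_UN_le[OF finI])
    finally have "real (card Dom) \<le> (\<Sum>i\<in>I. real (card (S i)))" unfolding of_nat_sum[symmetric] of_nat_le_iff .
    also have "\<dots> \<le> (\<Sum>i\<in>I. real j powr h)"
    proof (rule sum_mono)
      fix i
      have "real (card (S i)) \<le> (b + 1) ^ CARD('d)" unfolding S_def by (rule card_just_below[OF b0])
      then show "real (card (S i)) \<le> real j powr h" using elim(2) unfolding b_def by linarith
    qed
    also have "\<dots> = real (card I) * real j powr h" by simp
    also have "\<dots> \<le> real j powr t * real j powr h"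
      using elim(5) unfolding I_def by (intro mult_right_mono) auto
    also have "\<dots> = real j powr u" unfolding u_def by (simp add: powr_add)
    finally have Dom: "real (card Dom) \<le> real j powr u" .
    have "c * real j powr r = c * real j ^ (CARD('d) - 1)"
      unfolding r_def using elim(4) d_ge_1 by (simp add: powr_realpow[symmetric] of_nat_diff)
    also have "\<dots> = (real j / 2 / real CARD('d)) ^ (CARD('d) - 1)"
      unfolding c_def by (simp add: power_divide power_mult_distrib)
    also have "\<dots> \<le> (real N / real CARD('d)) ^ (CARD('d) - 1)"
      using N(2) by (intro power_mono divide_right_mono) auto
    also have "\<dots> \<le> real (card L)" unfolding L_def by (rule card_level_ge)
    also have "\<dots> \<le> real (card Dom) + real (card U)"
    proof -
      have "L = Dom \<union> U" unfolding L_def Dom_def U_def by auto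
      then have "card L \<le> card Dom + card U" using card_Un_le by simp
      then show ?thesis by linarith
    qed
    finally have "real j powr (r - e) \<le> real (card U)" using elim(1) Dom by linarith
    then show ?case unfolding U_def N_def r_def .
  qed
qed

text \<open>About \<open>j powr (d - 1)\<close> lattice points on the level \<open>lev 1 j\<close>
  are still undominated at time \<open>2 ^ j\<close>. Going on for a positive power of
  \<open>j\<close> blocks raises the dominated level by far more than \<open>ln j\<close>, so all of
  them acquire a first dominator within the window.\<close>

lemma window_lower:
  assumes "2 \<le> CARD('d)" "0 < e"
  shows "\<forall>\<^sub>F j in sequentially. \<forall>w. real j powr e \<le> real w \<longrightarrow>
    real j powr (real CARD('d) - 1 - e) \<le> real (Rcount x (2^(j+w))) - real (Rcount x (2^j))"
proof -
  \<comment> \<open>The cap \<open>1/2\<close> keeps the basic window at most \<open>j\<close> long,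
    so that \<open>j + w0 \<le> 2 * j\<close>. Longer windows follow by monotonicity of the
    count.\<close>
  define f where "f = min e (1/2)"
  have f: "0 < f" "f \<le> e" "f \<le> 1/2" unfolding f_def using assms by auto
  obtain J where J: "\<And>j1 j2 Z. J \<le> j1 \<Longrightarrow> j1 \<le> j2 \<Longrightarrow> finite Z \<Longrightarrow>
      (\<forall>g\<in>Z. \<not> dominated x (2^j1) (gvec g) \<and> dominated x (2^j2) (gvec g)) \<Longrightarrow>
    real (card Z) \<le> (real (Rcount x (2^j2)) - real (Rcount x (2^j1))) * real j2 powr (e/3)"
    using Rcount_growth[of "e/3"] assms by (metis divide_pos_pos zero_less_numeral)
  obtain J' where J': "\<And>j g. J' \<le> j \<Longrightarrow> real (sum g UNIV) \<le> lev (-1) j \<Longrightarrow> dominated x (2 ^ j) (gvec g)"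
    using lattice_dominated[OF zero_less_one] unfolding eventually_sequentially by blast
  have "\<forall>\<^sub>F j in sequentially. real j powr (real CARD('d) - 1 - e/3) \<le>
    real (card {g::'d \<Rightarrow> nat. sum g UNIV = nat \<lceil>lev 1 j\<rceil> \<and> \<not> dominated x (2^j) (gvec g)})"
    using assms by (intro undominated_level) auto
  moreover have "\<forall>\<^sub>F j in sequentially. real j powr f + 1 \<le> real j"
  proof -
    have "f < 1" using f by simp
    then show ?thesis using f(1) by real_asymp
  qed
  moreover have "\<forall>\<^sub>F j in sequentially. ln (real j) + 1 + ln (2 * real j) \<le> real j powr f * ln 2"
    using f(1) by real_asymp
  moreover have "\<forall>\<^sub>F j in sequentially. real j powr (real CARD('d) - 1 - e) * (2 * real j) powr (e/3) \<le> real j powr (real CARD('d) - 1 - e/3)"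
    using assms(2) by real_asymp
  moreover have "\<forall>\<^sub>F j in sequentially. max 1 (max J J') \<le> j" by (rule eventually_ge_at_top)
  ultimately show ?thesis using lev_ge_half[of 1]
  proof eventually_elim
    case (elim j)
    define w0 where "w0 = nat \<lceil>real j powr f\<rceil>"
    have w0: "real j powr f \<le> real w0" "real w0 \<le> real j"
      unfolding w0_def using elim(2) powr_ge_zero[of "real j" f] by linarith+
    define N where "N = nat \<lceil>lev 1 j\<rceil>"
    define Z where "Z = {g::'d \<Rightarrow> nat. sum g UNIV = N \<and> \<not> dominated x (2^j) (gvec g)}"
    have j1: "1 \<le> j" "J \<le> j" "J' \<le> j" using elim(5) by auto
    have "0 \<le> lev 1 j" using elim(6) by linarith
    then have "real N \<le> lev 1 j + 1" unfolding N_def by linarith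
    also have "\<dots> \<le> lev (-1) (j + w0)"
    proof -
      have "ln (real (j + w0)) \<le> ln (2 * real j)" using j1 w0 by (subst ln_le_cancel_iff) auto
      moreover have "real j powr f * ln 2 \<le> real w0 * ln 2" using w0 by (intro mult_right_mono) auto
      moreover have "real (j + w0) * ln 2 = real j * ln 2 + real w0 * ln 2" by (simp add: algebra_simps)
      ultimately show ?thesis unfolding lev_def using elim(3) by linarith
    qed
    finally have N: "real N \<le> lev (-1) (j + w0)" .
    have "real (card Z) \<le> (real (Rcount x (2^(j+w0))) - real (Rcount x (2^j))) * real (j+w0) powr (e/3)"
    proof (rule J)
      show "finite Z" unfolding Z_def by (rule finite_subset[OF _ finite_level[of N]]) auto
      show "\<forall>g\<in>Z. \<not> dominated x (2^j) (gvec g) \<and> dominated x (2^(j+w0)) (gvec g)"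
      proof
        fix g assume "g \<in> Z"
        then have g: "sum g UNIV = N" "\<not> dominated x (2^j) (gvec g)" unfolding Z_def by auto
        have "J' \<le> j + w0" using j1(3) by simp
        moreover have "real (sum g UNIV) \<le> lev (-1) (j + w0)" unfolding g(1) by (rule N)
        ultimately show "\<not> dominated x (2^j) (gvec g) \<and> dominated x (2^(j+w0)) (gvec g)" using J' g(2) by blast
      qed
    qed (use j1 in auto)
    also have "\<dots> \<le> (real (Rcount x (2^(j+w0))) - real (Rcount x (2^j))) * (2 * real j) powr (e/3)"
      using w0 assms(2) Rcount_mono[of "2^j" "2^(j+w0)" x] by (intro mult_left_mono powr_mono2) auto
    finally have "real j powr (real CARD('d) - 1 - e) * (2 * real j) powr (e/3)
        \<le> (real (Rcount x (2^(j+w0))) - real (Rcount x (2^j))) * (2 * real j) powr (e/3)"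
      using elim(1,4) unfolding Z_def N_def by linarith
    then have main: "real j powr (real CARD('d) - 1 - e) \<le> real (Rcount x (2^(j+w0))) - real (Rcount x (2^j))"
      using j1 by (simp add: mult_le_cancel_right)
    show ?case
    proof (intro allI impI)
      fix w assume "real j powr e \<le> real w"
      moreover have "real j powr f \<le> real j powr e" using f j1 by (intro powr_mono) auto
      ultimately have "real j powr f \<le> real w" by linarith
      then have "w0 \<le> w" unfolding w0_def by linarith
      then have "Rcount x (2^(j+w0)) \<le> Rcount x (2^(j+w))" by (intro Rcount_mono) simp
      then show "real j powr (real CARD('d) - 1 - e) \<le> real (Rcount x (2^(j+w))) - real (Rcount x (2^j))"
        using main by linarith
    qed
  qed
qed

end

text \<open>Collects what regularity gives at a single block with a single error \<open>e\<close>.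
  All quantifiers are countable, ranging over lattice points instead of the orthant, so tameness at
  \<open>j\<close> is an event.\<close>

definition tame :: "real \<Rightarrow> (nat \<Rightarrow> real^'d) \<Rightarrow> nat \<Rightarrow> bool" where
  "tame e x j \<longleftrightarrow>
    (\<forall>g. real (sum g UNIV) \<le> lev (-e) j \<longrightarrow> dominated x (2^j) (gvec g)) \<and>
    (\<exists>g. real (sum g UNIV) \<le> lev e j \<and> \<not> dominated x (2^j) (gvec g)) \<and>
    (\<forall>i\<in>{1..2^j}. coord_sum (x i) \<le> lev (real CARD('d) + e) j) \<and>
    (\<exists>i\<in>{1..2^j}. lev (real CARD('d) - 1 - e) j < coord_sum (x i)) \<and>
    real j powr (real CARD('d) - e) \<le> real (Rcount x (2^j)) \<and>
    real (Rcount x (2^j)) \<le> real j powr (real CARD('d) + e) \<and>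
    real (Rcount x (2^(j+1))) - real (Rcount x (2^j)) \<le> real j powr (real CARD('d) - 1 + e) \<and>
    (\<forall>w. real j powr e \<le> real w \<longrightarrow>
      real j powr (real CARD('d) - 1 - e) \<le> real (Rcount x (2^(j+w))) - real (Rcount x (2^j)))"

lemma (in regular_path) eventually_tame:
  assumes "2 \<le> CARD('d)" "0 < e"
  shows "\<forall>\<^sub>F j in sequentially. tame e x j"
proof -
  \<comment> \<open>Only nonemptiness of this set is wanted, for which any exponent serves.\<close>
  have "\<forall>\<^sub>F j in sequentially. real j powr (real CARD('d) - 1 - 1) \<le>
    real (card {g::'d \<Rightarrow> nat. sum g UNIV = nat \<lceil>lev (e/2) j\<rceil> \<and> \<not> dominated x (2^j) (gvec g)})"
    using assms by (intro undominated_level) auto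
  moreover have "\<forall>\<^sub>F j in sequentially. 1 \<le> (e/2) * ln (real j)"
    using assms(2) by real_asymp
  moreover have "\<forall>\<^sub>F j in sequentially. 1 \<le> j" by (rule eventually_ge_at_top)
  ultimately have "\<forall>\<^sub>F j in sequentially. \<exists>g. real (sum g UNIV) \<le> lev e j \<and> \<not> dominated x (2^j) (gvec g)"
    using lev_ge_half[of "e/2"]
  proof eventually_elim
    case (elim j)
    let ?U = "{g::'d \<Rightarrow> nat. sum g UNIV = nat \<lceil>lev (e/2) j\<rceil> \<and> \<not> dominated x (2^j) (gvec g)}"
    have "0 < real j powr (real CARD('d) - 1 - 1)" using elim(3) by simp
    then have "card ?U \<noteq> 0" using elim(1) by linarith
    then have "?U \<noteq> {}" by (metis card.empty)
    then obtain g :: "'d \<Rightarrow> nat" where g: "sum g UNIV = nat \<lceil>lev (e/2) j\<rceil>" "\<not> dominated x (2^j) (gvec g)" by blast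
    have "0 \<le> lev (e/2) j" using elim(4) by linarith
    then have "real (sum g UNIV) \<le> lev (e/2) j + 1" unfolding g(1) by linarith
    also have "\<dots> \<le> lev e j" using elim(2) unfolding lev_def by (simp add: field_simps)
    finally show ?case using g(2) by blast
  qed
  moreover have "\<forall>\<^sub>F j in sequentially. \<forall>i\<in>{1..2^j}. coord_sum (x i) \<le> lev (real CARD('d) + e) j"
    using assms(2) by (intro sum_upper) simp
  moreover have "\<forall>\<^sub>F j in sequentially. \<exists>i\<in>{1..2^j}. lev (real CARD('d) - 1 - e) j < coord_sum (x i)"
    using assms(2) by (intro sum_lower) simp
  ultimately show ?thesis
    using lattice_dominated[OF assms(2)] Rcount_lower[OF assms(2)] Rcount_upper[OF assms(2)] block_upper[OF assms(2)] window_lower[OF assms]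
    unfolding tame_def by eventually_elim blast
qed

context positive_path begin

text \<open>Everything is monotone in time. The left end \<open>2 ^ i\<close> supplies domination, a
  high observation and a lower count; the right end \<open>2 ^ (i+1)\<close> supplies an undominated
  point, a bound on all sums and an upper count.\<close>

lemma tame_block:
  assumes "tame e x i" "tame e x (i+1)" "1 \<le> i" "2^i < n" "n \<le> 2^(i+1)"
  shows "lev (-e) i - real CARD('d) \<le> Fminus x n"
    and "Fminus x n \<le> lev e (i+1)"
    and "lev (real CARD('d) - 1 - e) i \<le> Fplus x n"
    and "Fplus x n \<le> lev (real CARD('d) + e) (i+1)"
    and "(real CARD('d) - e) * ln (real i) \<le> ln (real (Rcount x n))"
    and "ln (real (Rcount x n)) \<le> (real CARD('d) + e) * ln (real i + 1)"
    and "1 \<le> Rcount x n" "real i powr (real CARD('d) - e) \<le> real (Rcount x n)"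
    and "real (Rcount x n) \<le> (real i + 1) powr (real CARD('d) + e)"
proof -
  have n1: "1 \<le> n" using assms(4) by linarith
  show "lev (-e) i - real CARD('d) \<le> Fminus x n"
  proof (rule Fminus_ge[OF n1])
    fix z :: "real^'d" assume z: "z \<in> nonneg_orthant" "coord_sum z \<le> lev (-e) i - real CARD('d)"
    obtain g where g: "real (sum g UNIV) \<le> coord_sum z + real CARD('d)"
      "\<And>x n. dominated x n (gvec g) \<Longrightarrow> dominated x n z"
      using lattice_point_above[OF z(1)] by blast
    have "real (sum g UNIV) \<le> lev (-e) i" using g(1) z(2) by linarith
    then have "dominated x (2^i) (gvec g)" using assms(1) unfolding tame_def by blast
    then have "dominated x (2^i) z" by (rule g(2))
    then show "dominated x n z" using dominated_mono assms(4) less_imp_le by blast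
  qed
  obtain g where g: "real (sum g UNIV) \<le> lev e (i+1)" "\<not> dominated x (2^(i+1)) (gvec g)"
    using assms(2) unfolding tame_def by blast
  have "gvec g \<in> RS x n" unfolding RS_eq using gvec_orthant g(2) dominated_mono assms(5) by blast
  from Fminus_le[OF n1 this] show "Fminus x n \<le> lev e (i+1)" using g(1) unfolding coord_sum_gvec by linarith
  obtain k where k: "k \<in> {1..2^i}" "lev (real CARD('d) - 1 - e) i < coord_sum (x k)"
    using assms(1) unfolding tame_def by blast
  then have "k \<in> {1..n}" using assms(4) by auto
  from Fplus_ge[OF this] show "lev (real CARD('d) - 1 - e) i \<le> Fplus x n" using k(2) by linarith
  have "\<forall>k\<in>{1..2^(i+1)}. coord_sum (x k) \<le> lev (real CARD('d) + e) (i+1)"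
    using assms(2) unfolding tame_def by blast
  then have "coord_sum (x k) \<le> lev (real CARD('d) + e) (i+1)" if "k \<in> {1..n}" for k
    using that assms(5) by auto
  then show "Fplus x n \<le> lev (real CARD('d) + e) (i+1)" by (rule Fplus_le[OF n1])
  have "Rcount x (2^i) \<le> Rcount x n" "Rcount x n \<le> Rcount x (2^(i+1))"
    using assms(4,5) by (auto intro: Rcount_mono)
  moreover have "real i powr (real CARD('d) - e) \<le> real (Rcount x (2^i))"
    "real (Rcount x (2^(i+1))) \<le> real (i+1) powr (real CARD('d) + e)"
    using assms(1,2) unfolding tame_def by blast+
  ultimately show R: "real i powr (real CARD('d) - e) \<le> real (Rcount x n)"
    "real (Rcount x n) \<le> (real i + 1) powr (real CARD('d) + e)" by (simp_all add: add.commute)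
  have "0 < real i powr (real CARD('d) - e)" using assms(3) by simp
  then have pos: "0 < real (Rcount x n)" using R(1) by linarith
  then show "1 \<le> Rcount x n" by simp
  have "ln (real i powr (real CARD('d) - e)) \<le> ln (real (Rcount x n))"
    using R(1) \<open>0 < real i powr (real CARD('d) - e)\<close> by (intro ln_mono)
  moreover have "ln (real i powr (real CARD('d) - e)) = (real CARD('d) - e) * ln (real i)"
    by (simp add: ln_powr)
  ultimately show "(real CARD('d) - e) * ln (real i) \<le> ln (real (Rcount x n))" by simp
  have "ln (real (Rcount x n)) \<le> ln ((real i + 1) powr (real CARD('d) + e))"
    using R(2) pos by (intro ln_mono)
  moreover have "ln ((real i + 1) powr (real CARD('d) + e)) = (real CARD('d) + e) * ln (real i + 1)"
    by (simp add: ln_powr)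
  ultimately show "ln (real (Rcount x n)) \<le> (real CARD('d) + e) * ln (real i + 1)" by simp
qed

end

text \<open>A record time is at least its index, since \<open>Rcount x n \<le> n\<close>. So
  \<open>m \<ge> 2 ^ (I+1)\<close> places the \<open>m\<close>th record in block \<open>I\<close> or
  later, whatever the path, and the conclusion is uniform in \<open>x\<close>.\<close>

lemma eventually_Wtilde:
  assumes S: "\<And>x. S x \<Longrightarrow> infinite {k. is_record x k}"
    and P: "\<forall>\<^sub>F i in sequentially. \<forall>x n. S x \<longrightarrow> 2^i < n \<longrightarrow> n \<le> 2^(i+1) \<longrightarrow> P x (Rcount x n) (Wwidth x n)"
  shows "\<forall>\<^sub>F m in sequentially. \<forall>x. S x \<longrightarrow> P x m (Wtilde x m)"
proof -
  obtain I where I: "\<And>i x n. I \<le> i \<Longrightarrow> S x \<Longrightarrow> 2^i < n \<Longrightarrow> n \<le> 2^(i+1) \<Longrightarrow> P x (Rcount x n) (Wwidth x n)"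
    using P unfolding eventually_sequentially by blast
  have "P x m (Wtilde x m)" if m: "2^(I+1) \<le> m" and x: "S x" for m x
  proof -
    define n where "n = record_time x m"
    have "1 \<le> m" using m by (meson le_trans one_le_numeral one_le_power)
    note T = Rcount_record_time[OF S[OF x] this]
    have "Rcount x n \<le> card {1..n}" unfolding Rcount_def by (intro card_mono) auto
    then have "m \<le> n" using T(1) unfolding n_def by simp
    then have n: "2^(I+1) \<le> n" using m by linarith
    moreover have "(2::nat) \<le> 2^(I+1)" by simp
    ultimately have "2 \<le> n" by linarith
    then obtain i where i: "2 ^ i < n" "n \<le> 2 ^ (i + 1)" by (rule dyadic_block)
    have "(2::nat)^(I+1) \<le> 2^(i+1)" using n i(2) by linarith
    then have "I + 1 \<le> i + 1" by (rule power_le_imp_le_exp[rotated]) simp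
    then have "I \<le> i" by simp
    from I[OF this x i] show ?thesis using T(1) unfolding n_def Wtilde_def by simp
  qed
  then show ?thesis unfolding eventually_sequentially by blast
qed

section \<open>The width along the record times\<close>

text \<open>With \<open>J\<close> as a parameter, bounds on such paths hold from an index
  \<open>m\<close> on that depends on \<open>e\<close> and \<open>J\<close> but not on the
  path.\<close>

definition tame_path :: "real \<Rightarrow> nat \<Rightarrow> (nat \<Rightarrow> real^'d) \<Rightarrow> bool" where
  "tame_path e J x \<longleftrightarrow> positive_path x \<and> infinite {k. is_record x k} \<and> (\<forall>j\<ge>J. tame e x j)"

lemma tame_pathD:
  assumes "tame_path e J x"
  shows "positive_path x" "infinite {k. is_record x k}" "\<And>j. J \<le> j \<Longrightarrow> tame e x j"
  using assms unfolding tame_path_def by blast+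

text \<open>In block \<open>i\<close> the width is at least \<open>(d - 1 - 2 * e) * ln i\<close>
  and \<open>ln m\<close> is at most \<open>(d + e) * ln i\<close>, up to bounded terms.\<close>

lemma Wtilde_lower:
  fixes q e :: real
  assumes e: "0 < e" "0 \<le> q" "q * (real CARD('d) + e) < real CARD('d) - 1 - 2 * e"
  shows "\<forall>\<^sub>F m in sequentially. \<forall>x :: nat \<Rightarrow> real^'d. tame_path e J x \<longrightarrow> q * ln (real m) \<le> Wtilde x m"
proof (rule eventually_Wtilde)
  show "infinite {k. is_record x k}" if "tame_path e J x" for x :: "nat \<Rightarrow> real^'d" using tame_pathD(2)[OF that] .
  define a b c where "a = real CARD('d) - 1 - e" and "b = q * (real CARD('d) + e)" and "c = b + e"
  have "c < a" using e(3) unfolding a_def b_def c_def by linarith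
  then have "\<forall>\<^sub>F i in sequentially. c * ln (real i + 1) \<le> a * ln (real i) - ln 2"
    by real_asymp
  moreover have "\<forall>\<^sub>F i in sequentially. max J 1 \<le> i" by (rule eventually_ge_at_top)
  ultimately show "\<forall>\<^sub>F i in sequentially. \<forall>x :: nat \<Rightarrow> real^'d. \<forall>n. tame_path e J x \<longrightarrow> 2^i < n \<longrightarrow> n \<le> 2^(i+1)
    \<longrightarrow> q * ln (real (Rcount x n)) \<le> Wwidth x n"
  proof eventually_elim
    case (elim i)
    show ?case
    proof (intro allI impI)
      fix x :: "nat \<Rightarrow> real^'d" and n :: nat assume x: "tame_path e J x" and n: "2^i < n" "n \<le> 2^(i+1)"
      have t: "tame e x i" "tame e x (i+1)" "1 \<le> i" using tame_pathD(3)[OF x] elim(2) by auto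
      note tb = positive_path.tame_block[OF tame_pathD(1)[OF x] t n]
      have "q * ln (real (Rcount x n)) \<le> q * ((real CARD('d) + e) * ln (real i + 1))"
        by (rule mult_left_mono[OF tb(6) e(2)])
      also have "\<dots> = b * ln (real i + 1)" unfolding b_def by simp
      also have "\<dots> = c * ln (real i + 1) - e * ln (real i + 1)" unfolding c_def by (simp add: algebra_simps)
      also have "\<dots> \<le> a * ln (real i) - ln 2 - e * ln (real i + 1)" using elim(1) by simp
      also have "\<dots> = lev a i - lev e (i+1)" unfolding lev_def by (simp add: algebra_simps)
      also have "\<dots> \<le> Wwidth x n" unfolding Wwidth_def a_def using tb(2,3) by linarith
      finally show "q * ln (real (Rcount x n)) \<le> Wwidth x n" .
    qed
  qed
qed

text \<open>Tameness caps the width at \<open>(d + 2 * e) * ln i\<close> up to bounded terms, while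
  \<open>ln m\<close> is at least \<open>(d - e) * ln i\<close>.\<close>

lemma Wtilde_upper:
  fixes q e :: real
  assumes e: "0 < e" "0 \<le> q" "real CARD('d) + 2 * e < q * (real CARD('d) - e)"
  shows "\<forall>\<^sub>F m in sequentially. \<forall>x :: nat \<Rightarrow> real^'d. tame_path e J x \<longrightarrow> Wtilde x m \<le> q * ln (real m)"
proof (rule eventually_Wtilde)
  show "infinite {k. is_record x k}" if "tame_path e J x" for x :: "nat \<Rightarrow> real^'d" using tame_pathD(2)[OF that] .
  define D where "D = real CARD('d)"
  define a b c where "a = D + e" and "b = q * (D - e)" and "c = b - e"
  have "a < c" using e(3) unfolding a_def b_def c_def D_def by linarith
  then have "\<forall>\<^sub>F i in sequentially. a * ln (real i + 1) + ln 2 + D \<le> c * ln (real i)"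
    by real_asymp
  moreover have "\<forall>\<^sub>F i in sequentially. max J 1 \<le> i" by (rule eventually_ge_at_top)
  ultimately show "\<forall>\<^sub>F i in sequentially. \<forall>x :: nat \<Rightarrow> real^'d. \<forall>n. tame_path e J x \<longrightarrow> 2^i < n \<longrightarrow> n \<le> 2^(i+1)
    \<longrightarrow> Wwidth x n \<le> q * ln (real (Rcount x n))"
  proof eventually_elim
    case (elim i)
    show ?case
    proof (intro allI impI)
      fix x :: "nat \<Rightarrow> real^'d" and n :: nat assume x: "tame_path e J x" and n: "2^i < n" "n \<le> 2^(i+1)"
      have t: "tame e x i" "tame e x (i+1)" "1 \<le> i" using tame_pathD(3)[OF x] elim(2) by auto
      note tb = positive_path.tame_block[OF tame_pathD(1)[OF x] t n]
      have "Wwidth x n \<le> lev a (i+1) - (lev (-e) i - D)"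
        unfolding Wwidth_def a_def D_def using tb(1,4) by linarith
      also have "\<dots> = a * ln (real i + 1) + ln 2 + D + e * ln (real i)"
        unfolding lev_def by (simp add: algebra_simps)
      also have "\<dots> \<le> c * ln (real i) + e * ln (real i)" using elim(1) by simp
      also have "\<dots> = q * ((real CARD('d) - e) * ln (real i))"
        unfolding c_def b_def D_def by (simp add: algebra_simps)
      also have "\<dots> \<le> q * ln (real (Rcount x n))" by (rule mult_left_mono[OF tb(5) e(2)])
      finally show "Wwidth x n \<le> q * ln (real (Rcount x n))" .
    qed
  qed
qed

text \<open>At time \<open>2 ^ (j+1)\<close>, just after a block with an exceedance, a high
  \<open>Fplus\<close> faces a typical \<open>Fminus\<close>. This need not be a record time;
  \<open>Wtilde_Rcount\<close> turns the width into a value of \<open>Wtilde\<close>, at an index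
  that tends to infinity with \<open>j\<close>.\<close>

lemma Wtilde_frequently_large:
  fixes q e :: real and x :: "nat \<Rightarrow> real^'d"
  assumes e: "0 < e" "0 \<le> q" "q * (real CARD('d) + e) < real CARD('d) - e"
    and x: "tame_path e J x"
    and freq: "\<exists>\<^sub>F j in sequentially. \<exists>i\<in>{2^j<..2^(j+1)}. lev (real CARD('d)) j < coord_sum (x i)"
  shows "\<exists>\<^sub>F m in sequentially. q * ln (real m) \<le> Wtilde x m"
proof -
  define D where "D = real CARD('d)"
  define b where "b = q * (D + e) + e"
  have "b < D" using e(3) unfolding b_def D_def by linarith
  then have "\<forall>\<^sub>F j in sequentially. b * ln (real j + 1) \<le> D * ln (real j) - ln 2" by real_asymp
  then have "\<exists>\<^sub>F j in sequentially. (\<exists>i\<in>{2^j<..2^(j+1)}. lev D j < coord_sum (x i)) \<and>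
     b * ln (real j + 1) \<le> D * ln (real j) - ln 2"
    using freq unfolding D_def by (intro frequently_eventually_frequently)
  then have freq': "\<exists>j\<ge>N. (\<exists>i\<in>{2^j<..2^(j+1)}. lev D j < coord_sum (x i)) \<and>
     b * ln (real j + 1) \<le> D * ln (real j) - ln 2" for N
    unfolding frequently_sequentially by (rule spec)
  have "\<exists>m\<ge>M. q * ln (real m) \<le> Wtilde x m" for M
  proof -
    have "\<forall>\<^sub>F j in sequentially. real M \<le> real j powr (real CARD('d) - e)"
    proof -
      have "0 < real CARD('d) - e" using e(3) mult_nonneg_nonneg[OF e(2), of "real CARD('d) + e"] e(1) by linarith
      then show ?thesis by real_asymp
    qed
    then obtain N where N: "\<And>j. N \<le> j \<Longrightarrow> real M \<le> real j powr (real CARD('d) - e)"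
      unfolding eventually_sequentially by blast
    obtain j i where j: "max (max J 1) N \<le> j" "i\<in>{2^j<..2^(j+1)}" "lev D j < coord_sum (x i)"
      "b * ln (real j + 1) \<le> D * ln (real j) - ln 2" using freq'[of "max (max J 1) N"] by (elim exE conjE bexE)
    define n :: nat where "n = 2^(j+1)"
    have n: "2^j < n" "n \<le> 2^(j+1)" unfolding n_def by simp_all
    have t: "tame e x j" "tame e x (j+1)" "1 \<le> j" using tame_pathD(3)[OF x] j(1) by auto
    note tb = positive_path.tame_block[OF tame_pathD(1)[OF x] t n]
    have W: "Wtilde x (Rcount x n) = Wwidth x n" using Wtilde_Rcount[OF tame_pathD(2)[OF x] tb(7)] .
    have "real M \<le> real (Rcount x n)" using N[of j] j(1) tb(8) by linarith
    then have "M \<le> Rcount x n" by simp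
    moreover have "q * ln (real (Rcount x n)) \<le> Wtilde x (Rcount x n)"
    proof -
      have "q * ln (real (Rcount x n)) \<le> q * ((real CARD('d) + e) * ln (real j + 1))"
        by (rule mult_left_mono[OF tb(6) e(2)])
      also have "\<dots> = b * ln (real j + 1) - e * ln (real j + 1)" unfolding b_def D_def by (simp add: algebra_simps)
      also have "\<dots> \<le> D * ln (real j) - ln 2 - e * ln (real j + 1)" using j(4) by simp
      also have "\<dots> = lev D j - lev e (j+1)" unfolding lev_def by (simp add: algebra_simps)
      also have "\<dots> \<le> coord_sum (x i) - Fminus x n" using j(3) tb(2) by linarith
      also have "\<dots> \<le> Wwidth x n"
        unfolding Wwidth_def using positive_path.Fplus_ge[OF tame_pathD(1)[OF x], of i n] j(2) unfolding n_def by simp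
      finally show ?thesis unfolding W .
    qed
    ultimately show "\<exists>m\<ge>M. q * ln (real m) \<le> Wtilde x m" by blast
  qed
  then show ?thesis unfolding frequently_sequentially by blast
qed

section \<open>Outliers that can affect the width at a given record\<close>

definition outlier :: "real \<Rightarrow> (nat \<Rightarrow> real^'d) \<Rightarrow> nat \<Rightarrow> bool" where
  "outlier a x j \<longleftrightarrow> (\<exists>i\<in>{2^j<..2^(j+1)}. lev (real CARD('d) - 1 + a) j < coord_sum (x i))"

text \<open>\<open>recent\<close> involves the observations up to time \<open>2 ^ j\<close> only, hence is independent of \<open>outlier\<close>, which
  concerns the next dyadic block. Its last clause bounds the number of \<open>j\<close> for which it can hold.\<close>

definition recent :: "real \<Rightarrow> nat \<Rightarrow> real \<Rightarrow> nat \<Rightarrow> (nat \<Rightarrow> real^'d) \<Rightarrow> nat \<Rightarrow> bool" where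
  "recent e J h m x j \<longleftrightarrow> real m - h \<le> real (Rcount x (2^j)) \<and> Rcount x (2^j) \<le> m \<and>
     (\<forall>l w. J \<le> l \<longrightarrow> l + w \<le> j \<longrightarrow> real l powr e \<le> real w \<longrightarrow>
       real l powr (real CARD('d) - 1 - e) \<le> real (Rcount x (2^(l+w))) - real (Rcount x (2^l)))"

lemma telescope_le:
  fixes f :: "nat \<Rightarrow> real"
  assumes "j \<le> i" "\<And>l. j \<le> l \<Longrightarrow> l < i \<Longrightarrow> f (l + 1) - f l \<le> B"
  shows "f i - f j \<le> real (i - j) * B"
  using assms
proof (induction i rule: dec_induct)
  case base then show ?case by simp
next
  case (step i)
  have "f i - f j \<le> real (i - j) * B" using step by simp
  moreover have "f (Suc i) - f i \<le> B" using step(4)[of i] step(1) by simp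
  moreover have "real (Suc i - j) = real (i - j) + 1" using step(1) by (simp add: Suc_diff_le)
  ultimately show ?case by (simp add: algebra_simps)
qed

text \<open>A large width at a time \<open>n\<close> in block \<open>i\<close> needs an observation
  above the level with exponent \<open>d - 1 + a\<close>. It falls in some block
  \<open>j \<le> i\<close> and is an outlier there, as the level is lower. Since tame sums stay
  below \<open>lev (d + e)\<close>, which rises linearly, it cannot be old:
  \<open>i + 1 - j \<le> i powr e\<close>. The block bounds then limit the records after
  \<open>2 ^ j\<close> to \<open>i powr (d - 1 + 2 * e)\<close>. Together with
  \<open>i \<le> m powr (1 / (d - e))\<close> this is the shortfall allowed in
  \<open>recent\<close>.\<close>

lemma outlier_of_large_width:
  fixes q e a :: real
  assumes e: "0 < e" "e < 1" and a: "0 < a" and q: "0 \<le> q" "real CARD('d) - 1 + a < q * (real CARD('d) - e) - e"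
    and d: "2 \<le> CARD('d)" and J: "1 \<le> J"
  shows "\<forall>\<^sub>F m in sequentially. \<forall>x :: nat \<Rightarrow> real^'d. tame_path e J x \<longrightarrow>
    Wtilde x m \<le> q * ln (real m) \<or>
    (\<exists>j\<ge>J. real m powr (1 / (real CARD('d) + e)) / 2 \<le> real j \<and> real j \<le> real m powr (1 / (real CARD('d) - e)) \<and>
       outlier a x j \<and> recent e J (real m powr ((real CARD('d) - 1 + 2 * e) / (real CARD('d) - e))) m x j)"
proof (rule eventually_Wtilde)
  show "infinite {k. is_record x k}" if "tame_path e J x" for x :: "nat \<Rightarrow> real^'d" using tame_pathD(2)[OF that] .
  define D where "D = real CARD('d)"
  have D2: "2 \<le> D" unfolding D_def using d by simp
  define b c where "b = D - 1 + a" and "c = q * (D - e) - e"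
  have bc: "b < c" "0 < b" unfolding b_def c_def D_def using q a D2[unfolded D_def] by linarith+
  \<comment> \<open>Tameness is available only from \<open>J\<close> on. This constant bounds all
    sums up to time \<open>2 ^ J\<close> and is below the level in question for large
    \<open>i\<close>.\<close>
  define lJ where "lJ = lev (D + e) J"
  have "\<forall>\<^sub>F i in sequentially. b * ln (real i) + D \<le> c * ln (real i)" using bc by real_asymp
  moreover have "\<forall>\<^sub>F i in sequentially. lJ \<le> real i * ln 2 + b * ln (real i)" by real_asymp
  moreover have "\<forall>\<^sub>F i in sequentially. 2 * ln 2 + (D + e) * ln (real i + 1) \<le> ln 2 * real i powr e"
    using e D2 by real_asymp
  moreover have "\<forall>\<^sub>F i in sequentially. real i powr e \<le> (real i + 1) / 2" using e by real_asymp
  moreover have "\<forall>\<^sub>F i in sequentially. max J 1 \<le> i" by (rule eventually_ge_at_top)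
  ultimately show "\<forall>\<^sub>F i in sequentially. \<forall>x :: nat \<Rightarrow> real^'d. \<forall>n. tame_path e J x \<longrightarrow> 2^i < n \<longrightarrow> n \<le> 2^(i+1)
    \<longrightarrow> Wwidth x n \<le> q * ln (real (Rcount x n)) \<or>
    (\<exists>j\<ge>J. real (Rcount x n) powr (1 / (real CARD('d) + e)) / 2 \<le> real j \<and>
       real j \<le> real (Rcount x n) powr (1 / (real CARD('d) - e)) \<and>
       outlier a x j \<and>
       recent e J (real (Rcount x n) powr ((real CARD('d) - 1 + 2 * e) / (real CARD('d) - e))) (Rcount x n) x j)"
  proof eventually_elim
    case (elim i)
    show ?case unfolding D_def[symmetric]
    proof (intro allI impI, subst disj_commute, rule disjCI)
      fix x :: "nat \<Rightarrow> real^'d" and n :: nat assume x: "tame_path e J x" and n: "2^i < n" "n \<le> 2^(i+1)"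
      assume W: "\<not> Wwidth x n \<le> q * ln (real (Rcount x n))"
      interpret positive_path x using tame_pathD(1)[OF x] .
      define f where "f j = real (Rcount x (2^j))" for j
      define m where "m = Rcount x n"
      have i1: "1 \<le> i" "J \<le> i" using elim(5) by auto
      have t: "tame e x i" "tame e x (i+1)" using tame_pathD(3)[OF x] i1 by auto
      note tb = tame_block[OF t i1(1) n, folded D_def m_def]
      have lni: "0 \<le> ln (real i)" using i1 by simp
      have "lev b i \<le> q * ((D - e) * ln (real i)) + lev (-e) i - D"
        using elim(1) unfolding lev_def c_def by (simp add: algebra_simps)
      also have "q * ((D - e) * ln (real i)) \<le> q * ln (real m)" by (rule mult_left_mono[OF tb(5) q(1)])
      also have "q * ln (real m) + lev (-e) i - D < Fplus x n"
        using W tb(1) unfolding Wwidth_def m_def by linarith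
      finally have F: "lev b i < Fplus x n" by simp
      have "1 \<le> n" using n(1) by linarith
      have "\<exists>k\<in>{1..n}. lev b i < coord_sum (x k)"
      proof (rule ccontr)
        assume "\<not> ?thesis"
        then have "coord_sum (x k) \<le> lev b i" if "k \<in> {1..n}" for k using that by (meson not_less)
        from Fplus_le[OF \<open>1 \<le> n\<close> this] show False using F by simp
      qed
      then obtain k where k: "k \<in> {1..n}" "lev b i < coord_sum (x k)" by blast
      have kn: "1 \<le> k" "k \<le> 2^(i+1)" using k(1) n(2) by auto
      have up: "coord_sum (x k) \<le> lev (D + e) l" if "J \<le> l" "k \<le> 2^l" for l
      proof -
        have "\<forall>k\<in>{1..2^l}. coord_sum (x k) \<le> lev (D + e) l"
          using tame_pathD(3)[OF x that(1)] unfolding tame_def D_def by blast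
        then show ?thesis using kn(1) that(2) by auto
      qed
      have kJ: "2^J < k"
      proof (rule ccontr)
        assume "\<not> 2^J < k"
        then have "coord_sum (x k) \<le> lJ" unfolding lJ_def by (intro up) auto
        then show False using k(2) elim(2) unfolding lev_def by linarith
      qed
      have "(1::nat) \<le> 2^J" by simp
      then have "2 \<le> k" using kJ by linarith
      then obtain j where j: "2^j < k" "k \<le> 2^(j+1)" by (rule dyadic_block)
      have "(2::nat)^J < 2^(j+1)" using kJ j(2) by linarith
      then have "J < j + 1" by (rule power_less_imp_less_exp[rotated]) simp
      then have Jj: "J \<le> j" by simp
      have "(2::nat)^j < 2^(i+1)" using j(1) kn(2) by linarith
      then have "j < i + 1" by (rule power_less_imp_less_exp[rotated]) simp
      then have ji: "j \<le> i" by simp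
      have j1: "1 \<le> j" using Jj J by simp
      have "lev b j \<le> lev b i"
        unfolding lev_def using ji j1 bc(2) by (intro add_mono mult_right_mono mult_left_mono) auto
      then have out: "outlier a x j" unfolding outlier_def D_def[symmetric] b_def[symmetric]
        using k(2) j by (intro bexI[of _ k]) auto
      have "coord_sum (x k) \<le> lev (D + e) (j+1)" using Jj j(2) by (intro up) auto
      moreover have "ln (real j + 1) \<le> ln (real i + 1)" using ji by simp
      then have "(D + e) * ln (real j + 1) \<le> (D + e) * ln (real i + 1)" using D2 e by (intro mult_left_mono) auto
      moreover have "0 \<le> b * ln (real i)" using bc(2) lni by simp
      ultimately have "real i * ln 2 \<le> real (j+1) * ln 2 + (D + e) * ln (real i + 1)"
        using k(2) unfolding lev_def by (simp add: add.commute)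
      then have "ln 2 * (real (i + 1) - real j) \<le> 2 * ln 2 + (D + e) * ln (real i + 1)"
        by (simp add: algebra_simps)
      also have "\<dots> \<le> ln 2 * real i powr e" by (rule elim(3))
      finally have ij: "real (i + 1) - real j \<le> real i powr e" by simp
      have "0 < real i powr (D - e)" using i1 by simp
      then have m0: "0 < real m" using tb(8) by linarith
      have hi: "real i \<le> real m powr (1 / (D - e))"
      proof -
        have "(real i powr (D - e)) powr (1 / (D - e)) \<le> real m powr (1 / (D - e))"
          using tb(8) D2 e by (intro powr_mono2) auto
        then show ?thesis using D2 e i1 by (simp add: powr_powr)
      qed
      have lo: "real m powr (1 / (D + e)) \<le> real i + 1"
      proof -
        have "real m powr (1 / (D + e)) \<le> ((real i + 1) powr (D + e)) powr (1 / (D + e))"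
          using tb(9) D2 e by (intro powr_mono2) auto
        then show ?thesis using D2 e by (simp add: powr_powr)
      qed
      have "f (i + 1) - f j \<le> real (i + 1 - j) * real i powr (D - 1 + e)"
      proof (rule telescope_le)
        fix l assume l: "j \<le> l" "l < i + 1"
        have "f (l + 1) - f l \<le> real l powr (D - 1 + e)"
          using tame_pathD(3)[OF x, of l] l Jj unfolding tame_def f_def D_def by simp
        also have "\<dots> \<le> real i powr (D - 1 + e)" using l D2 e by (intro powr_mono2) auto
        finally show "f (l + 1) - f l \<le> real i powr (D - 1 + e)" .
      qed (use ji in simp)
      also have "\<dots> \<le> real i powr e * real i powr (D - 1 + e)"
        using ij ji by (intro mult_right_mono) (auto simp: of_nat_diff)
      also have "\<dots> = real i powr (D - 1 + 2 * e)" by (simp add: powr_add[symmetric] algebra_simps)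
      also have "\<dots> \<le> (real m powr (1 / (D - e))) powr (D - 1 + 2 * e)"
        using hi D2 e by (intro powr_mono2) auto
      also have "\<dots> = real m powr ((D - 1 + 2 * e) / (D - e))" by (simp add: powr_powr)
      finally have h: "f (i + 1) - f j \<le> real m powr ((D - 1 + 2 * e) / (D - e))" .
      have mi: "real m \<le> f (i + 1)" unfolding m_def f_def using Rcount_mono[OF n(2)] by simp
      have jm: "Rcount x (2^j) \<le> m" unfolding m_def
      proof (rule Rcount_mono)
        have "(2::nat)^j \<le> 2^i" using ji by simp
        then show "2^j \<le> n" using n(1) by linarith
      qed
      have "recent e J (real m powr ((D - 1 + 2 * e) / (D - e))) m x j"
        unfolding recent_def
      proof (intro conjI allI impI)
        show "real m - real m powr ((D - 1 + 2 * e) / (D - e)) \<le> real (Rcount x (2^j))"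
          using h mi unfolding f_def by linarith
        show "Rcount x (2^j) \<le> m" by (rule jm)
        fix l w assume "J \<le> l" "real l powr e \<le> real w"
        then show "real l powr (real CARD('d) - 1 - e) \<le> real (Rcount x (2^(l+w))) - real (Rcount x (2^l))"
          using tame_pathD(3)[OF x, of l] unfolding tame_def by blast
      qed
      moreover have "real m powr (1 / (D + e)) / 2 \<le> real j" using lo ij elim(4) by simp
      moreover have "real j \<le> real m powr (1 / (D - e))" using hi ji by simp
      ultimately show "\<exists>j\<ge>J. real (Rcount x n) powr (1 / (D + e)) / 2 \<le> real j \<and>
         real j \<le> real (Rcount x n) powr (1 / (D - e)) \<and> outlier a x j \<and>
         recent e J (real (Rcount x n) powr ((D - 1 + 2 * e) / (D - e))) (Rcount x n) x j"
        using Jj out unfolding m_def by blast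
    qed
  qed
qed

text \<open>Between the least and the greatest element of \<open>V\<close> the count rises by at
  most \<open>h\<close>, both values lying between \<open>m - h\<close> and \<open>m\<close>.
  Consecutive windows of length \<open>w\<close> contribute at least \<open>lo powr p\<close> each,
  so at most \<open>h / lo powr p\<close> of them fit. The window clause of \<open>recent\<close> at
  the greatest element covers all of these windows.\<close>

lemma card_recent:
  fixes x :: "nat \<Rightarrow> real^'d" and e lo hi h :: real and J m :: nat
  assumes "0 \<le> e" "0 \<le> real CARD('d) - 1 - e" "0 < lo" "0 \<le> h"
  defines "V \<equiv> {j. J \<le> j \<and> lo \<le> real j \<and> real j \<le> hi \<and> recent e J h m x j}"
  shows "real (card V) \<le> (h / lo powr (real CARD('d) - 1 - e) + 1) * (hi powr e + 1)"
proof (cases "V = {}")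
  case True
  have "0 \<le> h / lo powr (real CARD('d) - 1 - e) + 1" using assms by simp
  then show ?thesis unfolding True by simp
next
  case False
  define p where "p = real CARD('d) - 1 - e"
  have fin: "finite V"
    by (rule finite_subset[of _ "{..nat \<lfloor>hi\<rfloor>}"]) (auto simp: V_def le_nat_floor)
  define j1 j2 where "j1 = Min V" and "j2 = Max V"
  have jV: "j1 \<in> V" "j2 \<in> V" unfolding j1_def j2_def using fin False by (auto intro: Min_in Max_in)
  have sub: "V \<subseteq> {j1..j2}" unfolding j1_def j2_def using fin by auto
  have j12: "j1 \<le> j2" using jV(2) sub by auto
  \<comment> \<open>Long enough to be an admissible window from every starting block up to
    \<open>hi\<close>.\<close>
  define w where "w = nat \<lceil>hi powr e\<rceil>"
  have hi0: "0 < hi" using jV(1) assms(3) unfolding V_def by simp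
  have w: "hi powr e \<le> real w" "real w \<le> hi powr e + 1" "0 < w"
  proof -
    have "0 < hi powr e" using hi0 by simp
    then show "hi powr e \<le> real w" "real w \<le> hi powr e + 1" "0 < w" unfolding w_def by linarith+
  qed
  define f where "f j = real (Rcount x (2^j))" for j
  have rec: "real l powr p \<le> f (l + w) - f l" if "J \<le> l" "l + w \<le> j2" "real l powr e \<le> real w" for l
    using jV(2) that unfolding V_def recent_def f_def p_def by blast
  define r where "r = (j2 - j1) div w"
  have rw: "j1 + s * w \<le> j2" if "s \<le> r" for s
  proof -
    have "s * w \<le> r * w" using that by simp
    also have "\<dots> \<le> j2 - j1" unfolding r_def by simp
    finally show ?thesis using j12 by linarith
  qed
  have "real s * lo powr p \<le> f (j1 + s * w) - f j1" if "s \<le> r" for s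
    using that
  proof (induction s)
    case 0 then show ?case by simp
  next
    case (Suc s)
    define l where "l = j1 + s * w"
    have l: "l + w \<le> j2" using rw[OF Suc(2)] unfolding l_def by simp
    have "j1 \<le> l" "l \<le> j2" using l unfolding l_def by simp_all
    moreover have "J \<le> j1" "lo \<le> real j1" "real j2 \<le> hi" using jV unfolding V_def by auto
    ultimately have "J \<le> l" "lo \<le> real l" "real l \<le> hi" by simp_all
    have "real l powr e \<le> hi powr e" using \<open>real l \<le> hi\<close> assms(1) by (intro powr_mono2) auto
    then have "real l powr p \<le> f (l + w) - f l" using rec[OF \<open>J \<le> l\<close> l] w(1) by linarith
    moreover have "lo powr p \<le> real l powr p"
      using \<open>lo \<le> real l\<close> assms unfolding p_def by (intro powr_mono2) auto
    ultimately have "lo powr p \<le> f (j1 + Suc s * w) - f (j1 + s * w)"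
      unfolding l_def by (simp add: algebra_simps)
    then show ?case using Suc by (simp add: algebra_simps)
  qed
  from this[of r] have "real r * lo powr p \<le> f (j1 + r * w) - f j1" by simp
  also have "f (j1 + r * w) \<le> f j2" unfolding f_def using rw[of r] by (simp add: Rcount_mono)
  also have "f j2 - f j1 \<le> h" using jV unfolding V_def recent_def f_def by force
  finally have "real r * lo powr p \<le> h" by simp
  then have r: "real r \<le> h / lo powr p" using assms(3) by (simp add: pos_le_divide_eq)
  have "card V \<le> card {j1..j2}" by (rule card_mono[OF _ sub]) simp
  also have "\<dots> = (j2 - j1) + 1" using j12 by simp
  also have "\<dots> \<le> (r + 1) * w"
  proof -
    have "(j2 - j1) mod w < w" using w(3) by simp
    moreover have "j2 - j1 = r * w + (j2 - j1) mod w" unfolding r_def by simp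
    ultimately have "j2 - j1 < r * w + w" by linarith
    then show ?thesis by simp
  qed
  finally have "card V \<le> (r + 1) * w" .
  then have "real (card V) \<le> real ((r + 1) * w)" by (rule of_nat_mono)
  also have "\<dots> = (real r + 1) * real w" by (simp add: algebra_simps)
  also have "\<dots> \<le> (h / lo powr p + 1) * (hi powr e + 1)" using r w by (intro mult_mono) auto
  finally show ?thesis unfolding p_def .
qed

section \<open>The random model\<close>

lemma borel_measurable_vecI:
  fixes f :: "'a \<Rightarrow> real^'d"
  assumes "\<And>j. (\<lambda>\<omega>. f \<omega> $ j) \<in> borel_measurable M"
  shows "f \<in> borel_measurable M"
proof (subst borel_measurable_euclidean_space, rule ballI)
  fix b :: "real^'d" assume "b \<in> Basis"
  then obtain j where "b = axis j 1" by (auto simp: Basis_vec_def)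
  then show "(\<lambda>\<omega>. f \<omega> \<bullet> b) \<in> borel_measurable M" using assms[of j] by (simp add: inner_axis)
qed

lemma borel_measurable_coord_sum [measurable]: "coord_sum \<in> borel_measurable borel"
  unfolding coord_sum_def[abs_def]
  by (intro borel_measurable_continuous_onI continuous_intros)

lemma sets_strict_less [measurable]: "{y :: real^'d. strict_less z y} \<in> sets borel"
proof -
  have "{y :: real^'d. strict_less z y} = (\<Inter>j. {y. z $ j < y $ j})" unfolding strict_less_def by auto
  moreover have "open {y :: real^'d. z $ j < y $ j}" for j
    by (rule open_Collect_less) (auto intro: continuous_intros)
  ultimately show ?thesis by (auto intro!: borel_open)
qed

locale record_model = prob_space M for M :: "'a measure" +
  fixes X :: "nat \<Rightarrow> 'a \<Rightarrow> real^'d"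
  assumes exponential: "\<And>i j. 1 \<le> i \<Longrightarrow> distributed M lborel (\<lambda>\<omega>. X i \<omega> $ j) (exponential_density 1)"
    and indep: "indep_vars (\<lambda>_. borel) (\<lambda>(i, j) \<omega>. X i \<omega> $ j) ({1..} \<times> UNIV)"
begin

abbreviation path :: "'a \<Rightarrow> nat \<Rightarrow> real^'d" where
  "path \<omega> \<equiv> \<lambda>i. X i \<omega>"

lemma measurable_coordinate: "1 \<le> i \<Longrightarrow> (\<lambda>\<omega>. X i \<omega> $ j) \<in> borel_measurable M"
  using distributed_measurable[OF exponential[of i j]] by simp

lemma measurable_X: "1 \<le> i \<Longrightarrow> X i \<in> borel_measurable M"
  by (intro borel_measurable_vecI measurable_coordinate)

text \<open>The coordinates are independent over all pairs. Grouping them by the first index and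
  reassembling each group through \<open>Y i\<close> gives independent vectors.\<close>

lemma indep_X: "indep_vars (\<lambda>_. borel) X {1..}"
proof -
  define K :: "nat \<Rightarrow> (nat \<times> 'd) set" where "K i = {i} \<times> UNIV" for i
  define Y :: "nat \<Rightarrow> (nat \<times> 'd \<Rightarrow> real) \<Rightarrow> real^'d" where "Y i f = (\<chi> j. f (i, j))" for i f
  have "indep_vars (\<lambda>i. PiM (K i) (\<lambda>_. borel)) (\<lambda>i \<omega>. restrict (\<lambda>k. (case k of (i, j) \<Rightarrow> \<lambda>\<omega>. X i \<omega> $ j) \<omega>) (K i)) {1..}"
    by (rule indep_vars_restrict[OF indep]) (auto simp: K_def disjoint_family_on_def)
  then have "indep_vars (\<lambda>_. borel) (\<lambda>i \<omega>. Y i (restrict (\<lambda>k. (case k of (i, j) \<Rightarrow> \<lambda>\<omega>. X i \<omega> $ j) \<omega>) (K i))) {1..}"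
  proof (rule indep_vars_compose2)
    fix i :: nat
    show "Y i \<in> borel_measurable (PiM (K i) (\<lambda>_. borel))"
    proof (rule borel_measurable_vecI)
      fix j
      have "(i, j) \<in> K i" unfolding K_def by simp
      then show "(\<lambda>f. Y i f $ j) \<in> borel_measurable (PiM (K i) (\<lambda>_. borel))"
        unfolding Y_def vec_lambda_beta by (rule measurable_component_singleton)
    qed
  qed
  moreover have "Y i (restrict (\<lambda>k. (case k of (i, j) \<Rightarrow> \<lambda>\<omega>. X i \<omega> $ j) \<omega>) (K i)) = X i \<omega>" for i \<omega>
    unfolding Y_def K_def by (simp add: vec_eq_iff)
  ultimately show ?thesis by simp
qed

lemma sets_X [measurable (raw)]:
  "1 \<le> i \<Longrightarrow> A \<in> sets borel \<Longrightarrow> {\<omega> \<in> space M. X i \<omega> \<in> A} \<in> events"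
  using measurable_sets[OF measurable_X, of i A] by (simp add: vimage_def Int_def conj_commute)

lemma prob_INT_X:
  assumes "finite I" "I \<subseteq> {1..}" "\<And>i. i \<in> I \<Longrightarrow> A i \<in> sets borel"
  shows "\<P>(\<omega> in M. \<forall>i\<in>I. X i \<omega> \<in> A i) = (\<Prod>i\<in>I. \<P>(\<omega> in M. X i \<omega> \<in> A i))"
proof (cases "I = {}")
  case True then show ?thesis by (simp add: prob_space)
next
  case False
  have "prob (\<Inter>i\<in>I. X i -` A i \<inter> space M) = (\<Prod>i\<in>I. prob (X i -` A i \<inter> space M))"
    using indep_X False assms by (intro indep_varsD) auto
  moreover have "(\<Inter>i\<in>I. X i -` A i \<inter> space M) = {\<omega> \<in> space M. \<forall>i\<in>I. X i \<omega> \<in> A i}"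
    using False by auto
  moreover have "X i -` A i \<inter> space M = {\<omega> \<in> space M. X i \<omega> \<in> A i}" for i by auto
  ultimately show ?thesis by simp
qed

text \<open>Independence together with \<open>1 - p \<le> exp (- p)\<close> in each factor.\<close>

lemma prob_none_le:
  assumes "finite I" "I \<subseteq> {1..}" "\<And>i. i \<in> I \<Longrightarrow> A i \<in> sets borel"
  shows "\<P>(\<omega> in M. \<forall>i\<in>I. X i \<omega> \<notin> A i) \<le> exp (- (\<Sum>i\<in>I. \<P>(\<omega> in M. X i \<omega> \<in> A i)))"
proof -
  have "\<P>(\<omega> in M. \<forall>i\<in>I. X i \<omega> \<in> - A i) = (\<Prod>i\<in>I. \<P>(\<omega> in M. X i \<omega> \<in> - A i))"
    using assms by (intro prob_INT_X) auto
  also have "\<dots> \<le> (\<Prod>i\<in>I. exp (- \<P>(\<omega> in M. X i \<omega> \<in> A i)))"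
  proof (rule prod_mono)
    fix i assume i: "i \<in> I"
    have "{\<omega> \<in> space M. X i \<omega> \<in> A i} \<in> events" using i assms by (intro sets_X) auto
    from prob_compl[OF this]
    have "\<P>(\<omega> in M. X i \<omega> \<in> - A i) = 1 - \<P>(\<omega> in M. X i \<omega> \<in> A i)"
      by (simp add: set_diff_eq Collect_conj_eq[symmetric] conj_commute cong: conj_cong)
    also have "\<dots> \<le> exp (- \<P>(\<omega> in M. X i \<omega> \<in> A i))"
      using exp_ge_add_one_self[of "- \<P>(\<omega> in M. X i \<omega> \<in> A i)"] by simp
    finally show "0 \<le> \<P>(\<omega> in M. X i \<omega> \<in> - A i) \<and>
      \<P>(\<omega> in M. X i \<omega> \<in> - A i) \<le> exp (- \<P>(\<omega> in M. X i \<omega> \<in> A i))" by simp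
  qed
  also have "\<dots> = exp (- (\<Sum>i\<in>I. \<P>(\<omega> in M. X i \<omega> \<in> A i)))"
    using assms(1) by (simp add: exp_sum sum_negf[symmetric])
  finally show ?thesis by simp
qed

lemma prob_strict_less:
  assumes "1 \<le> i" "z \<in> nonneg_orthant"
  shows "\<P>(\<omega> in M. strict_less z (X i \<omega>)) = exp (- coord_sum z)"
proof -
  have "prob (\<Inter>k\<in>{i} \<times> UNIV. (case k of (i, j) \<Rightarrow> \<lambda>\<omega>. X i \<omega> $ j) -` {z $ snd k<..} \<inter> space M)
     = (\<Prod>k\<in>{i} \<times> UNIV. prob ((case k of (i, j) \<Rightarrow> \<lambda>\<omega>. X i \<omega> $ j) -` {z $ snd k<..} \<inter> space M))"
    using assms by (intro indep_varsD[OF indep]) auto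
  also have "(\<Inter>k\<in>{i} \<times> UNIV. (case k of (i, j) \<Rightarrow> \<lambda>\<omega>. X i \<omega> $ j) -` {z $ snd k<..} \<inter> space M)
     = {\<omega> \<in> space M. strict_less z (X i \<omega>)}"
    unfolding strict_less_def by auto
  also have "(\<Prod>k\<in>{i} \<times> UNIV. prob ((case k of (i, j) \<Rightarrow> \<lambda>\<omega>. X i \<omega> $ j) -` {z $ snd k<..} \<inter> space M))
     = (\<Prod>k\<in>{i} \<times> (UNIV :: 'd set). exp (- z $ snd k))"
  proof (rule prod.cong)
    fix k assume k: "k \<in> {i} \<times> (UNIV :: 'd set)"
    have "(case k of (i, j) \<Rightarrow> \<lambda>\<omega>. X i \<omega> $ j) -` {z $ snd k<..} \<inter> space M = {\<omega> \<in> space M. z $ snd k < X i \<omega> $ snd k}"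
      using k by auto
    moreover have "\<P>(\<omega> in M. z $ snd k < X i \<omega> $ snd k) = exp (- (z $ snd k) * 1)"
      using assms by (intro exponential_distributedD_gt exponential) (auto simp: nonneg_orthant_def)
    ultimately show "prob ((case k of (i, j) \<Rightarrow> \<lambda>\<omega>. X i \<omega> $ j) -` {z $ snd k<..} \<inter> space M) = exp (- z $ snd k)"
      by simp
  qed simp
  also have "\<dots> = (\<Prod>j\<in>UNIV. exp (- z $ j))"
    by (rule prod.reindex_bij_witness[of _ "\<lambda>j. (i, j)" snd]) auto
  also have "\<dots> = exp (- coord_sum z)" unfolding coord_sum_def by (simp add: exp_sum[symmetric] sum_negf)
  finally show ?thesis .
qed

text \<open>The survival function of the Gamma distribution with shape \<open>d\<close> and rate 1,
  the law of a sum of \<open>d\<close> independent standard exponentials.\<close>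

definition tail :: "real \<Rightarrow> real" where
  "tail b = (\<Sum>n<CARD('d). b ^ n / fact n) * exp (- b)"

lemma prob_coord_sum_gt:
  assumes "1 \<le> i" "0 \<le> b"
  shows "\<P>(\<omega> in M. b < coord_sum (X i \<omega>)) = tail b"
proof -
  have "distributed M lborel (\<lambda>\<omega>. \<Sum>k\<in>{i} \<times> (UNIV :: 'd set). (case k of (i, j) \<Rightarrow> \<lambda>\<omega>. X i \<omega> $ j) \<omega>)
      (erlang_density (card ({i} \<times> (UNIV :: 'd set)) - 1) 1)"
    using assms exponential by (intro exponential_distributed_sum indep_vars_subset[OF indep]) auto
  moreover have "(\<Sum>k\<in>{i} \<times> (UNIV :: 'd set). (case k of (i, j) \<Rightarrow> \<lambda>\<omega>. X i \<omega> $ j) \<omega>) = coord_sum (X i \<omega>)" for \<omega>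
    unfolding coord_sum_def by (rule sum.reindex_bij_witness[of _ "\<lambda>j. (i, j)" snd]) auto
  ultimately have "distributed M lborel (\<lambda>\<omega>. coord_sum (X i \<omega>)) (erlang_density (CARD('d) - 1) 1)"
    by (simp add: card_cartesian_product)
  from erlang_distributed_gt[OF this _ assms(2)]
  have "\<P>(\<omega> in M. b < coord_sum (X i \<omega>)) = 1 - erlang_CDF (CARD('d) - 1) 1 b" by simp
  also have "\<dots> = (\<Sum>n\<le>CARD('d) - 1. b ^ n * exp (- b) / fact n)"
    using assms(2) by (simp add: erlang_CDF_def)
  also have "{..CARD('d) - 1} = {..<CARD('d)}"
    using lessThan_Suc_atMost[of "CARD('d) - 1"] by simp
  finally show ?thesis unfolding tail_def by (simp add: sum_distrib_right)
qed

text \<open>The factor \<open>2 ^ j\<close> cancels the linear part of the level in the exponential.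
  What remains is \<open>j powr (- s)\<close> times a polynomial of degree \<open>d - 1\<close> in a
  quantity of order \<open>j\<close>, whence the exponent \<open>d - 1 - s\<close> in the two bounds
  below.\<close>

lemma scaled_tail:
  assumes "1 \<le> j"
  shows "2 ^ j * tail (lev s j) = real j powr (- s) * (\<Sum>n<CARD('d). lev s j ^ n / fact n)"
proof -
  have "2 ^ j * exp (- lev s j) = real j powr (- s)"
  proof -
    have "exp (- lev s j) = exp (- (real j * ln 2)) * exp (- s * ln (real j))"
      unfolding lev_def by (simp add: exp_add[symmetric])
    also have "exp (- (real j * ln 2)) = 1 / 2 ^ j"
      by (simp add: exp_minus exp_of_nat_mult field_simps)
    also have "exp (- s * ln (real j)) = real j powr (- s)" using assms by (simp add: powr_def)
    finally show ?thesis by simp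
  qed
  then have "real j powr (- s) * (\<Sum>n<CARD('d). lev s j ^ n / fact n)
      = 2 ^ j * exp (- lev s j) * (\<Sum>n<CARD('d). lev s j ^ n / fact n)" by (simp only:)
  also have "\<dots> = 2 ^ j * tail (lev s j)" unfolding tail_def by (simp only: mult_ac)
  finally show ?thesis ..
qed

lemma scaled_tail_upper:
  "\<exists>C>0. \<forall>s. \<forall>\<^sub>F j in sequentially. 0 \<le> lev s j \<and> 2 ^ j * tail (lev s j) \<le> C * real j powr (real CARD('d) - 1 - s)"
proof (intro exI conjI allI)
  \<comment> \<open>There are \<open>d\<close> summands, each at most \<open>(2 * j) ^ n\<close>
    with \<open>n < d\<close>.\<close>
  define C :: real where "C = real CARD('d) * 2 ^ CARD('d)"
  show "0 < C" unfolding C_def by simp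
  fix s
  have "\<forall>\<^sub>F j in sequentially. lev s j \<le> 2 * real j"
  proof -
    have "\<forall>\<^sub>F j in sequentially. real j * ln 2 + s * ln (real j) \<le> real j * ln 2 + real j" by real_asymp
    then show ?thesis unfolding lev_def
    proof eventually_elim
      case (elim j)
      have "real j * ln 2 \<le> real j * 1" using ln_2_less_1 by (intro mult_left_mono) auto
      then show ?case using elim by linarith
    qed
  qed
  then show "\<forall>\<^sub>F j in sequentially. 0 \<le> lev s j \<and> 2 ^ j * tail (lev s j) \<le> C * real j powr (real CARD('d) - 1 - s)"
    using lev_ge_half[of s] eventually_ge_at_top[of 1]
  proof eventually_elim
    case (elim j)
    have pos: "0 \<le> lev s j" using elim by linarith
    have "(\<Sum>n<CARD('d). lev s j ^ n / fact n) \<le> (\<Sum>n<CARD('d). 2 ^ CARD('d) * real j ^ (CARD('d) - 1))"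
    proof (rule sum_mono)
      fix n assume n: "n \<in> {..<CARD('d)}"
      have "lev s j ^ n / fact n \<le> lev s j ^ n" using pos by (simp add: divide_le_eq mult_left_le fact_ge_1 mult_le_cancel_left1)
      also have "\<dots> \<le> (2 * real j) ^ n" using pos elim(1) by (intro power_mono)
      also have "\<dots> = 2 ^ n * real j ^ n" by (simp add: power_mult_distrib)
      also have "\<dots> \<le> 2 ^ CARD('d) * real j ^ (CARD('d) - 1)"
        using n elim(3) by (intro mult_mono power_increasing) auto
      finally show "lev s j ^ n / fact n \<le> 2 ^ CARD('d) * real j ^ (CARD('d) - 1)" .
    qed
    also have "\<dots> = C * real j ^ (CARD('d) - 1)" unfolding C_def by simp
    also have "real j ^ (CARD('d) - 1) = real j powr (real CARD('d) - 1)"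
      using elim(3) zero_less_card_finite[where ?'a = 'd] by (simp add: powr_realpow[symmetric] of_nat_diff)
    finally have "2 ^ j * tail (lev s j) \<le> real j powr (- s) * (C * real j powr (real CARD('d) - 1))"
      unfolding scaled_tail[OF elim(3)] by (intro mult_left_mono) auto
    also have "\<dots> = C * (real j powr (- s) * real j powr (real CARD('d) - 1))" by simp
    also have "\<dots> = C * real j powr (real CARD('d) - 1 - s)" by (simp add: powr_add[symmetric] algebra_simps)
    finally show ?case using pos by simp
  qed
qed

lemma scaled_tail_lower:
  "\<exists>c>0. \<forall>s. \<forall>\<^sub>F j in sequentially. 0 \<le> lev s j \<and> c * real j powr (real CARD('d) - 1 - s) \<le> 2 ^ j * tail (lev s j)"
proof (intro exI conjI allI)
  \<comment> \<open>The top summand alone, with \<open>lev s j \<ge> j / 2\<close>.\<close>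
  define c :: real where "c = (1 / 2) ^ (CARD('d) - 1) / fact (CARD('d) - 1)"
  show "0 < c" unfolding c_def by simp
  fix s
  show "\<forall>\<^sub>F j in sequentially. 0 \<le> lev s j \<and> c * real j powr (real CARD('d) - 1 - s) \<le> 2 ^ j * tail (lev s j)"
    using lev_ge_half[of s] eventually_ge_at_top[of 1]
  proof eventually_elim
    case (elim j)
    have pos: "0 \<le> lev s j" using elim by linarith
    have d0: "0 < CARD('d)" by (rule zero_less_card_finite)
    have "c * real j powr (real CARD('d) - 1) = (real j / 2) ^ (CARD('d) - 1) / fact (CARD('d) - 1)"
      unfolding c_def using elim(2) d0 by (simp add: powr_realpow[symmetric] of_nat_diff power_divide)
    also have "\<dots> \<le> lev s j ^ (CARD('d) - 1) / fact (CARD('d) - 1)"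
      using elim(1) by (intro divide_right_mono power_mono) auto
    also have "\<dots> \<le> (\<Sum>n<CARD('d). lev s j ^ n / fact n)"
      using pos d0 by (intro member_le_sum[of "CARD('d) - 1" _ "\<lambda>n. lev s j ^ n / fact n"]) auto
    finally have "real j powr (- s) * (c * real j powr (real CARD('d) - 1)) \<le> 2 ^ j * tail (lev s j)"
      unfolding scaled_tail[OF elim(2)] by (intro mult_left_mono) auto
    moreover have "real j powr (- s) * (c * real j powr (real CARD('d) - 1)) = c * (real j powr (- s) * real j powr (real CARD('d) - 1))" by simp
    moreover have "\<dots> = c * real j powr (real CARD('d) - 1 - s)" by (simp add: powr_add[symmetric] algebra_simps)
    ultimately show ?case using pos by simp
  qed
qed

text \<open>Markov's inequality for the exponential moment with parameter 1. The constant 2 is a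
  bound for \<open>exp 1 - 1\<close>.\<close>

lemma chernoff:
  assumes "finite I" "I \<subseteq> {1..}" and A: "A \<in> sets borel" and p: "\<And>i. i \<in> I \<Longrightarrow> \<P>(\<omega> in M. X i \<omega> \<in> A) \<le> p"
  shows "\<P>(\<omega> in M. t \<le> real (card {i \<in> I. X i \<omega> \<in> A})) \<le> exp (2 * real (card I) * p - t)"
proof -
  define Y where "Y i \<omega> = exp (indicator A (X i \<omega>) :: real)" for i \<omega>
  have indY: "indep_vars (\<lambda>_. borel) Y I"
    unfolding Y_def
    by (rule indep_vars_compose2[OF indep_vars_subset[OF indep_X assms(2)], where Y = "\<lambda>_ x. exp (indicator A x)"])
      (use A in measurable)
  have measY: "Y i \<in> borel_measurable M" if "i \<in> I" for i
    using indY that unfolding indep_vars_def by auto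
  have bddY: "norm (Y i \<omega>) \<le> exp 1" for i \<omega> unfolding Y_def by (simp add: indicator_def)
  have intY: "integrable M (Y i)" if "i \<in> I" for i
    using measY[OF that] bddY by (intro integrable_const_bound[of _ "exp 1"]) auto
  have EY: "expectation (Y i) \<le> exp (2 * p)" if i: "i \<in> I" for i
  proof -
    have e: "{\<omega> \<in> space M. X i \<omega> \<in> A} \<in> events" using i assms by (intro sets_X) auto
    have "Y i \<omega> = 1 + (exp 1 - 1) * indicator {\<omega> \<in> space M. X i \<omega> \<in> A} \<omega>" if "\<omega> \<in> space M" for \<omega>
      using that unfolding Y_def by (simp add: indicator_def)
    then have "expectation (Y i) = expectation (\<lambda>\<omega>. 1 + (exp 1 - 1) * indicator {\<omega> \<in> space M. X i \<omega> \<in> A} \<omega>)"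
      by (intro Bochner_Integration.integral_cong) auto
    also have "\<dots> = 1 + (exp 1 - 1) * \<P>(\<omega> in M. X i \<omega> \<in> A)"
    proof -
      have "integrable M (indicat_real {\<omega> \<in> space M. X i \<omega> \<in> A})"
        using e by (intro integrable_real_indicator) (auto simp: emeasure_eq_measure)
      then show ?thesis using e by (simp add: prob_space)
    qed
    also have "\<dots> \<le> 1 + 2 * p"
      using p[OF i] exp_le by (intro add_mono mult_mono) auto
    also have "\<dots> \<le> exp (2 * p)" by simp
    finally show ?thesis .
  qed
  define N where "N \<omega> = (\<Prod>i\<in>I. Y i \<omega>)" for \<omega>
  have N: "N \<omega> = exp (real (card {i \<in> I. X i \<omega> \<in> A}))" for \<omega>
  proof -
    have "(\<Sum>i\<in>I. indicator A (X i \<omega>) :: real) = real (card {i \<in> I. X i \<omega> \<in> A})"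
      using assms(1) by (simp add: indicator_def sum.If_cases Int_def)
    then show ?thesis unfolding N_def Y_def using assms(1) by (simp add: exp_sum[symmetric])
  qed
  have intN: "integrable M N" unfolding N_def[abs_def] by (rule indep_vars_integrable[OF assms(1) indY intY])
  have EN: "expectation N \<le> exp (2 * real (card I) * p)"
  proof -
    have "expectation N = (\<Prod>i\<in>I. expectation (Y i))"
      unfolding N_def[abs_def] by (rule indep_vars_lebesgue_integral[OF assms(1) indY intY])
    also have "\<dots> \<le> (\<Prod>i\<in>I. exp (2 * p))"
      by (intro prod_mono conjI EY Bochner_Integration.integral_nonneg) (auto simp: Y_def)
    also have "\<dots> = exp (2 * real (card I) * p)" by (simp add: exp_of_nat_mult[symmetric] algebra_simps)
    finally show ?thesis .
  qed
  have "\<P>(\<omega> in M. exp t \<le> N \<omega>) \<le> expectation N / exp t"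
    by (rule integral_Markov_inequality_measure[OF intN, where A = "space M"]) (auto simp: N)
  also have "\<dots> \<le> exp (2 * real (card I) * p) / exp t" using EN by (intro divide_right_mono) auto
  also have "\<dots> = exp (2 * real (card I) * p - t)" by (simp add: exp_diff)
  finally show ?thesis unfolding N by simp
qed

end

section \<open>Almost sure regularity\<close>

lemma lev_mono: "s \<le> t \<Longrightarrow> 1 \<le> j \<Longrightarrow> lev s j \<le> lev t j"
  unfolding lev_def by (intro add_left_mono mult_right_mono) auto

lemma powr_mult_exp_small:
  assumes "0 < e"
  shows "\<forall>\<^sub>F j in sequentially. (real j + 1) powr D * exp (- (real j powr e)) \<le> 1 * real j powr (- 2)"
  using assms by real_asymp

lemma exp_neg_powr_small:
  assumes "0 < c" "0 < r"
  shows "\<forall>\<^sub>F j in sequentially. exp (- (c * real j powr r)) \<le> 1 * real j powr (- 2)"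
  using assms by real_asymp

lemma exp_powr_diff_small:
  assumes "u < t" "0 < t" "0 < C"
  shows "\<forall>\<^sub>F j in sequentially. exp (C * real j powr u - real j powr t) \<le> 1 * real j powr (- 2)"
  using assms by real_asymp

context record_model begin

text \<open>The convergence half of Borel--Cantelli, in the form in which the regularity properties
  use it.\<close>

lemma AE_eventually:
  assumes meas: "\<And>j. {\<omega> \<in> space M. \<not> P j \<omega>} \<in> events"
    and le: "\<forall>\<^sub>F j in sequentially. \<P>(\<omega> in M. \<not> P j \<omega>) \<le> K * real j powr (- r)"
    and r: "1 < r"
  shows "AE \<omega> in M. \<forall>\<^sub>F j in sequentially. P j \<omega>"
proof -
  have "summable (\<lambda>j. K * real j powr (- r))"
    using r by (intro summable_mult) (simp add: summable_real_powr_iff)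
  moreover have "\<forall>\<^sub>F j in sequentially. norm (\<P>(\<omega> in M. \<not> P j \<omega>)) \<le> K * real j powr (- r)"
    using le by simp
  ultimately have "summable (\<lambda>j. \<P>(\<omega> in M. \<not> P j \<omega>))"
    by (rule summable_comparison_test_ev[rotated])
  then have "AE \<omega> in M. \<forall>\<^sub>F j in sequentially. \<omega> \<in> space M - {\<omega> \<in> space M. \<not> P j \<omega>}"
    by (intro borel_cantelli_AE1 meas) (auto simp: emeasure_eq_measure)
  then show ?thesis by (auto elim: eventually_mono)
qed

lemma sets_coord_sum: "1 \<le> i \<Longrightarrow> {\<omega> \<in> space M. b < coord_sum (X i \<omega>)} \<in> events"
  using sets_X[of i "{y. b < coord_sum y}"] by simp

text \<open>A union bound over at most \<open>(j + 1) ^ d\<close> lattice points. A point with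
  coordinate sum \<open>b\<close> is missed by all \<open>2 ^ j\<close> observations with
  probability at most \<open>exp (- (2 ^ j * exp (- b)))\<close>, and at
  \<open>b = lev (-e) j\<close> this is \<open>exp (- (j powr e))\<close>.\<close>

lemma AE_lattice_dominated:
  assumes "0 < e"
  shows "AE \<omega> in M. \<forall>\<^sub>F j in sequentially.
      \<forall>g. real (sum g UNIV) \<le> lev (-e) j \<longrightarrow> dominated (path \<omega>) (2 ^ j) (gvec g)"
proof (rule AE_eventually[where K = 1 and r = 2])
  let ?P = "\<lambda>j \<omega>. \<forall>g. real (sum g UNIV) \<le> lev (-e) j \<longrightarrow> dominated (path \<omega>) (2 ^ j) (gvec g)"
  define G where "G j = {g :: 'd \<Rightarrow> nat. real (sum g UNIV) \<le> lev (-e) j}" for j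
  define F where "F j g = {\<omega> \<in> space M. \<forall>i\<in>{1..2^j}. X i \<omega> \<notin> {y. strict_less (gvec g) y}}" for j and g :: "'d \<Rightarrow> nat"
  have finG: "finite (G j)" for j
  proof (rule finite_subset[OF _ finite_simplex[of "nat \<lceil>lev (-e) j\<rceil>"]])
    show "G j \<subseteq> {g. sum g UNIV \<le> nat \<lceil>lev (-e) j\<rceil>}" unfolding G_def by (auto simp del: of_nat_sum; linarith)
  qed
  have F: "F j g \<in> events" for j g
  proof -
    have "F j g = space M - (\<Union>i\<in>{1..2^j}. {\<omega> \<in> space M. X i \<omega> \<in> {y. strict_less (gvec g) y}})"
      unfolding F_def by auto
    moreover have "{\<omega> \<in> space M. X i \<omega> \<in> {y. strict_less (gvec g) y}} \<in> events" if "i \<in> {1..2^j}" for i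
      using that by (intro sets_X sets_strict_less) auto
    ultimately show ?thesis by (simp only: sets.finite_UN sets.compl_sets finite_atLeastAtMost)
  qed
  have eq: "{\<omega> \<in> space M. \<not> ?P j \<omega>} = (\<Union>g\<in>G j. F j g)" for j
    unfolding F_def G_def dominated_def by blast
  show "{\<omega> \<in> space M. \<not> ?P j \<omega>} \<in> events" for j
    unfolding eq using finG F by (intro sets.finite_UN) auto
  note powr_mult_exp_small[OF assms, of "real CARD('d)"]
  moreover have "\<forall>\<^sub>F j in sequentially. lev (-e) j \<le> real j"
  proof -
    have "lev (-e) j \<le> real j" if "1 \<le> j" for j
    proof -
      have "real j * ln 2 \<le> real j * 1" using ln_2_less_1 by (intro mult_left_mono) auto
      moreover have "0 \<le> e * ln (real j)" using that assms by simp
      ultimately show ?thesis unfolding lev_def by simp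
    qed
    then show ?thesis by (rule eventually_mono[OF eventually_ge_at_top])
  qed
  ultimately show "\<forall>\<^sub>F j in sequentially. \<P>(\<omega> in M. \<not> ?P j \<omega>) \<le> 1 * real j powr (- 2)"
    using eventually_ge_at_top[of 1]
  proof eventually_elim
    case (elim j)
    have PF: "prob (F j g) \<le> exp (- (real j powr e))" if "g \<in> G j" for g
    proof -
      have "prob (F j g) \<le> exp (- (\<Sum>i\<in>{1..2^j}. \<P>(\<omega> in M. X i \<omega> \<in> {y. strict_less (gvec g) y})))"
        unfolding F_def by (intro prob_none_le) auto
      also have "(\<Sum>i\<in>{1..2^j}. \<P>(\<omega> in M. X i \<omega> \<in> {y. strict_less (gvec g) y}))
          = (\<Sum>i\<in>{1..2^j::nat}. exp (- real (sum g UNIV)))"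
      proof (rule sum.cong)
        fix i :: nat assume "i \<in> {1..2^j}"
        then show "\<P>(\<omega> in M. X i \<omega> \<in> {y. strict_less (gvec g) y}) = exp (- real (sum g UNIV))"
          using prob_strict_less[OF _ gvec_orthant, of i g] by (simp add: coord_sum_gvec)
      qed simp
      also have "\<dots> = 2 ^ j * exp (- real (sum g UNIV))" by simp
      finally have 1: "prob (F j g) \<le> exp (- (2 ^ j * exp (- real (sum g UNIV))))" .
      have "real j powr e = 2 ^ j * exp (- lev (-e) j)"
      proof -
        have "exp (- lev (-e) j) = exp (- (real j * ln 2)) * exp (e * ln (real j))"
          unfolding lev_def by (simp add: exp_add[symmetric])
        also have "exp (- (real j * ln 2)) = 1 / 2 ^ j"
          by (simp add: exp_minus exp_of_nat_mult field_simps)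
        also have "exp (e * ln (real j)) = real j powr e" using elim(3) by (simp add: powr_def)
        finally show ?thesis by simp
      qed
      also have "\<dots> \<le> 2 ^ j * exp (- real (sum g UNIV))" using that unfolding G_def by (simp del: of_nat_sum)
      finally have "exp (- (2 ^ j * exp (- real (sum g UNIV)))) \<le> exp (- (real j powr e))" by simp
      then show ?thesis using 1 by linarith
    qed
    have cardG: "real (card (G j)) \<le> (real j + 1) powr real CARD('d)"
    proof -
      have "G j \<subseteq> {g. \<forall>i. g i \<le> j}"
      proof safe
        fix g i assume "g \<in> G j"
        then have "real (sum g UNIV) \<le> real j" using elim(2) unfolding G_def by (simp del: of_nat_sum)
        then show "g i \<le> j" using coord_le_sum[of g i] by linarith
      qed
      then have "card (G j) \<le> card {g :: 'd \<Rightarrow> nat. \<forall>i. g i \<le> j}" by (rule card_mono[OF finite_box])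
      also have "\<dots> = (j + 1) ^ CARD('d)" by (rule card_box)
      finally have "card (G j) \<le> (j + 1) ^ CARD('d)" .
      then have "real (card (G j)) \<le> real ((j + 1) ^ CARD('d))" by (rule of_nat_mono)
      also have "\<dots> = (real j + 1) powr real CARD('d)" by (simp add: powr_realpow add.commute)
      finally show ?thesis .
    qed
    have "\<P>(\<omega> in M. \<not> ?P j \<omega>) \<le> (\<Sum>g\<in>G j. prob (F j g))"
      unfolding eq using F finG by (intro finite_measure_subadditive_finite) auto
    also have "\<dots> \<le> (\<Sum>g\<in>G j. exp (- (real j powr e)))" by (intro sum_mono PF)
    also have "\<dots> = real (card (G j)) * exp (- (real j powr e))" by simp
    also have "\<dots> \<le> (real j + 1) powr real CARD('d) * exp (- (real j powr e))"
      by (intro mult_right_mono cardG) simp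
    finally show ?case using elim(1) by linarith
  qed
qed simp

lemma exceed_eq:
  "{\<omega> \<in> space M. \<exists>i\<in>I. b < coord_sum (X i \<omega>)} = (\<Union>i\<in>I. {\<omega> \<in> space M. b < coord_sum (X i \<omega>)})"
  by blast

lemma events_exceed:
  assumes "finite I" "I \<subseteq> {1..}"
  shows "{\<omega> \<in> space M. \<exists>i\<in>I. b < coord_sum (X i \<omega>)} \<in> events"
  unfolding exceed_eq
proof (rule sets.finite_UN[OF assms(1)])
  fix i assume "i \<in> I"
  then show "{\<omega> \<in> space M. b < coord_sum (X i \<omega>)} \<in> events" using assms(2) by (intro sets_coord_sum) auto
qed

lemma prob_exceed_le:
  assumes "finite I" "I \<subseteq> {1..}" "0 \<le> b"
  shows "\<P>(\<omega> in M. \<exists>i\<in>I. b < coord_sum (X i \<omega>)) \<le> real (card I) * tail b"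
proof -
  have "prob (\<Union>i\<in>I. {\<omega> \<in> space M. b < coord_sum (X i \<omega>)}) \<le> (\<Sum>i\<in>I. \<P>(\<omega> in M. b < coord_sum (X i \<omega>)))"
  proof (rule finite_measure_subadditive_finite[OF assms(1)], rule image_subsetI)
    fix i assume "i \<in> I"
    then show "{\<omega> \<in> space M. b < coord_sum (X i \<omega>)} \<in> events" using assms(2) by (intro sets_coord_sum) auto
  qed
  also have "\<dots> = (\<Sum>i\<in>I. tail b)"
  proof (rule sum.cong[OF refl])
    fix i assume "i \<in> I"
    then show "\<P>(\<omega> in M. b < coord_sum (X i \<omega>)) = tail b"
      using assms(2,3) by (intro prob_coord_sum_gt) auto
  qed
  finally show ?thesis unfolding exceed_eq by simp
qed


end

lemma real_card_eq_sum: "real (card {i\<in>{1..n}. P i}) = (\<Sum>i\<in>{1..n}. of_bool (P i))" for n :: nat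
  using sum.inter_filter[of "{1..n}" "\<lambda>_. 1::real" P] by (simp add: of_bool_def)

context record_model begin

text \<open>The union bound gives a failure probability of order at most
  \<open>j powr (d - 1 - s)\<close>, summable as \<open>s > d\<close>.\<close>

lemma AE_sum_upper:
  assumes "real CARD('d) < s"
  shows "AE \<omega> in M. \<forall>\<^sub>F j in sequentially. \<forall>i\<in>{1..2^j}. coord_sum (X i \<omega>) \<le> lev s j"
proof -
  obtain C where "0 < C \<and> (\<forall>s. \<forall>\<^sub>F j in sequentially. 0 \<le> lev s j \<and> 2 ^ j * tail (lev s j) \<le> C * real j powr (real CARD('d) - 1 - s))"
    using scaled_tail_upper ..
  then have C: "0 < C" "\<forall>\<^sub>F j in sequentially. 0 \<le> lev s j \<and> 2 ^ j * tail (lev s j) \<le> C * real j powr (real CARD('d) - 1 - s)"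
    by (rule conjunct1, rule spec[OF conjunct2])
  have eq: "{\<omega> \<in> space M. \<not> (\<forall>i\<in>{1..2^j}. coord_sum (X i \<omega>) \<le> lev s j)} = {\<omega> \<in> space M. \<exists>i\<in>{1..2^j}. lev s j < coord_sum (X i \<omega>)}" for j
    unfolding not_le[symmetric] by blast
  show ?thesis
  proof (rule AE_eventually[where K = C and r = "s + 1 - real CARD('d)"])
    show "{\<omega> \<in> space M. \<not> (\<forall>i\<in>{1..2^j}. coord_sum (X i \<omega>) \<le> lev s j)} \<in> events" for j
      unfolding eq by (rule events_exceed) auto
    show "\<forall>\<^sub>F j in sequentially. \<P>(\<omega> in M. \<not> (\<forall>i\<in>{1..2^j}. coord_sum (X i \<omega>) \<le> lev s j))
       \<le> C * real j powr - (s + 1 - real CARD('d))"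
      using C(2)
    proof eventually_elim
      case (elim j)
      have "\<P>(\<omega> in M. \<exists>i\<in>{1..2^j}. lev s j < coord_sum (X i \<omega>)) \<le> real (card {1..2^j::nat}) * tail (lev s j)"
        by (rule prob_exceed_le) (use elim in auto)
      moreover have "real (card {1..2^j::nat}) = 2 ^ j" by simp
      moreover have "- (s + 1 - real CARD('d)) = real CARD('d) - 1 - s" by simp
      ultimately show ?case using elim unfolding eq by (simp only:) linarith
    qed
  qed (use assms in simp)
qed

text \<open>The expected number of exceedances is at least \<open>c * j powr r\<close> with
  \<open>r > 0\<close>, so none occurs with probability at most
  \<open>exp (- (c * j powr r))\<close>.\<close>

lemma AE_sum_lower:
  assumes "s < real CARD('d) - 1"
  shows "AE \<omega> in M. \<forall>\<^sub>F j in sequentially. \<exists>i\<in>{1..2^j}. lev s j < coord_sum (X i \<omega>)"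
proof -
  obtain c where "0 < c \<and> (\<forall>s. \<forall>\<^sub>F j in sequentially. 0 \<le> lev s j \<and> c * real j powr (real CARD('d) - 1 - s) \<le> 2 ^ j * tail (lev s j))"
    using scaled_tail_lower ..
  then have c: "0 < c" "\<forall>\<^sub>F j in sequentially. 0 \<le> lev s j \<and> c * real j powr (real CARD('d) - 1 - s) \<le> 2 ^ j * tail (lev s j)"
    by (rule conjunct1, rule spec[OF conjunct2])
  define r where "r = real CARD('d) - 1 - s"
  have "0 < r" using assms unfolding r_def by simp
  show ?thesis
  proof (rule AE_eventually[where K = 1 and r = 2])
    have "{\<omega> \<in> space M. \<not> (\<exists>i\<in>{1..2^j}. lev s j < coord_sum (X i \<omega>))} = space M - {\<omega> \<in> space M. \<exists>i\<in>{1..2^j}. lev s j < coord_sum (X i \<omega>)}" for j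
      by blast
    moreover have "{\<omega> \<in> space M. \<exists>i\<in>{1..2^j}. lev s j < coord_sum (X i \<omega>)} \<in> events" for j
      by (rule events_exceed) auto
    ultimately show "{\<omega> \<in> space M. \<not> (\<exists>i\<in>{1..2^j}. lev s j < coord_sum (X i \<omega>))} \<in> events" for j
      by (simp only: sets.compl_sets)
    note exp_neg_powr_small[OF c(1) \<open>0 < r\<close>]
    then show "\<forall>\<^sub>F j in sequentially. \<P>(\<omega> in M. \<not> (\<exists>i\<in>{1..2^j}. lev s j < coord_sum (X i \<omega>)))
       \<le> 1 * real j powr (- 2)"
      using c(2)
    proof eventually_elim
      case (elim j)
      have "\<P>(\<omega> in M. \<forall>i\<in>{1..2^j}. X i \<omega> \<notin> {y. lev s j < coord_sum y})
        \<le> exp (- (\<Sum>i\<in>{1..2^j}. \<P>(\<omega> in M. X i \<omega> \<in> {y. lev s j < coord_sum y})))"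
        by (intro prob_none_le) auto
      also have "(\<Sum>i\<in>{1..2^j}. \<P>(\<omega> in M. X i \<omega> \<in> {y. lev s j < coord_sum y})) = (\<Sum>i\<in>{1..2^j::nat}. tail (lev s j))"
        using prob_coord_sum_gt elim by (intro sum.cong) auto
      also have "\<dots> = 2 ^ j * tail (lev s j)" by simp
      also have "exp (- (2 ^ j * tail (lev s j))) \<le> exp (- (c * real j powr r))" using elim unfolding r_def by simp
      finally have "\<P>(\<omega> in M. \<forall>i\<in>{1..2^j}. X i \<omega> \<notin> {y. lev s j < coord_sum y}) \<le> 1 * real j powr (- 2)"
        using elim(1) by linarith
      then show ?case by simp
    qed
  qed simp
qed

lemma measurable_card_exceed:
  "(\<lambda>\<omega>. real (card {i\<in>{1..n}. b < coord_sum (X i \<omega>)})) \<in> borel_measurable M"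
  unfolding real_card_eq_sum
proof (rule borel_measurable_sum)
  fix i assume "i \<in> {1..n}"
  then have 1: "X i \<in> borel_measurable M" by (intro measurable_X) simp
  have 2: "(\<lambda>y :: real^'d. of_bool (b < coord_sum y) :: real) \<in> borel_measurable borel" by measurable
  show "(\<lambda>\<omega>. of_bool (b < coord_sum (X i \<omega>)) :: real) \<in> borel_measurable M"
    by (rule measurable_compose[OF 1 2])
qed

text \<open>The Chernoff bound \<open>exp (2 * C * j powr u - j powr t)\<close> is summable because
  \<open>u < t\<close> and \<open>t > 0\<close>.\<close>

lemma AE_exceed_count:
  assumes "0 < t" "real CARD('d) - 1 - s < t"
  shows "AE \<omega> in M. \<forall>\<^sub>F j in sequentially. real (card {i\<in>{1..2^j}. lev s j < coord_sum (X i \<omega>)}) \<le> real j powr t"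
proof -
  obtain C where "0 < C \<and> (\<forall>s. \<forall>\<^sub>F j in sequentially. 0 \<le> lev s j \<and> 2 ^ j * tail (lev s j) \<le> C * real j powr (real CARD('d) - 1 - s))"
    using scaled_tail_upper ..
  then have C: "0 < C" "\<forall>\<^sub>F j in sequentially. 0 \<le> lev s j \<and> 2 ^ j * tail (lev s j) \<le> C * real j powr (real CARD('d) - 1 - s)"
    by (rule conjunct1, rule spec[OF conjunct2])
  define u where "u = real CARD('d) - 1 - s"
  have "u < t" using assms unfolding u_def by simp
  show ?thesis
  proof (rule AE_eventually[where K = 1 and r = 2])
    show "{\<omega> \<in> space M. \<not> real (card {i\<in>{1..2^j}. lev s j < coord_sum (X i \<omega>)}) \<le> real j powr t} \<in> events" for j
      using measurable_card_exceed[of "2^j" "lev s j"] unfolding borel_measurable_iff_greater not_le by (rule spec)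
    have "\<forall>\<^sub>F j in sequentially. exp ((2 * C) * real j powr u - real j powr t) \<le> 1 * real j powr (- 2)"
      using C(1) \<open>u < t\<close> assms(1) by (intro exp_powr_diff_small) auto
    then show "\<forall>\<^sub>F j in sequentially. \<P>(\<omega> in M. \<not> real (card {i\<in>{1..2^j}. lev s j < coord_sum (X i \<omega>)}) \<le> real j powr t)
       \<le> 1 * real j powr (- 2)"
      using C(2)
    proof eventually_elim
      case (elim j)
      define N where "N \<omega> = real (card {i \<in> {1..2^j}. X i \<omega> \<in> {y. lev s j < coord_sum y}})" for \<omega>
      have ch: "\<P>(\<omega> in M. real j powr t \<le> N \<omega>)
        \<le> exp (2 * real (card {1..2^j::nat}) * tail (lev s j) - real j powr t)"
        unfolding N_def using prob_coord_sum_gt elim by (intro chernoff) auto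
      have "N \<in> borel_measurable M" unfolding N_def[abs_def] mem_Collect_eq by (rule measurable_card_exceed)
      then have "{\<omega> \<in> space M. real j powr t \<le> N \<omega>} \<in> events"
        unfolding borel_measurable_iff_ge by (rule spec)
      then have "\<P>(\<omega> in M. \<not> N \<omega> \<le> real j powr t) \<le> \<P>(\<omega> in M. real j powr t \<le> N \<omega>)"
      proof (rule finite_measure_mono[rotated])
        show "{\<omega> \<in> space M. \<not> N \<omega> \<le> real j powr t} \<subseteq> {\<omega> \<in> space M. real j powr t \<le> N \<omega>}"
          unfolding not_le using less_imp_le by blast
      qed
      also note ch
      also have "exp (2 * real (card {1..2^j::nat}) * tail (lev s j) - real j powr t) \<le> exp (2 * C * real j powr u - real j powr t)"
      proof -
        have "real (card {1..2^j::nat}) = 2 ^ j" by simp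
        moreover have "2 * (2 ^ j * tail (lev s j)) \<le> 2 * (C * real j powr u)" using elim(2) unfolding u_def by linarith
        ultimately show ?thesis unfolding exp_le_cancel_iff by (simp only: mult.assoc)
      qed
      finally have "\<P>(\<omega> in M. \<not> N \<omega> \<le> real j powr t) \<le> 1 * real j powr (- 2)" using elim(1) by linarith
      then show ?case unfolding N_def mem_Collect_eq .
    qed
  qed simp
qed

lemma AE_positive: "AE \<omega> in M. \<forall>i j. 1 \<le> i \<longrightarrow> 0 < X i \<omega> $ j"
proof -
  have "AE \<omega> in M. 1 \<le> i \<longrightarrow> 0 < X i \<omega> $ j" for i j
  proof (cases "1 \<le> i")
    case True
    have "\<P>(\<omega> in M. 0 < X i \<omega> $ j) = exp (- 0 * 1)"
      by (rule exponential_distributedD_gt[OF exponential[OF True]]) auto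
    then have "AE \<omega> in M. \<omega> \<in> {\<omega> \<in> space M. 0 < X i \<omega> $ j}" by (intro AE_prob_1) simp
    then show ?thesis by auto
  qed simp
  then show ?thesis by (intro AE_all_countable[THEN iffD2] allI AE_finite_allI) auto
qed

text \<open>Each property holds off a null set for each parameter, but the locale asks for all real
  parameters at once. Monotonicity in the level reduces them to errors \<open>1 / (n + 1)\<close>
  and, for the exceedance counts, to rational pairs.\<close>

lemma AE_regular_path: "AE \<omega> in M. regular_path (path \<omega>)"
proof -
  define e where "e n = inverse (real (Suc n))" for n
  have e0: "0 < e n" for n unfolding e_def by simp
  have small: "\<exists>n. e n < \<delta>" if "0 < \<delta>" for \<delta> unfolding e_def using reals_Archimedean[OF that] .
  have "AE \<omega> in M. \<forall>n. \<forall>\<^sub>F j in sequentially.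
      \<forall>g. real (sum g UNIV) \<le> lev (-e n) j \<longrightarrow> dominated (path \<omega>) (2 ^ j) (gvec g)"
    using AE_lattice_dominated[OF e0] by (simp add: AE_all_countable)
  moreover have "AE \<omega> in M. \<forall>n. \<forall>\<^sub>F j in sequentially. \<forall>i\<in>{1..2^j}. coord_sum (X i \<omega>) \<le> lev (real CARD('d) + e n) j"
    using AE_sum_upper e0 by (simp add: AE_all_countable)
  moreover have "AE \<omega> in M. \<forall>n. \<forall>\<^sub>F j in sequentially. \<exists>i\<in>{1..2^j}. lev (real CARD('d) - 1 - e n) j < coord_sum (X i \<omega>)"
    using AE_sum_lower e0 by (simp add: AE_all_countable)
  moreover have "AE \<omega> in M. \<forall>(s::rat) (t::rat). 0 < real_of_rat t \<longrightarrow> real CARD('d) - 1 - real_of_rat s < real_of_rat t \<longrightarrow>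
     (\<forall>\<^sub>F j in sequentially. real (card {i\<in>{1..2^j}. lev (real_of_rat s) j < coord_sum (X i \<omega>)}) \<le> real j powr real_of_rat t)"
    unfolding AE_all_countable
  proof (intro allI)
    fix s t :: rat
    show "AE \<omega> in M. 0 < real_of_rat t \<longrightarrow> real CARD('d) - 1 - real_of_rat s < real_of_rat t \<longrightarrow>
     (\<forall>\<^sub>F j in sequentially. real (card {i\<in>{1..2^j}. lev (real_of_rat s) j < coord_sum (X i \<omega>)}) \<le> real j powr real_of_rat t)"
    proof (cases "0 < real_of_rat t \<and> real CARD('d) - 1 - real_of_rat s < real_of_rat t")
      case True
      then have "AE \<omega> in M. \<forall>\<^sub>F j in sequentially. real (card {i\<in>{1..2^j}. lev (real_of_rat s) j < coord_sum (X i \<omega>)}) \<le> real j powr real_of_rat t"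
        by (intro AE_exceed_count) auto
      then show ?thesis by eventually_elim blast
    next
      case False then show ?thesis by (intro AE_I2) blast
    qed
  qed
  ultimately show ?thesis using AE_positive
  proof eventually_elim
    case (elim \<omega>)
    show ?case
    proof
      show "\<And>i j. 1 \<le> i \<Longrightarrow> 0 < X i \<omega> $ j" using elim(5) by blast
    next
      fix \<delta> :: real assume "0 < \<delta>"
      then obtain n where n: "e n < \<delta>" using small by blast
      show "\<forall>\<^sub>F j in sequentially. \<forall>g. real (sum g UNIV) \<le> lev (-\<delta>) j \<longrightarrow> dominated (path \<omega>) (2 ^ j) (gvec g)"
        using elim(1)[rule_format, of n] eventually_ge_at_top[of 1]
      proof eventually_elim
        case (elim j)
        have l: "lev (-\<delta>) j \<le> lev (- e n) j" using n elim(2) by (intro lev_mono) auto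
        show ?case
        proof (intro allI impI)
          fix g :: "'d \<Rightarrow> nat" assume "real (sum g UNIV) \<le> lev (-\<delta>) j"
          then have "real (sum g UNIV) \<le> lev (- e n) j" using l by (rule order_trans)
          then show "dominated (path \<omega>) (2 ^ j) (gvec g)" using elim(1) by blast
        qed
      qed
    next
      fix s assume "real CARD('d) < s"
      then obtain n where n: "e n < s - real CARD('d)" using small[of "s - real CARD('d)"] by auto
      show "\<forall>\<^sub>F j in sequentially. \<forall>i\<in>{1..2^j}. coord_sum (X i \<omega>) \<le> lev s j"
        using elim(2)[rule_format, of n] eventually_ge_at_top[of 1]
      proof eventually_elim
        case (elim j)
        have l: "lev (real CARD('d) + e n) j \<le> lev s j" using n elim(2) by (intro lev_mono) auto
        show ?case
        proof
          fix i assume "i \<in> {1..(2::nat)^j}"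
          with elim(1) have "coord_sum (X i \<omega>) \<le> lev (real CARD('d) + e n) j" by (rule bspec)
          then show "coord_sum (X i \<omega>) \<le> lev s j" using l by (rule order_trans)
        qed
      qed
    next
      fix s assume "s < real CARD('d) - 1"
      then obtain n where n: "e n < real CARD('d) - 1 - s" using small[of "real CARD('d) - 1 - s"] by auto
      show "\<forall>\<^sub>F j in sequentially. \<exists>i\<in>{1..2^j}. lev s j < coord_sum (X i \<omega>)"
        using elim(3)[rule_format, of n] eventually_ge_at_top[of 1]
      proof eventually_elim
        case (elim j)
        have l: "lev s j \<le> lev (real CARD('d) - 1 - e n) j" using n elim(2) by (intro lev_mono) auto
        obtain i where i: "i \<in> {1..2^j}" "lev (real CARD('d) - 1 - e n) j < coord_sum (X i \<omega>)"
          using elim(1) by (rule bexE)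
        have "lev s j < coord_sum (X i \<omega>)" using l i(2) by (rule le_less_trans)
        then show ?case using i(1) by (rule bexI)
      qed
    next
      fix s t :: real assume st: "0 < t" "real CARD('d) - 1 - s < t"
      \<comment> \<open>With \<open>t'\<close> between \<open>t0\<close> and \<open>t\<close>, and
        \<open>s'\<close> between \<open>d - 1 - t'\<close> and \<open>s\<close>, the rational pair
        meets the side conditions. It implies the claim for \<open>s\<close> and \<open>t\<close>,
        since a lower level only raises the count.\<close>
      define t0 where "t0 = max 0 (real CARD('d) - 1 - s)"
      obtain t' where t': "t0 < real_of_rat t'" "real_of_rat t' < t"
        using of_rat_dense[of t0 t] st unfolding t0_def by auto
      obtain s' where s': "real CARD('d) - 1 - real_of_rat t' < real_of_rat s'" "real_of_rat s' < s"
        using of_rat_dense[of "real CARD('d) - 1 - real_of_rat t'" s] t'(1) unfolding t0_def by auto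
      have "0 < real_of_rat t'" "real CARD('d) - 1 - real_of_rat s' < real_of_rat t'"
        using t'(1) s'(1) unfolding t0_def by auto
      then have "\<forall>\<^sub>F j in sequentially. real (card {i\<in>{1..2^j}. lev (real_of_rat s') j < coord_sum (X i \<omega>)}) \<le> real j powr real_of_rat t'"
        using elim(4) by blast
      then show "\<forall>\<^sub>F j in sequentially. real (card {i\<in>{1..2^j}. lev s j < coord_sum (X i \<omega>)}) \<le> real j powr t"
        using eventually_ge_at_top[of 1]
      proof eventually_elim
        case (elim j)
        have l: "lev (real_of_rat s') j \<le> lev s j" using s'(2) elim(2) by (intro lev_mono) auto
        have "card {i\<in>{1..2^j}. lev s j < coord_sum (X i \<omega>)} \<le> card {i\<in>{1..2^j}. lev (real_of_rat s') j < coord_sum (X i \<omega>)}"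
        proof (rule card_mono)
          show "{i\<in>{1..2^j}. lev s j < coord_sum (X i \<omega>)} \<subseteq> {i\<in>{1..2^j}. lev (real_of_rat s') j < coord_sum (X i \<omega>)}"
            using le_less_trans[OF l] by blast
        qed simp
        moreover have "real j powr real_of_rat t' \<le> real j powr t" using t'(2) elim(2) by (intro powr_mono) auto
        ultimately show ?case using elim(1) by linarith
      qed
    qed
  qed
qed

end

section \<open>Infinitely many exceedances of the level with exponent d\<close>

lemma block_sum:
  fixes h :: "nat \<Rightarrow> real"
  assumes "N \<le> L" and h: "\<And>j i. i \<in> {2^j<..2^(j+1)} \<Longrightarrow> h i = p j"
  shows "(\<Sum>i\<in>{2^N<..2^L}. h i) = (\<Sum>j\<in>{N..<L}. 2^j * p j)"
  using assms(1)
proof (induction L rule: dec_induct)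
  case base then show ?case by simp
next
  case (step L)
  have "(2::nat)^N \<le> 2^L" "(2::nat)^L \<le> 2^(L+1)" using step(1) by simp_all
  then have "{2^N<..2^(L+1)} = {2^N<..2^L} \<union> {2^L<..2^(L+1)::nat}" by (rule ivl_disj_un_two(6)[symmetric])
  then have "(\<Sum>i\<in>{2^N<..2^(L+1)}. h i) = (\<Sum>i\<in>{2^N<..2^L}. h i) + (\<Sum>i\<in>{2^L<..2^(L+1)}. h i)"
    by (simp only:) (rule sum.union_disjoint, auto)
  also have "(\<Sum>i\<in>{2^L<..2^(L+1)}. h i) = (\<Sum>i\<in>{2^L<..2^(L+1)::nat}. p L)" using h by (rule sum.cong[OF refl])
  also have "\<dots> = 2^L * p L" by simp
  finally show ?case using step by simp
qed

lemma two_le_of_power_less: "i \<in> {2^N<..(2::nat)^L} \<Longrightarrow> 2 \<le> i"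
proof -
  assume "i \<in> {2^N<..(2::nat)^L}"
  moreover have "(1::nat) \<le> 2^N" by simp
  ultimately show "2 \<le> i" unfolding greaterThanAtMost_iff by linarith
qed

context record_model begin

text \<open>The second Borel--Cantelli lemma for the exceedances of \<open>lev d j\<close>, whose block probabilities
  are of order \<open>1/j\<close>.\<close>

lemma AE_frequently_exceed:
  "AE \<omega> in M. \<exists>\<^sub>F j in sequentially. \<exists>i\<in>{2^j<..2^(j+1)}. lev (real CARD('d)) j < coord_sum (X i \<omega>)"
proof -
  define l where "l j = lev (real CARD('d)) j" for j
  obtain c where "0 < c \<and> (\<forall>s. \<forall>\<^sub>F j in sequentially. 0 \<le> lev s j \<and> c * real j powr (real CARD('d) - 1 - s) \<le> 2 ^ j * tail (lev s j))"
    using scaled_tail_lower ..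
  then have c: "0 < c" "\<forall>\<^sub>F j in sequentially. 0 \<le> l j \<and> c * real j powr (real CARD('d) - 1 - real CARD('d)) \<le> 2 ^ j * tail (l j)"
    unfolding l_def by (rule conjunct1, rule spec[OF conjunct2])
  obtain J where J: "\<And>j. J \<le> j \<Longrightarrow> 0 \<le> l j \<and> c * real j powr (real CARD('d) - 1 - real CARD('d)) \<le> 2 ^ j * tail (l j)"
    using c(2) unfolding eventually_sequentially by blast
  have tailj: "0 \<le> l j" "c * inverse (real j) \<le> 2 ^ j * tail (l j)" if "J \<le> j" for j
    using J[OF that] by (simp_all add: powr_minus_divide inverse_eq_divide powr_neg_one' )
  \<comment> \<open>The block of an observation. Attaching levels to observations allows a single
    product bound over all of them, in place of independence of block events.\<close>
  define blk where "blk i = (LEAST j. i \<le> (2::nat)^(j+1))" for i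
  have blk: "blk i = j" if "i \<in> {2^j<..2^(j+1)}" for i j
    unfolding blk_def
  proof (rule Least_equality)
    show "i \<le> 2^(j+1)" using that by simp
    fix k assume "i \<le> 2^(k+1)"
    then have "(2::nat)^j < 2^(k+1)" using that by simp
    then have "j < k + 1" by (rule power_less_imp_less_exp[rotated]) simp
    then show "j \<le> k" by simp
  qed
  \<comment> \<open>Absence of exceedances from block \<open>N\<close> up to block
    \<open>L - 1\<close>. Its probability is at most \<open>exp\<close> of minus \<open>c\<close>
    times a piece of the harmonic series, hence tends to 0 as \<open>L\<close> grows.\<close>
  define F where "F N L = {\<omega> \<in> space M. \<forall>i\<in>{2^N<..2^L}. X i \<omega> \<notin> {y. l (blk i) < coord_sum y}}" for N L :: nat
  have FE: "F N L \<in> events" for N L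
  proof -
    have "F N L = space M - (\<Union>i\<in>{2^N<..2^L}. {\<omega> \<in> space M. l (blk i) < coord_sum (X i \<omega>)})"
      unfolding F_def by blast
    moreover have "(\<Union>i\<in>{2^N<..2^L}. {\<omega> \<in> space M. l (blk i) < coord_sum (X i \<omega>)}) \<in> events"
    proof (rule sets.finite_UN)
      fix i assume "i \<in> {2^N<..(2::nat)^L}"
      then have "1 \<le> i" by simp
      then show "{\<omega> \<in> space M. l (blk i) < coord_sum (X i \<omega>)} \<in> events" by (rule sets_coord_sum)
    qed simp
    ultimately show ?thesis by (simp only: sets.compl_sets)
  qed
  have le: "prob (F N L) \<le> exp (- (c * (\<Sum>j\<in>{N..<L}. inverse (real j))))" if "J \<le> N" "N \<le> L" for N L
  proof -
    have "prob (F N L) \<le> exp (- (\<Sum>i\<in>{2^N<..2^L}. \<P>(\<omega> in M. X i \<omega> \<in> {y. l (blk i) < coord_sum y})))"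
      unfolding F_def
    proof (rule prob_none_le)
      show "{2 ^ N<..2 ^ L} \<subseteq> {1::nat..}" by auto
    qed simp_all
    also have "(\<Sum>i\<in>{2^N<..2^L}. \<P>(\<omega> in M. X i \<omega> \<in> {y. l (blk i) < coord_sum y}))
        = (\<Sum>i\<in>{2^N<..2^L}. tail (l (blk i)))"
    proof (rule sum.cong[OF refl])
      fix i assume i: "i \<in> {2^N<..(2::nat)^L}"
      then have "2 \<le> i" by (rule two_le_of_power_less)
      then obtain j where j: "2^j < i" "i \<le> 2^(j+1)" by (rule dyadic_block)
      have "(2::nat)^N < 2^(j+1)" using i j(2) by simp
      then have "N < j + 1" by (rule power_less_imp_less_exp[rotated]) simp
      then have "0 \<le> l (blk i)" using blk[of i j] j that(1) tailj(1) by simp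
      moreover have "1 \<le> i" using \<open>2 \<le> i\<close> by simp
      ultimately show "\<P>(\<omega> in M. X i \<omega> \<in> {y. l (blk i) < coord_sum y}) = tail (l (blk i))"
        using prob_coord_sum_gt by simp
    qed
    also have "\<dots> = (\<Sum>j\<in>{N..<L}. 2^j * tail (l j))"
      using that(2) by (rule block_sum) (simp only: blk)
    finally have "prob (F N L) \<le> exp (- (\<Sum>j\<in>{N..<L}. 2^j * tail (l j)))" .
    moreover have "c * (\<Sum>j\<in>{N..<L}. inverse (real j)) \<le> (\<Sum>j\<in>{N..<L}. 2^j * tail (l j))"
      unfolding sum_distrib_left using that(1) by (intro sum_mono tailj(2)) simp
    ultimately show ?thesis by (smt (verit) exp_le_cancel_iff)
  qed
  have null: "prob (\<Inter>L. F N L) = 0" if N: "J \<le> N" for N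
  proof -
    have "prob (\<Inter>L. F N L) \<le> exp (- (c * (\<Sum>j<n. inverse (real (j + N)))))" for n
    proof -
      have "(\<Inter>L. F N L) \<subseteq> F N (n + N)" by blast
      then have "prob (\<Inter>L. F N L) \<le> prob (F N (n + N))" by (rule finite_measure_mono[OF _ FE])
      also have "\<dots> \<le> exp (- (c * (\<Sum>j\<in>{N..<n + N}. inverse (real j))))" by (rule le[OF N]) simp
      also have "(\<Sum>j\<in>{N..<n + N}. inverse (real j)) = (\<Sum>j<n. inverse (real (j + N)))"
        using sum.shift_bounds_nat_ivl[of "\<lambda>j. inverse (real j)" 0 N n] by (simp add: lessThan_atLeast0)
      finally show ?thesis .
    qed
    then have bound: "prob (\<Inter>L. F N L) \<le> exp (- (c * (\<Sum>j<n. inverse (real (j + N)))))" for n .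
    have "\<not> 0 < prob (\<Inter>L. F N L)"
    proof
      assume pos: "0 < prob (\<Inter>L. F N L)"
      have "(\<Sum>j<n. inverse (real (j + N))) \<le> - ln (prob (\<Inter>L. F N L)) / c" for n
      proof -
        have "ln (prob (\<Inter>L. F N L)) \<le> ln (exp (- (c * (\<Sum>j<n. inverse (real (j + N))))))"
          using bound[of n] pos by (intro ln_mono)
        then have "c * (\<Sum>j<n. inverse (real (j + N))) \<le> - ln (prob (\<Inter>L. F N L))" by simp
        then show ?thesis unfolding pos_le_divide_eq[OF c(1)] mult.commute[of _ c] .
      qed
      then have "summable (\<lambda>j. inverse (real (j + N)))" by (intro summableI_nonneg_bounded) auto
      then have "summable (\<lambda>j. inverse (real j))" by (rule summable_iff_shift[THEN iffD1])
      then show False using not_summable_harmonic[where 'a = real] by simp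
    qed
    then show ?thesis using measure_nonneg[of M "\<Inter>L. F N L"] by linarith
  qed
  have "AE \<omega> in M. \<omega> \<notin> (\<Inter>L. F (N + J) L)" for N
  proof -
    have "(\<Inter>L. F (N + J) L) \<in> events" using FE by (intro sets.countable_INT) auto
    then have "(\<Inter>L. F (N + J) L) \<in> null_sets M" using null[of "N + J"] by (simp add: emeasure_eq_measure null_setsI)
    then show ?thesis by (rule AE_not_in)
  qed
  then have "AE \<omega> in M. \<forall>N. \<omega> \<notin> (\<Inter>L. F (N + J) L)" by (simp add: AE_all_countable)
  moreover have "AE \<omega> in M. \<omega> \<in> space M" by (rule AE_space)
  ultimately show ?thesis
  proof eventually_elim
    case (elim \<omega>)
    show ?case unfolding frequently_sequentially
    proof
      fix N
      obtain L where "\<omega> \<notin> F (N + J) L" using elim(1) by blast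
      then obtain i where i: "i \<in> {2^(N+J)<..(2::nat)^L}" "l (blk i) < coord_sum (X i \<omega>)"
        using elim(2) unfolding F_def by blast
      have "2 \<le> i" using i(1) by (rule two_le_of_power_less)
      then obtain j where j: "2^j < i" "i \<le> 2^(j+1)" by (rule dyadic_block)
      have "(2::nat)^(N+J) < 2^(j+1)" using i j(2) by simp
      then have "N + J < j + 1" by (rule power_less_imp_less_exp[rotated]) simp
      moreover have "lev (real CARD('d)) j < coord_sum (X i \<omega>)" using i(2) blk[of i j] j unfolding l_def by simp
      moreover have "i \<in> {2^j<..2^(j+1)}" using j by simp
      ultimately have "N \<le> j \<and> (\<exists>i\<in>{2^j<..2^(j+1)}. lev (real CARD('d)) j < coord_sum (X i \<omega>))" by auto
      then show "\<exists>j\<ge>N. \<exists>i\<in>{2^j<..2^(j+1)}. lev (real CARD('d)) j < coord_sum (X i \<omega>)" by blast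
    qed
  qed
qed

end

section \<open>Records and outliers are independent\<close>

lemma Rcount_cong:
  assumes "\<And>i. i \<in> {1..n} \<Longrightarrow> x i = y i"
  shows "Rcount x n = Rcount y n"
proof -
  have "is_record x k \<longleftrightarrow> is_record y k" if "k \<in> {1..n}" for k
  proof -
    have "x i = y i" if "i \<in> {1..<k}" for i using assms[of i] that \<open>k \<in> {1..n}\<close> by auto
    then show ?thesis unfolding is_record_def using assms[OF that] by auto
  qed
  then have "{k \<in> {1..n}. is_record x k} = {k \<in> {1..n}. is_record y k}" by blast
  then show ?thesis unfolding Rcount_def by simp
qed

text \<open>All counts in \<open>recent\<close> are taken at times up to \<open>2 ^ j\<close>, owing
  to the restriction \<open>l + w \<le> j\<close>.\<close>

lemma recent_cong:
  assumes "\<And>i. i \<in> {1..2^j} \<Longrightarrow> x i = y i"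
  shows "recent e J h m x j \<longleftrightarrow> recent e J h m y j"
proof -
  have R: "Rcount x (2^l) = Rcount y (2^l)" if "l \<le> j" for l
  proof (rule Rcount_cong)
    fix i assume "i \<in> {1..(2::nat)^l}"
    moreover have "(2::nat)^l \<le> 2^j" using that by simp
    ultimately have "i \<in> {1..2^j}" unfolding atLeastAtMost_iff by linarith
    then show "x i = y i" by (rule assms)
  qed
  have "(\<forall>l w. J \<le> l \<longrightarrow> l + w \<le> j \<longrightarrow> real l powr e \<le> real w \<longrightarrow>
       real l powr (real CARD('a) - 1 - e) \<le> real (Rcount x (2^(l+w))) - real (Rcount x (2^l))) \<longleftrightarrow>
    (\<forall>l w. J \<le> l \<longrightarrow> l + w \<le> j \<longrightarrow> real l powr e \<le> real w \<longrightarrow>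
       real l powr (real CARD('a) - 1 - e) \<le> real (Rcount y (2^(l+w))) - real (Rcount y (2^l)))"
  proof (intro all_cong1 imp_cong[OF refl])
    fix l w assume "l + w \<le> j"
    then show "(real l powr (real CARD('a) - 1 - e) \<le> real (Rcount x (2^(l+w))) - real (Rcount x (2^l))) \<longleftrightarrow>
      (real l powr (real CARD('a) - 1 - e) \<le> real (Rcount y (2^(l+w))) - real (Rcount y (2^l)))"
      using R[of "l + w"] R[of l] by simp
  qed
  then show ?thesis unfolding recent_def using R[of j] by simp
qed

lemma outlier_cong:
  assumes "\<And>i. i \<in> {2^j<..2^(j+1)} \<Longrightarrow> x i = y i"
  shows "outlier a x j \<longleftrightarrow> outlier a y j"
  unfolding outlier_def using assms by (intro bex_cong) auto

text \<open>Measurability is stated for a general measure space \<open>S\<close> because it is used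
  both on \<open>M\<close> and on the product space of the first \<open>2 ^ j\<close> observations,
  where the independence argument takes place.\<close>

context
  fixes S :: "'b measure" and Y :: "nat \<Rightarrow> 'b \<Rightarrow> real^'d" and n :: nat
  assumes Y: "\<And>i. i \<in> {1..n} \<Longrightarrow> Y i \<in> borel_measurable S"
begin

lemma pred_strict_less:
  assumes "f \<in> borel_measurable S" "g \<in> borel_measurable S"
  shows "Measurable.pred S (\<lambda>\<omega>. strict_less (f \<omega>) (g \<omega> :: real^'d))"
proof -
  have "Measurable.pred S (\<lambda>\<omega>. \<forall>j\<in>UNIV. f \<omega> $ j < g \<omega> $ j)"
  proof (rule pred_intros_finite(3))
    fix j
    show "Measurable.pred S (\<lambda>\<omega>. f \<omega> $ j < g \<omega> $ j)"
      unfolding pred_def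
      by (intro borel_measurable_less measurable_compose[OF _ borel_measurable_nth] assms)
  qed simp
  then show ?thesis unfolding strict_less_def by simp
qed

lemma pred_dominated:
  assumes "k \<le> n"
  shows "Measurable.pred S (\<lambda>\<omega>. dominated (\<lambda>i. Y i \<omega>) k z)"
  unfolding dominated_def
  by (intro pred_intros_finite(4) pred_strict_less Y) (use assms in auto)

lemma pred_record:
  assumes "k \<in> {1..n}"
  shows "Measurable.pred S (\<lambda>\<omega>. is_record (\<lambda>i. Y i \<omega>) k)"
proof -
  have "Measurable.pred S (\<lambda>\<omega>. \<forall>i\<in>{1..<k}. \<not> strict_less (Y k \<omega>) (Y i \<omega>))"
    by (intro pred_intros_finite(3) pred_intros_logic(2) pred_strict_less Y) (use assms in auto)
  then show ?thesis unfolding is_record_def using assms by simp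
qed

lemma measurable_Rcount:
  assumes "k \<le> n"
  shows "(\<lambda>\<omega>. real (Rcount (\<lambda>i. Y i \<omega>) k)) \<in> borel_measurable S"
  unfolding Rcount_def real_card_eq_sum
proof (rule borel_measurable_sum)
  fix i assume "i \<in> {1..k}"
  then have [measurable]: "Measurable.pred S (\<lambda>\<omega>. is_record (\<lambda>i. Y i \<omega>) i)" using assms by (intro pred_record) auto
  show "(\<lambda>\<omega>. of_bool (is_record (\<lambda>i. Y i \<omega>) i) :: real) \<in> borel_measurable S"
    unfolding of_bool_def by measurable
qed

lemma pred_recent:
  assumes n: "n = 2^j"
  shows "Measurable.pred S (\<lambda>\<omega>. recent e J h m (\<lambda>i. Y i \<omega>) j)"
proof -
  have R: "(\<lambda>\<omega>. real (Rcount (\<lambda>i. Y i \<omega>) (2^l))) \<in> borel_measurable S" if "l \<le> j" for l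
    using that by (intro measurable_Rcount) (simp add: n)
  have 1: "Measurable.pred S (\<lambda>\<omega>. real m - h \<le> real (Rcount (\<lambda>i. Y i \<omega>) (2^j)))"
    unfolding pred_def by (intro borel_measurable_le R) auto
  have 2: "Measurable.pred S (\<lambda>\<omega>. real (Rcount (\<lambda>i. Y i \<omega>) (2^j)) \<le> real m)"
    unfolding pred_def by (intro borel_measurable_le R) auto
  have 3: "Measurable.pred S (\<lambda>\<omega>. real l powr (real CARD('d) - 1 - e)
      \<le> real (Rcount (\<lambda>i. Y i \<omega>) (2^(l+w))) - real (Rcount (\<lambda>i. Y i \<omega>) (2^l)))" if "l + w \<le> j" for l w
    unfolding pred_def using that by (intro borel_measurable_le borel_measurable_diff R) auto
  show ?thesis unfolding recent_def
    by (intro pred_intros_logic(3) pred_intros_countable(1) pred_intros_imp' 1 2[unfolded of_nat_le_iff] 3)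
qed

end

context record_model begin

lemma pred_tame: "Measurable.pred M (\<lambda>\<omega>. tame e (path \<omega>) j)"
proof -
  have X: "X i \<in> borel_measurable M" if "i \<in> {1..n}" for i n using that by (intro measurable_X) simp
  have D: "Measurable.pred M (\<lambda>\<omega>. dominated (path \<omega>) k z)" for k z by (rule pred_dominated[OF X]) auto
  have R: "(\<lambda>\<omega>. real (Rcount (path \<omega>) k)) \<in> borel_measurable M" for k by (rule measurable_Rcount[OF X]) auto
  have S: "(\<lambda>\<omega>. coord_sum (X i \<omega>)) \<in> borel_measurable M" if "i \<in> {1..n}" for i n
    by (rule measurable_compose[OF X[OF that] borel_measurable_coord_sum])
  have 1: "Measurable.pred M (\<lambda>\<omega>. \<forall>i\<in>{1..2^j}. coord_sum (X i \<omega>) \<le> b)" for b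
    by (rule pred_intros_finite(3)) (auto simp: pred_def intro!: borel_measurable_le S)
  have 2: "Measurable.pred M (\<lambda>\<omega>. \<exists>i\<in>{1..2^j}. b < coord_sum (X i \<omega>))" for b
    by (rule pred_intros_finite(4)) (auto simp: pred_def intro!: borel_measurable_less S)
  have 3: "Measurable.pred M (\<lambda>\<omega>. b \<le> real (Rcount (path \<omega>) k))"
    "Measurable.pred M (\<lambda>\<omega>. real (Rcount (path \<omega>) k) \<le> b)"
    "Measurable.pred M (\<lambda>\<omega>. b \<le> real (Rcount (path \<omega>) k) - real (Rcount (path \<omega>) l))"
    "Measurable.pred M (\<lambda>\<omega>. real (Rcount (path \<omega>) k) - real (Rcount (path \<omega>) l) \<le> b)" for b k l
    unfolding pred_def by (intro borel_measurable_le borel_measurable_diff R borel_measurable_const)+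
  show ?thesis unfolding tame_def
    by (intro pred_intros_logic(3) pred_intros_countable pred_intros_imp' pred_intros_conj1' pred_intros_logic(2) 1 2 3 D)
qed

text \<open>The restrictions of the path to the disjoint index sets \<open>I1\<close> and
  \<open>I2\<close> are independent random elements of product spaces. The congruence lemmas
  identify each event with one about its own restriction.\<close>

lemma prob_recent_outlier:
  "\<P>(\<omega> in M. recent e J h m (path \<omega>) j \<and> outlier a (path \<omega>) j)
    = \<P>(\<omega> in M. recent e J h m (path \<omega>) j) * \<P>(\<omega> in M. outlier a (path \<omega>) j)"
proof -
  define I1 I2 where "I1 = {1..(2::nat)^j}" and "I2 = {2^j<..(2::nat)^(j+1)}"
  define P1 P2 where "P1 = PiM I1 (\<lambda>_. borel :: (real^'d) measure)" and "P2 = PiM I2 (\<lambda>_. borel :: (real^'d) measure)"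
  define Y1 Y2 where "Y1 \<omega> = restrict (path \<omega>) I1" and "Y2 \<omega> = restrict (path \<omega>) I2" for \<omega>
  define A1 A2 where "A1 = {y \<in> space P1. recent e J h m y j}" and "A2 = {y \<in> space P2. outlier a y j}"
  have ind: "indep_var P1 Y1 P2 Y2"
    unfolding P1_def P2_def Y1_def[abs_def] Y2_def[abs_def]
    by (rule indep_var_restrict[OF indep_X]) (auto simp: I1_def I2_def)
  have A1: "A1 \<in> sets P1"
  proof -
    have "Measurable.pred P1 (\<lambda>y. recent e J h m (\<lambda>i. (\<lambda>i y. y i) i y) j)"
      by (rule pred_recent[OF _ refl]) (auto simp: P1_def I1_def intro!: measurable_component_singleton)
    then show ?thesis unfolding A1_def pred_def by simp
  qed
  have A2: "A2 \<in> sets P2"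
  proof -
    have "Measurable.pred P2 (\<lambda>y. outlier a y j)"
      unfolding outlier_def
    proof (rule pred_intros_finite(4))
      fix i assume "i \<in> {2^j<..(2::nat)^(j+1)}"
      then have "(\<lambda>y. y i) \<in> borel_measurable P2" unfolding P2_def I2_def by (rule measurable_component_singleton)
      then have "(\<lambda>y. coord_sum (y i)) \<in> borel_measurable P2" by (rule measurable_compose[OF _ borel_measurable_coord_sum])
      then show "Measurable.pred P2 (\<lambda>y. lev (real CARD('d) - 1 + a) j < coord_sum (y i))"
        unfolding pred_def by (intro borel_measurable_less borel_measurable_const)
    qed simp
    then show ?thesis unfolding A2_def pred_def by simp
  qed
  have sp: "Y1 \<omega> \<in> space P1" "Y2 \<omega> \<in> space P2" for \<omega>
    unfolding Y1_def Y2_def P1_def P2_def by (simp_all add: space_PiM PiE_def)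
  have c1: "recent e J h m (Y1 \<omega>) j \<longleftrightarrow> recent e J h m (path \<omega>) j" for \<omega>
    by (rule recent_cong) (simp add: Y1_def I1_def)
  have c2: "outlier a (Y2 \<omega>) j \<longleftrightarrow> outlier a (path \<omega>) j" for \<omega>
    by (rule outlier_cong) (simp add: Y2_def I2_def)
  have "prob ((\<lambda>\<omega>. (Y1 \<omega>, Y2 \<omega>)) -` (A1 \<times> A2) \<inter> space M) = prob (Y1 -` A1 \<inter> space M) * prob (Y2 -` A2 \<inter> space M)"
    by (rule indep_varD[OF ind A1 A2])
  moreover have "(\<lambda>\<omega>. (Y1 \<omega>, Y2 \<omega>)) -` (A1 \<times> A2) \<inter> space M = {\<omega> \<in> space M. recent e J h m (path \<omega>) j \<and> outlier a (path \<omega>) j}"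
    unfolding A1_def A2_def using sp c1 c2 by auto
  moreover have "Y1 -` A1 \<inter> space M = {\<omega> \<in> space M. recent e J h m (path \<omega>) j}"
    unfolding A1_def using sp c1 by auto
  moreover have "Y2 -` A2 \<inter> space M = {\<omega> \<in> space M. outlier a (path \<omega>) j}"
    unfolding A2_def using sp c2 by auto
  ultimately show ?thesis by simp
qed

end

lemma regular_tame_path:
  fixes x :: "nat \<Rightarrow> real^'d"
  assumes "regular_path x" "2 \<le> CARD('d)" "0 < e"
  obtains J where "1 \<le> J" "tame_path e J x"
proof -
  interpret regular_path x by fact
  obtain J where "\<And>j. J \<le> j \<Longrightarrow> tame e x j"
    using eventually_tame[OF assms(2,3)] unfolding eventually_sequentially by blast
  then have "tame_path e (max J 1) x"
    unfolding tame_path_def using infinite_records positive_path_axioms by simp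
  then show thesis by (rule that[rotated]) simp
qed

text \<open>At \<open>e = 0\<close> both inequalities are strict, with differences
  \<open>\<delta> * D / 2\<close> and \<open>\<delta> / 2\<close>, so they persist for small
  \<open>e\<close>. The first lets a width excess of \<open>\<delta>\<close> force an outlier with
  \<open>a = \<delta> * D / 2\<close>; the second lets the outlier probability beat the number of
  candidate blocks.\<close>

lemma exponent_choice:
  fixes D \<delta> :: real
  assumes "2 \<le> D" "0 < \<delta>"
  obtains e where "0 < e" "e < 1"
    "D - 1 + \<delta> * D / 2 < (1 - 1 / D + \<delta>) * (D - e) - e"
    "((D - 1 + 2 * e) / (D - e) - (1 / (D + e)) * (D - 1 - e)) + (1 / (D - e)) * e < (\<delta> * D / 2) * (1 / (D + e))"
proof -
  have "((\<lambda>e. (1 - 1 / D + \<delta>) * (D - e) - e - (D - 1 + \<delta> * D / 2)) \<longlongrightarrow> (1 - 1 / D + \<delta>) * (D - 0) - 0 - (D - 1 + \<delta> * D / 2)) (at_right 0)"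
    by (intro tendsto_intros)
  moreover have "0 < (1 - 1 / D + \<delta>) * (D - 0) - 0 - (D - 1 + \<delta> * D / 2)"
    using assms by (simp add: field_simps)
  ultimately have 1: "\<forall>\<^sub>F e in at_right 0. 0 < (1 - 1 / D + \<delta>) * (D - e) - e - (D - 1 + \<delta> * D / 2)"
    by (rule order_tendstoD(1))
  have "((\<lambda>e. (\<delta> * D / 2) * (1 / (D + e)) - (((D - 1 + 2 * e) / (D - e) - (1 / (D + e)) * (D - 1 - e)) + (1 / (D - e)) * e))
    \<longlongrightarrow> (\<delta> * D / 2) * (1 / (D + 0)) - (((D - 1 + 2 * 0) / (D - 0) - (1 / (D + 0)) * (D - 1 - 0)) + (1 / (D - 0)) * 0)) (at_right 0)"
    using assms by (intro tendsto_intros) auto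
  moreover have "0 < (\<delta> * D / 2) * (1 / (D + 0)) - (((D - 1 + 2 * 0) / (D - 0) - (1 / (D + 0)) * (D - 1 - 0)) + (1 / (D - 0)) * 0)"
    using assms by simp
  ultimately have 2: "\<forall>\<^sub>F e in at_right 0. 0 < (\<delta> * D / 2) * (1 / (D + e)) - (((D - 1 + 2 * e) / (D - e) - (1 / (D + e)) * (D - 1 - e)) + (1 / (D - e)) * e)"
    by (rule order_tendstoD(1))
  have 3: "\<forall>\<^sub>F e in at_right (0::real). 0 < e \<and> e < 1"
    using eventually_at_right_real[of 0 1] by (auto elim: eventually_mono)
  have "\<forall>\<^sub>F e in at_right 0. 0 < e \<and> e < 1 \<and> D - 1 + \<delta> * D / 2 < (1 - 1 / D + \<delta>) * (D - e) - e \<and>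
    ((D - 1 + 2 * e) / (D - e) - (1 / (D + e)) * (D - 1 - e)) + (1 / (D - e)) * e < (\<delta> * D / 2) * (1 / (D + e))"
    using 1 2 3 by eventually_elim linarith
  then obtain e where "0 < e \<and> e < 1 \<and> D - 1 + \<delta> * D / 2 < (1 - 1 / D + \<delta>) * (D - e) - e \<and>
    ((D - 1 + 2 * e) / (D - e) - (1 / (D + e)) * (D - 1 - e)) + (1 / (D - e)) * e < (\<delta> * D / 2) * (1 / (D + e))"
    using eventually_happens'[OF trivial_limit_at_right_real] by blast
  then show thesis using that by blast
qed

text \<open>The first factor bounds the outlier probability of one block, the second is the bound of
  \<open>card_recent\<close>. The leading power of \<open>m\<close> in the product is
  \<open>(\<gamma> - \<alpha> * p) + \<beta> * e - a * \<alpha>\<close>, which is negative.\<close>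

lemma union_bound_vanishes:
  fixes a \<alpha> \<beta> \<gamma> p e C \<eta> :: real
  assumes "0 < \<gamma> - \<alpha> * p" "0 < \<beta> * e" "(\<gamma> - \<alpha> * p) + \<beta> * e < a * \<alpha>" "0 < C" "0 < \<eta>"
  shows "\<forall>\<^sub>F m in sequentially. C * (real m powr \<alpha> / 2) powr (- a) *
    ((real m powr \<gamma> / (real m powr \<alpha> / 2) powr p + 1) * ((real m powr \<beta>) powr e + 1)) < \<eta>"
proof -
  define u v w where "u = \<gamma> - \<alpha> * p" and "v = \<beta> * e" and "w = a * \<alpha>"
  define K1 K2 where "K1 = C * 2 powr a" and "K2 = (2::real) powr p"
  have pos: "0 < K1" "0 < K2" "0 < u" "0 < v" "u + v < w" unfolding K1_def K2_def u_def v_def w_def using assms by auto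
  have "((\<lambda>m. K1 * real m powr (- w) * ((K2 * real m powr u + 1) * (real m powr v + 1))) \<longlongrightarrow> 0) sequentially"
    using pos by real_asymp
  from order_tendstoD(2)[OF this assms(5)] eventually_ge_at_top[of 1]
  show ?thesis
  proof eventually_elim
    case (elim m)
    have "(real m powr \<alpha> / 2) powr (- a) = 2 powr a * real m powr (- w)"
      unfolding w_def by (simp add: powr_divide powr_powr powr_minus field_simps)
    moreover have "real m powr \<gamma> / (real m powr \<alpha> / 2) powr p = K2 * real m powr u"
      unfolding K2_def u_def by (simp add: powr_divide powr_powr powr_diff field_simps)
    moreover have "(real m powr \<beta>) powr e = real m powr v" unfolding v_def by (simp add: powr_powr)
    ultimately show ?case using elim(1) unfolding K1_def by (simp only: mult.assoc)
  qed
qed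

lemma limsup_eqI:
  fixes f :: "nat \<Rightarrow> real"
  assumes "\<And>n. \<forall>\<^sub>F m in sequentially. f m \<le> L + inverse (real (Suc n))"
    and "\<And>n. \<exists>\<^sub>F m in sequentially. L - inverse (real (Suc n)) \<le> f m"
  shows "limsup (\<lambda>m. ereal (f m)) = ereal L"
proof (rule antisym)
  have lim: "(\<lambda>n. inverse (real (Suc n))) \<longlonglongrightarrow> 0" by (rule LIMSEQ_inverse_real_of_nat)
  have up: "limsup (\<lambda>m. ereal (f m)) \<le> ereal (L + inverse (real (Suc n)))" for n
  proof (rule Limsup_bounded)
    show "\<forall>\<^sub>F m in sequentially. ereal (f m) \<le> ereal (L + inverse (real (Suc n)))"
      using assms(1)[of n] unfolding ereal_less_eq(3) .
  qed
  have "(\<lambda>n. ereal (L + inverse (real (Suc n)))) \<longlonglongrightarrow> ereal (L + 0)"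
    by (intro tendsto_intros lim)
  from tendsto_lowerbound[OF this always_eventually sequentially_bot]
  have "limsup (\<lambda>m. ereal (f m)) \<le> ereal (L + 0)" using up by blast
  then show "limsup (\<lambda>m. ereal (f m)) \<le> ereal L" by simp
  have low: "ereal (L - inverse (real (Suc n))) \<le> limsup (\<lambda>m. ereal (f m))" for n
  proof (rule ccontr)
    assume "\<not> ?thesis"
    then have "\<forall>\<^sub>F m in sequentially. ereal (f m) < ereal (L - inverse (real (Suc n)))"
      by (intro Limsup_lessD) simp
    then have "\<forall>\<^sub>F m in sequentially. \<not> L - inverse (real (Suc n)) \<le> f m"
      by eventually_elim simp
    then show False using assms(2)[of n] unfolding frequently_def by (rule notE[rotated])
  qed
  have "(\<lambda>n. ereal (L - inverse (real (Suc n)))) \<longlonglongrightarrow> ereal (L - 0)"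
    by (intro tendsto_intros lim)
  from tendsto_upperbound[OF this always_eventually sequentially_bot]
  have "ereal (L - 0) \<le> limsup (\<lambda>m. ereal (f m))" using low by blast
  then show "ereal L \<le> limsup (\<lambda>m. ereal (f m))" by simp
qed

lemma liminf_eqI:
  fixes f :: "nat \<Rightarrow> real"
  assumes "\<And>n. \<exists>\<^sub>F m in sequentially. f m \<le> L + inverse (real (Suc n))"
    and "\<And>n. \<forall>\<^sub>F m in sequentially. L - inverse (real (Suc n)) \<le> f m"
  shows "liminf (\<lambda>m. ereal (f m)) = ereal L"
proof -
  have "limsup (\<lambda>m. ereal (- f m)) = ereal (- L)"
  proof (rule limsup_eqI)
    fix n
    show "\<forall>\<^sub>F m in sequentially. - f m \<le> - L + inverse (real (Suc n))"
      using assms(2)[of n] by eventually_elim simp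
    show "\<exists>\<^sub>F m in sequentially. - L - inverse (real (Suc n)) \<le> - f m"
      using assms(1)[of n] by (rule frequently_elim1) simp
  qed
  then have neg: "- liminf (\<lambda>m. ereal (f m)) = ereal (- L)"
    unfolding ereal_Limsup_uminus[symmetric] uminus_ereal.simps(1) .
  have "liminf (\<lambda>m. ereal (f m)) = - (- liminf (\<lambda>m. ereal (f m)))" by simp
  also have "\<dots> = ereal L" unfolding neg by simp
  finally show ?thesis .
qed

section \<open>Probability bounds for atypical widths\<close>

context record_model begin

text \<open>Almost surely a path is tame from some random block on. The events \<open>B J\<close> of
  a failure at or after \<open>J\<close> decrease to a null event, so a deterministic
  \<open>J\<close> works up to probability \<open>\<eta>\<close>. Adding the null event
  \<open>N\<close> covers all irregular paths.\<close>

lemma tame_path_likely: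
  assumes "2 \<le> CARD('d)" "0 < e" "0 < \<eta>"
  obtains J G where "1 \<le> J" "G \<in> events" "prob G < \<eta>"
    "\<forall>\<omega>\<in>space M - G. tame_path e J (path \<omega>)"
proof -
  obtain N where N: "{\<omega> \<in> space M. \<not> regular_path (path \<omega>)} \<subseteq> N" "emeasure M N = 0" "N \<in> events"
    using AE_regular_path by (rule AE_E)
  define B where "B J = {\<omega> \<in> space M. \<not> (\<forall>j\<ge>J. tame e (path \<omega>) j)}" for J
  have BE: "B J \<in> events" for J
  proof -
    have "Measurable.pred M (\<lambda>\<omega>. \<not> (\<forall>j. J \<le> j \<longrightarrow> tame e (path \<omega>) j))"
      by (intro pred_intros_logic(2) pred_intros_countable(1) pred_intros_imp' pred_tame)
    then show ?thesis unfolding B_def pred_def .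
  qed
  have "decseq B" unfolding decseq_def B_def by (auto intro: order_trans)
  with BE have "(\<lambda>J. prob (B J)) \<longlonglongrightarrow> prob (\<Inter>J. B J)"
    by (intro finite_Lim_measure_decseq) auto
  moreover have "prob (\<Inter>J. B J) = 0"
  proof -
    have "(\<Inter>J. B J) \<subseteq> N"
    proof
      fix \<omega> assume w: "\<omega> \<in> (\<Inter>J. B J)"
      then have "\<omega> \<in> space M" unfolding B_def by blast
      moreover have "\<not> regular_path (path \<omega>)"
      proof
        assume "regular_path (path \<omega>)"
        then obtain J where "tame_path e J (path \<omega>)" by (rule regular_tame_path[OF _ assms(1,2)])
        then have "\<forall>j\<ge>J. tame e (path \<omega>) j" using tame_pathD(3) by blast
        then have "\<omega> \<notin> B J" unfolding B_def by simp
        then show False using w by blast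
      qed
      ultimately show "\<omega> \<in> N" using N(1) by blast
    qed
    then have "prob (\<Inter>J. B J) \<le> prob N" by (rule finite_measure_mono[OF _ N(3)])
    moreover have "prob N = 0" using N(2) by (simp add: measure_def)
    ultimately show ?thesis using measure_nonneg[of M "\<Inter>J. B J"] by linarith
  qed
  ultimately have "(\<lambda>J. prob (B J)) \<longlonglongrightarrow> 0" by simp
  then have "\<forall>\<^sub>F J in sequentially. prob (B J) < \<eta>" using assms(3) by (rule order_tendstoD(2))
  then have "\<forall>\<^sub>F J in sequentially. 1 \<le> J \<and> prob (B J) < \<eta>"
    using eventually_ge_at_top[of 1] by eventually_elim simp
  then obtain J where J: "1 \<le> J" "prob (B J) < \<eta>" using eventually_happens'[OF sequentially_bot] by blast
  have "prob (B J \<union> N) \<le> prob (B J) + prob N" by (rule measure_Un_le[OF BE N(3)])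
  also have "prob N = 0" using N(2) by (simp add: measure_def)
  finally have "prob (B J \<union> N) < \<eta>" using J(2) by simp
  moreover have "tame_path e J (path \<omega>)" if w: "\<omega> \<in> space M" "\<omega> \<notin> B J \<union> N" for \<omega>
  proof -
    have r: "regular_path (path \<omega>)" using w N(1) by blast
    then have "positive_path (path \<omega>)" "infinite {k. is_record (path \<omega>) k}"
      by (auto intro: regular_path.axioms(1) dest: regular_path.infinite_records)
    moreover have "\<forall>j\<ge>J. tame e (path \<omega>) j" using w unfolding B_def by blast
    ultimately show ?thesis unfolding tame_path_def by blast
  qed
  ultimately show thesis using that[of J "B J \<union> N"] J(1) BE N(3) by blast
qed

lemma events_recent: "{\<omega> \<in> space M. recent e J h m (path \<omega>) j} \<in> events"
proof -
  have "Measurable.pred M (\<lambda>\<omega>. recent e J h m (path \<omega>) j)"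
    by (rule pred_recent[OF measurable_X refl]) simp
  then show ?thesis unfolding pred_def .
qed

lemma events_outlier: "{\<omega> \<in> space M. outlier a (path \<omega>) j} \<in> events"
  unfolding outlier_def by (rule events_exceed) auto

text \<open>For \<open>s = d - 1 + a\<close> the exponent \<open>d - 1 - s\<close> of the tail bound
  is \<open>- a\<close>, and the block contains \<open>2 ^ j\<close> observations.\<close>

lemma prob_outlier:
  "\<exists>C>0. \<forall>a. \<forall>\<^sub>F j in sequentially. \<P>(\<omega> in M. outlier a (path \<omega>) j) \<le> C * real j powr (- a)"
proof -
  obtain C where C: "0 < C \<and> (\<forall>s. \<forall>\<^sub>F j in sequentially. 0 \<le> lev s j \<and> 2 ^ j * tail (lev s j) \<le> C * real j powr (real CARD('d) - 1 - s))"
    using scaled_tail_upper ..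
  have "\<forall>\<^sub>F j in sequentially. \<P>(\<omega> in M. outlier a (path \<omega>) j) \<le> C * real j powr (- a)" for a
  proof -
    have "\<forall>\<^sub>F j in sequentially. 0 \<le> lev (real CARD('d) - 1 + a) j \<and>
      2 ^ j * tail (lev (real CARD('d) - 1 + a) j) \<le> C * real j powr (real CARD('d) - 1 - (real CARD('d) - 1 + a))"
      using C by (rule conjunct2[THEN spec])
    then show ?thesis
    proof eventually_elim
      case (elim j)
      have "\<P>(\<omega> in M. outlier a (path \<omega>) j) \<le> real (card {2^j<..2^(j+1)::nat}) * tail (lev (real CARD('d) - 1 + a) j)"
        unfolding outlier_def by (rule prob_exceed_le) (use elim in auto)
      also have "real (card {2^j<..2^(j+1)::nat}) = 2 ^ j" by simp
      finally show ?case using elim by simp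
    qed
  qed
  then show ?thesis using C by blast
qed

text \<open>The sum is the expected number of recent \<open>j\<close>. On every path
  \<open>card_recent\<close> bounds that number, since the required window growth is part of
  \<open>recent\<close> itself.\<close>

lemma sum_prob_recent:
  fixes e lo hi h :: real and J m :: nat
  assumes "0 \<le> e" "0 \<le> real CARD('d) - 1 - e" "0 < lo" "0 \<le> h"
  defines "I \<equiv> {j. J \<le> j \<and> lo \<le> real j \<and> real j \<le> hi}"
  shows "(\<Sum>j\<in>I. \<P>(\<omega> in M. recent e J h m (path \<omega>) j))
    \<le> (h / lo powr (real CARD('d) - 1 - e) + 1) * (hi powr e + 1)"
proof -
  have fin: "finite I"
    by (rule finite_subset[of _ "{..nat \<lfloor>hi\<rfloor>}"]) (auto simp: I_def le_nat_floor)
  let ?A = "\<lambda>j. {\<omega> \<in> space M. recent e J h m (path \<omega>) j}"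
  let ?K = "(h / lo powr (real CARD('d) - 1 - e) + 1) * (hi powr e + 1)"
  have int: "integrable M (indicat_real (?A j))" for j
    using events_recent by (intro integrable_real_indicator) (auto simp: emeasure_eq_measure)
  have "(\<Sum>j\<in>I. prob (?A j)) = (\<Sum>j\<in>I. expectation (indicat_real (?A j)))"
    using events_recent by (intro sum.cong) auto
  also have "\<dots> = expectation (\<lambda>\<omega>. \<Sum>j\<in>I. indicat_real (?A j) \<omega>)"
    using int by (rule Bochner_Integration.integral_sum[symmetric])
  also have "\<dots> \<le> expectation (\<lambda>\<omega>. ?K)"
  proof (rule integral_mono)
    show "integrable M (\<lambda>\<omega>. \<Sum>j\<in>I. indicat_real (?A j) \<omega>)" using int by (rule Bochner_Integration.integrable_sum)
    fix \<omega> assume w: "\<omega> \<in> space M"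
    have "(\<Sum>j\<in>I. indicat_real (?A j) \<omega>) = (\<Sum>j\<in>I. if recent e J h m (path \<omega>) j then 1 else 0)"
      using w by (intro sum.cong) (auto simp: indicator_def)
    also have "\<dots> = real (card {j \<in> I. recent e J h m (path \<omega>) j})"
      using sum.inter_filter[OF fin, of "\<lambda>_. 1::real" "recent e J h m (path \<omega>)"] by simp
    also have "{j \<in> I. recent e J h m (path \<omega>) j} = {j. J \<le> j \<and> lo \<le> real j \<and> real j \<le> hi \<and> recent e J h m (path \<omega>) j}"
      unfolding I_def by blast
    also have "real (card \<dots>) \<le> ?K" by (rule card_recent[OF assms(1-4)])
    finally show "(\<Sum>j\<in>I. indicat_real (?A j) \<omega>) \<le> ?K" .
  qed simp
  also have "\<dots> = ?K" by (simp add: prob_space)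
  finally show ?thesis .
qed

text \<open>Outside \<open>G\<close> the path is tame, so a large width forces some \<open>j\<close>
  that is both recent and an outlier. The probability of each such \<open>j\<close> factorises; the
  outlier factor is at most \<open>C * lo powr (- a)\<close> throughout, and the recent factors are
  summed by \<open>sum_prob_recent\<close>. The covering event \<open>S\<close> avoids measurability
  questions about \<open>Wtilde\<close>.\<close>

lemma large_width_unlikely:
  assumes d: "2 \<le> CARD('d)" and \<delta>: "0 < \<delta>" and \<eta>: "0 < \<eta>"
  shows "\<forall>\<^sub>F m in sequentially. \<exists>S\<in>events. prob S < \<eta> \<and>
    {\<omega> \<in> space M. (1 - 1 / real CARD('d) + \<delta>) * ln (real m) < Wtilde (path \<omega>) m} \<subseteq> S"
proof -
  define D where "D = real CARD('d)"
  have D2: "2 \<le> D" unfolding D_def using d by simp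
  \<comment> \<open>An excess of \<open>\<delta> * ln m\<close> in width is one of about
    \<open>\<delta> * D * ln j\<close>. Half of it goes to the outlier, the rest absorbs the errors
    in \<open>e\<close>.\<close>
  define a q where "a = \<delta> * D / 2" and "q = 1 - 1 / D + \<delta>"
  have a0: "0 < a" unfolding a_def using \<delta> D2 by simp
  have "1 / D \<le> 1" using D2 by simp
  then have q0: "0 \<le> q" unfolding q_def using \<delta> by linarith
  obtain e where e: "0 < e" "e < 1" "D - 1 + a < q * (D - e) - e"
    "((D - 1 + 2 * e) / (D - e) - (1 / (D + e)) * (D - 1 - e)) + (1 / (D - e)) * e < a * (1 / (D + e))"
    using exponent_choice[OF D2 \<delta>] unfolding a_def q_def by blast
  define \<alpha> \<beta> \<gamma> p where "\<alpha> = 1 / (D + e)" and "\<beta> = 1 / (D - e)" and "\<gamma> = (D - 1 + 2 * e) / (D - e)" and "p = D - 1 - e"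
  have p0: "0 \<le> p" unfolding p_def using D2 e by simp
  have exps: "0 < \<gamma> - \<alpha> * p" "0 < \<beta> * e" "(\<gamma> - \<alpha> * p) + \<beta> * e < a * \<alpha>"
  proof -
    show "(\<gamma> - \<alpha> * p) + \<beta> * e < a * \<alpha>" unfolding \<alpha>_def \<beta>_def \<gamma>_def p_def by (rule e(4))
    show "0 < \<beta> * e" unfolding \<beta>_def using D2 e by simp
    have "\<alpha> * p \<le> \<beta> * p" unfolding \<alpha>_def \<beta>_def using D2 e p0 by (intro mult_right_mono frac_le) auto
    also have "\<dots> < \<beta> * (D - 1 + 2 * e)" unfolding p_def \<beta>_def using D2 e by (intro mult_strict_left_mono) auto
    also have "\<dots> = \<gamma>" unfolding \<beta>_def \<gamma>_def by simp
    finally show "0 < \<gamma> - \<alpha> * p" by simp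
  qed
  have half: "0 < \<eta> / 2" using \<eta> by simp
  obtain J G where G: "1 \<le> J" "G \<in> events" "prob G < \<eta> / 2"
    "\<forall>\<omega>\<in>space M - G. tame_path e J (path \<omega>)"
    using tame_path_likely[OF d e(1) half] by blast
  obtain C where C: "0 < C" "\<forall>\<^sub>F j in sequentially. \<P>(\<omega> in M. outlier a (path \<omega>) j) \<le> C * real j powr (- a)"
    using prob_outlier by blast
  obtain J0 where J0: "\<And>j. J0 \<le> j \<Longrightarrow> \<P>(\<omega> in M. outlier a (path \<omega>) j) \<le> C * real j powr (- a)"
    using C(2) unfolding eventually_sequentially by blast
  have det: "\<forall>\<^sub>F m in sequentially. \<forall>x :: nat \<Rightarrow> real^'d. tame_path e J x \<longrightarrow>
    Wtilde x m \<le> q * ln (real m) \<or>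
    (\<exists>j\<ge>J. real m powr \<alpha> / 2 \<le> real j \<and> real j \<le> real m powr \<beta> \<and>
       outlier a x j \<and> recent e J (real m powr \<gamma>) m x j)"
    unfolding \<alpha>_def \<beta>_def \<gamma>_def D_def
    using e(1,2) a0 q0 e(3)[unfolded D_def] d G(1) by (rule outlier_of_large_width)
  have "\<forall>\<^sub>F m in sequentially. real J0 \<le> real m powr \<alpha> / 2"
  proof -
    have "0 < \<alpha>" unfolding \<alpha>_def using D2 e by simp
    then show ?thesis by real_asymp
  qed
  moreover have "\<forall>\<^sub>F m in sequentially. C * (real m powr \<alpha> / 2) powr (- a) *
    ((real m powr \<gamma> / (real m powr \<alpha> / 2) powr p + 1) * ((real m powr \<beta>) powr e + 1)) < \<eta> / 2"
    using \<eta> by (intro union_bound_vanishes[OF exps C(1)]) simp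
  moreover have "\<forall>\<^sub>F m in sequentially. (1::nat) \<le> m" by (rule eventually_ge_at_top)
  ultimately show ?thesis using det
  proof eventually_elim
    case (elim m)
    define lo hi h where "lo = real m powr \<alpha> / 2" and "hi = real m powr \<beta>" and "h = real m powr \<gamma>"
    have lo0: "0 < lo" unfolding lo_def using elim(3) by simp
    define I where "I = {j. J \<le> j \<and> lo \<le> real j \<and> real j \<le> hi}"
    have fin: "finite I"
      by (rule finite_subset[of _ "{..nat \<lfloor>hi\<rfloor>}"]) (auto simp: I_def le_nat_floor)
    define E where "E j = {\<omega> \<in> space M. recent e J h m (path \<omega>) j \<and> outlier a (path \<omega>) j}" for j
    have EE: "E j \<in> events" for j
    proof -
      have "E j = {\<omega> \<in> space M. recent e J h m (path \<omega>) j} \<inter> {\<omega> \<in> space M. outlier a (path \<omega>) j}"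
        unfolding E_def by blast
      then show ?thesis using events_recent events_outlier by (simp only: sets.Int)
    qed
    have UE: "(\<Union>j\<in>I. E j) \<in> events" using fin EE by (intro sets.finite_UN) auto
    have PE: "prob (E j) \<le> \<P>(\<omega> in M. recent e J h m (path \<omega>) j) * (C * lo powr (- a))" if "j \<in> I" for j
    proof -
      have j: "lo \<le> real j" using that unfolding I_def by simp
      have "J0 \<le> j" using j elim(1) unfolding lo_def by simp
      from J0[OF this] have "\<P>(\<omega> in M. outlier a (path \<omega>) j) \<le> C * real j powr (- a)" .
      also have "\<dots> \<le> C * lo powr (- a)" using j lo0 a0 C(1) by (intro mult_left_mono powr_mono2') auto
      finally show ?thesis unfolding E_def prob_recent_outlier by (intro mult_left_mono) auto
    qed
    have "prob (\<Union>j\<in>I. E j) \<le> (\<Sum>j\<in>I. prob (E j))"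
      using fin EE by (intro finite_measure_subadditive_finite) auto
    also have "\<dots> \<le> (\<Sum>j\<in>I. \<P>(\<omega> in M. recent e J h m (path \<omega>) j) * (C * lo powr (- a)))"
      by (intro sum_mono PE)
    also have "\<dots> = C * lo powr (- a) * (\<Sum>j\<in>I. \<P>(\<omega> in M. recent e J h m (path \<omega>) j))"
      by (simp add: sum_distrib_left mult_ac)
    also have "\<dots> \<le> C * lo powr (- a) * ((h / lo powr p + 1) * (hi powr e + 1))"
      unfolding I_def p_def D_def
      using e(1) p0[unfolded p_def D_def] lo0 C(1) by (intro mult_left_mono sum_prob_recent) (auto simp: h_def)
    also have "\<dots> < \<eta> / 2" using elim(2) unfolding lo_def hi_def h_def .
    finally have U: "prob (\<Union>j\<in>I. E j) < \<eta> / 2" .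
    have "prob (G \<union> (\<Union>j\<in>I. E j)) \<le> prob G + prob (\<Union>j\<in>I. E j)" by (rule measure_Un_le[OF G(2) UE])
    then have "prob (G \<union> (\<Union>j\<in>I. E j)) < \<eta>" using U G(3) by linarith
    moreover have "{\<omega> \<in> space M. (1 - 1 / real CARD('d) + \<delta>) * ln (real m) < Wtilde (path \<omega>) m} \<subseteq> G \<union> (\<Union>j\<in>I. E j)"
    proof
      fix \<omega> assume "\<omega> \<in> {\<omega> \<in> space M. (1 - 1 / real CARD('d) + \<delta>) * ln (real m) < Wtilde (path \<omega>) m}"
      then have w: "\<omega> \<in> space M" "q * ln (real m) < Wtilde (path \<omega>) m" unfolding q_def D_def by auto
      show "\<omega> \<in> G \<union> (\<Union>j\<in>I. E j)"
      proof (rule ccontr)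
        assume no: "\<omega> \<notin> G \<union> (\<Union>j\<in>I. E j)"
        then have "tame_path e J (path \<omega>)" using G(4) w(1) by blast
        then obtain j where "J \<le> j" "lo \<le> real j" "real j \<le> hi" "outlier a (path \<omega>) j" "recent e J h m (path \<omega>) j"
          using elim(4) w(2) unfolding lo_def hi_def h_def by (metis not_le)
        then have "\<omega> \<in> (\<Union>j\<in>I. E j)" using w(1) unfolding I_def E_def by blast
        then show False using no by blast
      qed
    qed
    ultimately show ?case using G(2) UE by (intro bexI[of _ "G \<union> (\<Union>j\<in>I. E j)"]) auto
  qed
qed

text \<open>On tame paths the lower bound is deterministic once \<open>m\<close> is large, so the
  exceptional event \<open>G\<close> alone covers the small widths.\<close>

lemma small_width_unlikely:
  assumes d: "2 \<le> CARD('d)" and \<delta>: "0 < \<delta>" and \<eta>: "0 < \<eta>"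
  shows "\<forall>\<^sub>F m in sequentially. \<exists>S\<in>events. prob S < \<eta> \<and>
    {\<omega> \<in> space M. Wtilde (path \<omega>) m < (1 - 1 / real CARD('d) - \<delta>) * ln (real m)} \<subseteq> S"
proof -
  define D where "D = real CARD('d)"
  have D2: "2 \<le> D" unfolding D_def using d by simp
  \<comment> \<open>\<open>Wtilde_lower\<close> asks for a nonnegative \<open>q\<close>, so a
    negative target is raised to 0.\<close>
  define q where "q = max 0 (1 - 1 / D - \<delta>)"
  have q: "0 \<le> q" "1 - 1 / D - \<delta> \<le> q" "q < 1 - 1 / D" unfolding q_def using D2 \<delta> by (auto simp: field_simps)
  then have qD: "0 < D - 1 - q * D" using D2 by (simp add: field_simps)
  \<comment> \<open>Makes \<open>e * (q + 2)\<close> half of the available gap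
    \<open>D - 1 - q * D\<close>.\<close>
  define e where "e = (D - 1 - q * D) / (2 * (q + 2))"
  have e0: "0 < e" unfolding e_def using qD q(1) by simp
  have "z / (2 * y) * y = z / 2" if "y \<noteq> 0" for y z :: real using that by simp
  from this[of "q + 2" "D - 1 - q * D"] have "e * (q + 2) = (D - 1 - q * D) / 2" unfolding e_def using q(1) by linarith
  moreover have "q * (D + e) + 2 * e = q * D + e * (q + 2)" by (simp add: algebra_simps)
  ultimately have eq: "q * (D + e) + 2 * e = q * D + (D - 1 - q * D) / 2" by simp
  define z where "z = D - 1 - q * D"
  have "q * D = D - 1 - z" unfolding z_def by simp
  with eq have "q * (D + e) + 2 * e = D - 1 - z + z / 2" unfolding z_def by simp
  then have "q * (D + e) < D - 1 - 2 * e" using qD unfolding z_def[symmetric] by linarith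
  note det = Wtilde_lower[OF e0 q(1) this[unfolded D_def]]
  obtain J G where G: "1 \<le> J" "G \<in> events" "prob G < \<eta>"
    "\<forall>\<omega>\<in>space M - G. tame_path e J (path \<omega>)"
    using tame_path_likely[OF d e0 \<eta>] by blast
  show ?thesis using det[of J] eventually_ge_at_top[of 1]
  proof eventually_elim
    case (elim m)
    have "(1 - 1 / D - \<delta>) * ln (real m) \<le> q * ln (real m)" using q(2) elim(2) by (intro mult_right_mono) auto
    moreover have "\<omega> \<in> G" if "(1 - 1 / D - \<delta>) * ln (real m) \<le> q * ln (real m)" "\<omega> \<in> space M" "Wtilde (path \<omega>) m < (1 - 1 / D - \<delta>) * ln (real m)" for \<omega>
    proof (rule ccontr)
      assume "\<omega> \<notin> G"
      then have "tame_path e J (path \<omega>)" using G(4) that(2) by blast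
      then have "q * ln (real m) \<le> Wtilde (path \<omega>) m" using elim(1) by blast
      then show False using that(1,3) by linarith
    qed
    ultimately have "{\<omega> \<in> space M. Wtilde (path \<omega>) m < (1 - 1 / real CARD('d) - \<delta>) * ln (real m)} \<subseteq> G"
      unfolding D_def[symmetric] by blast
    then show ?case using G(2,3) by blast
  qed
qed

end

section \<open>The width in probability and almost surely\<close>

context record_model begin

abbreviation deviation :: "real \<Rightarrow> nat \<Rightarrow> 'a set" where
  "deviation \<epsilon> m \<equiv> {\<omega> \<in> space M. \<bar>Wtilde (path \<omega>) m / ln (real m) - (1 - 1 / real CARD('d))\<bar> > \<epsilon>}"

text \<open>The two covering events bound the measure of the deviation set whether or not that set
  is itself measurable.\<close>

lemma width_ratio_in_probability:
  assumes d: "2 \<le> CARD('d)" and \<epsilon>: "0 < \<epsilon>"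
  shows "(\<lambda>m. prob (deviation \<epsilon> m)) \<longlonglongrightarrow> 0"
proof (rule LIMSEQ_I)
  fix \<eta> :: real assume "0 < \<eta>"
  then have half: "0 < \<eta> / 2" by simp
  define c where "c = 1 - 1 / real CARD('d)"
  have "\<forall>\<^sub>F m in sequentially. norm (\<P>(\<omega> in M. \<bar>Wtilde (path \<omega>) m / ln (real m) - c\<bar> > \<epsilon>) - 0) < \<eta>"
    using large_width_unlikely[OF d \<epsilon> half] small_width_unlikely[OF d \<epsilon> half] eventually_ge_at_top[of 2]
  proof eventually_elim
    case (elim m)
    obtain S1 where S1: "S1 \<in> events" "prob S1 < \<eta> / 2"
      "{\<omega> \<in> space M. (c + \<epsilon>) * ln (real m) < Wtilde (path \<omega>) m} \<subseteq> S1"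
      using elim(1) unfolding c_def by blast
    obtain S2 where S2: "S2 \<in> events" "prob S2 < \<eta> / 2"
      "{\<omega> \<in> space M. Wtilde (path \<omega>) m < (c - \<epsilon>) * ln (real m)} \<subseteq> S2"
      using elim(2) unfolding c_def by blast
    have lnm: "0 < ln (real m)" using elim(3) by simp
    have "{\<omega> \<in> space M. \<bar>Wtilde (path \<omega>) m / ln (real m) - c\<bar> > \<epsilon>} \<subseteq> S1 \<union> S2"
    proof
      fix \<omega> assume "\<omega> \<in> {\<omega> \<in> space M. \<bar>Wtilde (path \<omega>) m / ln (real m) - c\<bar> > \<epsilon>}"
      then have w: "\<omega> \<in> space M" "\<epsilon> < \<bar>Wtilde (path \<omega>) m / ln (real m) - c\<bar>" by blast+
      from w(2) consider "c + \<epsilon> < Wtilde (path \<omega>) m / ln (real m)" | "Wtilde (path \<omega>) m / ln (real m) < c - \<epsilon>"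
        by linarith
      then show "\<omega> \<in> S1 \<union> S2"
      proof cases
        case 1
        then have "(c + \<epsilon>) * ln (real m) < Wtilde (path \<omega>) m" unfolding pos_less_divide_eq[OF lnm] .
        then show ?thesis using S1(3) w(1) by blast
      next
        case 2
        then have "Wtilde (path \<omega>) m < (c - \<epsilon>) * ln (real m)" unfolding pos_divide_less_eq[OF lnm] .
        then show ?thesis using S2(3) w(1) by blast
      qed
    qed
    then have "\<P>(\<omega> in M. \<bar>Wtilde (path \<omega>) m / ln (real m) - c\<bar> > \<epsilon>) \<le> prob (S1 \<union> S2)"
      by (rule finite_measure_mono[OF _ sets.Un[OF S1(1) S2(1)]])
    also have "\<dots> \<le> prob S1 + prob S2" by (rule measure_Un_le[OF S1(1) S2(1)])
    finally show ?case using S1(2) S2(2) by simp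
  qed
  then show "\<exists>no. \<forall>m\<ge>no. norm (prob (deviation \<epsilon> m) - 0) < \<eta>"
    unfolding c_def eventually_sequentially .
qed

text \<open>A width that is large for all \<open>m \<ge> N\<close> is large at arbitrarily late
  \<open>m\<close>, an occurrence covered by events of arbitrarily small probability. The estimate
  in probability thus yields the upper bound for the lower limit.\<close>

lemma AE_frequently_small_width:
  assumes d: "2 \<le> CARD('d)" and \<delta>: "0 < \<delta>"
  shows "AE \<omega> in M. \<exists>\<^sub>F m in sequentially. Wtilde (path \<omega>) m \<le> (1 - 1 / real CARD('d) + \<delta>) * ln (real m)"
proof -
  let ?W = "\<lambda>\<omega> m. (1 - 1 / real CARD('d) + \<delta>) * ln (real m) < Wtilde (path \<omega>) m"
  have null: "AE \<omega> in M. \<not> (\<forall>m\<ge>N. ?W \<omega> m)" for N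
  proof -
    have "\<exists>S. S \<in> events \<and> prob S < inverse (real (Suc k)) \<and> {\<omega> \<in> space M. \<forall>m\<ge>N. ?W \<omega> m} \<subseteq> S" for k
    proof -
      have "0 < inverse (real (Suc k))" by simp
      from eventually_conj[OF large_width_unlikely[OF d \<delta> this] eventually_ge_at_top[of N]]
      have "\<exists>m. (\<exists>S\<in>events. prob S < inverse (real (Suc k)) \<and> {\<omega> \<in> space M. ?W \<omega> m} \<subseteq> S) \<and> N \<le> m"
        by (rule eventually_happens'[OF sequentially_bot])
      then obtain m S where m: "N \<le> m"
        and S: "S \<in> events" "prob S < inverse (real (Suc k))" "{\<omega> \<in> space M. ?W \<omega> m} \<subseteq> S"
        by (elim exE conjE bexE)
      have "{\<omega> \<in> space M. \<forall>m\<ge>N. ?W \<omega> m} \<subseteq> {\<omega> \<in> space M. ?W \<omega> m}"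
        using m by (intro Collect_mono) simp
      then have "{\<omega> \<in> space M. \<forall>m\<ge>N. ?W \<omega> m} \<subseteq> S" using S(3) by (rule order_trans)
      then show ?thesis using S(1,2) by blast
    qed
    then have "\<exists>S. \<forall>k. S k \<in> events \<and> prob (S k) < inverse (real (Suc k)) \<and> {\<omega> \<in> space M. \<forall>m\<ge>N. ?W \<omega> m} \<subseteq> S k"
      by (intro choice allI)
    then obtain S where "\<forall>k. S k \<in> events \<and> prob (S k) < inverse (real (Suc k)) \<and> {\<omega> \<in> space M. \<forall>m\<ge>N. ?W \<omega> m} \<subseteq> S k" ..
    then have S: "\<And>k. S k \<in> events" "\<And>k. prob (S k) < inverse (real (Suc k))"
      "\<And>k. {\<omega> \<in> space M. \<forall>m\<ge>N. ?W \<omega> m} \<subseteq> S k"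
      by simp_all
    have I: "(\<Inter>k. S k) \<in> events" using S(1) by (intro sets.countable_INT) auto
    have le: "prob (\<Inter>k. S k) \<le> inverse (real (Suc k))" for k
    proof -
      have "prob (\<Inter>k. S k) \<le> prob (S k)" by (rule finite_measure_mono[OF _ S(1)]) blast
      then show ?thesis using S(2)[of k] by linarith
    qed
    have "prob (\<Inter>k. S k) \<le> 0"
      by (rule tendsto_lowerbound[OF LIMSEQ_inverse_real_of_nat always_eventually[OF allI[OF le]] sequentially_bot])
    then have "prob (\<Inter>k. S k) = 0" using measure_nonneg[of M "\<Inter>k. S k"] by linarith
    then have "(\<Inter>k. S k) \<in> null_sets M" using I by (simp add: emeasure_eq_measure null_setsI)
    moreover have "{\<omega> \<in> space M. \<not> \<not> (\<forall>m\<ge>N. ?W \<omega> m)} \<subseteq> (\<Inter>k. S k)" using S(3) by blast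
    ultimately show ?thesis by (rule AE_I')
  qed
  have "AE \<omega> in M. \<forall>N. \<not> (\<forall>m\<ge>N. ?W \<omega> m)" unfolding AE_all_countable using null by (rule allI)
  then show ?thesis
  proof eventually_elim
    case (elim \<omega>)
    then show ?case unfolding frequently_sequentially by (simp add: not_less)
  qed
qed

text \<open>The two eventual bounds come from tameness with small \<open>e\<close>. That they are
  approached infinitely often is supplied by \<open>AE_frequently_small_width\<close> for the lower
  limit and by the exceedances of the level with exponent \<open>d\<close> for the upper
  one.\<close>

lemma AE_liminf_limsup:
  assumes d: "2 \<le> CARD('d)"
  shows "AE \<omega> in M.
     liminf (\<lambda>m. ereal (Wtilde (path \<omega>) m / ln (real m))) = ereal (1 - 1 / real CARD('d)) \<and>
     limsup (\<lambda>m. ereal (Wtilde (path \<omega>) m / ln (real m))) = 1"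
proof -
  define D where "D = real CARD('d)"
  have D2: "2 \<le> D" unfolding D_def using d by simp
  define r where "r n = inverse (real (Suc n))" for n
  have r0: "0 < r n" for n unfolding r_def by simp
  have "AE \<omega> in M. \<forall>n. \<exists>\<^sub>F m in sequentially. Wtilde (path \<omega>) m \<le> (1 - 1 / real CARD('d) + r n) * ln (real m)"
    unfolding AE_all_countable using AE_frequently_small_width[OF d r0] by (rule allI)
  then show ?thesis using AE_regular_path AE_frequently_exceed
  proof eventually_elim
    case (elim \<omega>)
    define x where "x = (path \<omega>)"
    define f where "f m = Wtilde x m / ln (real m)" for m
    have f: "f m \<le> q \<longleftrightarrow> Wtilde x m \<le> q * ln (real m)" "q \<le> f m \<longleftrightarrow> q * ln (real m) \<le> Wtilde x m" if "2 \<le> m" for q m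
    proof -
      have lnm: "0 < ln (real m)" using that by simp
      show "f m \<le> q \<longleftrightarrow> Wtilde x m \<le> q * ln (real m)" unfolding f_def by (rule pos_divide_le_eq[OF lnm])
      show "q \<le> f m \<longleftrightarrow> q * ln (real m) \<le> Wtilde x m" unfolding f_def by (rule pos_le_divide_eq[OF lnm])
    qed
    have ge2: "\<forall>\<^sub>F m in sequentially. (2::nat) \<le> m" by (rule eventually_ge_at_top)
    have tame: "\<exists>J. tame_path e J x" if "0 < e" for e
      using elim(2) d that unfolding x_def[symmetric] by (rule regular_tame_path) blast
    \<comment> \<open>Each condition on \<open>e\<close> below is linear in \<open>e\<close> and
      amounts to \<open>e * k < z\<close> for a positive gap \<open>z\<close>.\<close>
    have eps: "\<exists>e>0. e * k < z" if "0 < z" "0 < k" for k z :: real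
      using that by (intro exI[of _ "z / (2 * k)"]) (simp add: field_simps)
    have up: "\<forall>\<^sub>F m in sequentially. f m \<le> 1 + r n" for n
    proof -
      obtain e where e: "0 < e" "e * (3 + r n) < r n * D" using eps[of "r n * D" "3 + r n"] r0[of n] D2 by auto
      have "D + 2 * e < (1 + r n) * (D - e)" using e(2) by (simp add: algebra_simps)
      moreover obtain J where J: "tame_path e J x" using tame[OF e(1)] by blast
      ultimately have "\<forall>\<^sub>F m in sequentially. \<forall>x :: nat \<Rightarrow> real^'d. tame_path e J x \<longrightarrow> Wtilde x m \<le> (1 + r n) * ln (real m)"
        using e(1) r0[of n] unfolding D_def by (intro Wtilde_upper) auto
      then show ?thesis using ge2
      proof eventually_elim
        case (elim m) then show ?case using J unfolding f(1)[OF elim(2)] by blast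
      qed
    qed
    have low: "\<forall>\<^sub>F m in sequentially. (1 - 1 / D) - r n \<le> f m" for n
    proof -
      define q where "q = max 0 (1 - 1 / D - r n)"
      have q: "0 \<le> q" "1 - 1 / D - r n \<le> q" "q < 1 - 1 / D" unfolding q_def using D2 r0[of n] by (auto simp: field_simps)
      then have "0 < D - 1 - q * D" using D2 by (simp add: field_simps)
      then obtain e where e: "0 < e" "e * (q + 2) < D - 1 - q * D" using eps[of "D - 1 - q * D" "q + 2"] q(1) by auto
      have "q * (D + e) < D - 1 - 2 * e" using e(2) by (simp add: algebra_simps)
      moreover obtain J where J: "tame_path e J x" using tame[OF e(1)] by blast
      ultimately have "\<forall>\<^sub>F m in sequentially. \<forall>x :: nat \<Rightarrow> real^'d. tame_path e J x \<longrightarrow> q * ln (real m) \<le> Wtilde x m"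
        using e(1) q(1) unfolding D_def by (intro Wtilde_lower) auto
      then show ?thesis using ge2
      proof eventually_elim
        case (elim m)
        have "q \<le> f m" unfolding f(2)[OF elim(2)] using elim(1) J by blast
        then show ?case using q(2) by linarith
      qed
    qed
    have freq: "\<exists>\<^sub>F m in sequentially. 1 - r n \<le> f m" for n
    proof -
      define q where "q = max 0 (1 - r n)"
      have q: "0 \<le> q" "1 - r n \<le> q" "q < 1" unfolding q_def using r0[of n] by auto
      then have "0 < (1 - q) * D" using D2 by simp
      then obtain e where e: "0 < e" "e * (q + 1) < (1 - q) * D" using eps[of "(1 - q) * D" "q + 1"] q(1) by auto
      have "q * (D + e) < D - e" using e(2) by (simp add: algebra_simps)
      moreover obtain J where J: "tame_path e J x" using tame[OF e(1)] by blast
      ultimately have "\<exists>\<^sub>F m in sequentially. q * ln (real m) \<le> Wtilde x m"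
        using e(1) q(1) J elim(3) unfolding D_def x_def by (intro Wtilde_frequently_large)
      then have "\<exists>\<^sub>F m in sequentially. q * ln (real m) \<le> Wtilde x m \<and> 2 \<le> m"
        using ge2 by (rule frequently_eventually_frequently)
      then show ?thesis
      proof (rule frequently_elim1)
        fix m assume m: "q * ln (real m) \<le> Wtilde x m \<and> 2 \<le> m"
        then have "q \<le> f m" using f(2)[of m q] by blast
        then show "1 - r n \<le> f m" using q(2) by linarith
      qed
    qed
    have freq': "\<exists>\<^sub>F m in sequentially. f m \<le> (1 - 1 / D) + r n" for n
    proof -
      have "\<exists>\<^sub>F m in sequentially. Wtilde x m \<le> (1 - 1 / D + r n) * ln (real m) \<and> 2 \<le> m"
        using elim(1)[rule_format, of n] ge2 unfolding D_def x_def by (rule frequently_eventually_frequently)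
      then show ?thesis by (rule frequently_elim1) (simp add: f(1))
    qed
    have "liminf (\<lambda>m. ereal (f m)) = ereal (1 - 1 / D)"
      by (rule liminf_eqI) (fact freq'[unfolded r_def], fact low[unfolded r_def])
    moreover have "limsup (\<lambda>m. ereal (f m)) = ereal 1"
      by (rule limsup_eqI) (fact up[unfolded r_def], fact freq[unfolded r_def])
    ultimately show ?case unfolding f_def x_def D_def one_ereal_def by blast
  qed
qed

text \<open>For \<open>d = 1\<close> the limit \<open>1 - 1/d\<close> is 0, and the width vanishes
  on every regular path.\<close>

lemma width_ratio_in_probability_one_dim:
  assumes d: "CARD('d) = 1" and \<epsilon>: "0 < \<epsilon>"
  shows "(\<lambda>m. prob (deviation \<epsilon> m)) \<longlonglongrightarrow> 0"
proof -
  obtain N where N: "{\<omega> \<in> space M. \<not> regular_path (path \<omega>)} \<subseteq> N" "emeasure M N = 0" "N \<in> events"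
    using AE_regular_path by (rule AE_E)
  have "prob (deviation \<epsilon> m) = 0" if m: "1 \<le> m" for m
  proof -
    have W: "Wtilde (path \<omega>) m = 0" if "regular_path (path \<omega>)" for \<omega>
    proof -
      interpret regular_path "path \<omega>" by fact
      show ?thesis unfolding Wtilde_def
        by (rule Wwidth_one_dim[OF d Rcount_record_time(3)[OF infinite_records m]])
    qed
    have "deviation \<epsilon> m \<subseteq> N"
    proof
      fix \<omega> assume "\<omega> \<in> deviation \<epsilon> m"
      then have w: "\<omega> \<in> space M" "\<epsilon> < \<bar>Wtilde (path \<omega>) m / ln (real m) - (1 - 1 / real CARD('d))\<bar>" by blast+
      have "\<not> regular_path (path \<omega>)"
      proof
        assume "regular_path (path \<omega>)"
        from w(2)[unfolded W[OF this]] show False using d \<epsilon> by simp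
      qed
      then show "\<omega> \<in> N" using N(1) w(1) by blast
    qed
    then have "prob (deviation \<epsilon> m) \<le> prob N"
      by (rule finite_measure_mono[OF _ N(3)])
    moreover have "prob N = 0" using N(2) by (simp add: measure_def)
    ultimately show ?thesis by (simp add: measure_le_0_iff)
  qed
  then have "\<forall>\<^sub>F m in sequentially. prob (deviation \<epsilon> m) = 0"
    unfolding eventually_sequentially by blast
  then show ?thesis by (rule tendsto_eventually)
qed

end

theorem theorem5p6:
  fixes M :: "'a measure" and X :: "nat \<Rightarrow> 'a \<Rightarrow> real^'d"
  assumes "prob_space M"
    and "\<And>i j. 1 \<le> i \<Longrightarrow> distributed M lborel (\<lambda>\<omega>. X i \<omega> $ j) (exponential_density 1)"
    and "prob_space.indep_vars M (\<lambda>_. borel) (\<lambda>(i, j) \<omega>. X i \<omega> $ j) ({1..} \<times> UNIV)"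
  shows "(\<forall>\<epsilon>>0. (\<lambda>m. measure M {\<omega> \<in> space M.
              \<bar>Wtilde (\<lambda>i. X i \<omega>) m / ln (real m) - (1 - 1 / real CARD('d))\<bar> > \<epsilon>})
            \<longlonglongrightarrow> 0)
       \<and> (CARD('d) \<ge> 2 \<longrightarrow>
            (AE \<omega> in M.
               liminf (\<lambda>m. ereal (Wtilde (\<lambda>i. X i \<omega>) m / ln (real m)))
                 = ereal (1 - 1 / real CARD('d))
             \<and> limsup (\<lambda>m. ereal (Wtilde (\<lambda>i. X i \<omega>) m / ln (real m))) = 1))"
proof -
  interpret prob_space M by fact
  interpret record_model M X
    by unfold_locales (use assms(2,3) in auto)
  have "0 < CARD('d)" by (rule zero_less_card_finite)
  then consider "CARD('d) = 1" | "2 \<le> CARD('d)" by linarith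
  then have conv: "(\<lambda>m. prob {\<omega> \<in> space M.
      \<bar>Wtilde (\<lambda>i. X i \<omega>) m / ln (real m) - (1 - 1 / real CARD('d))\<bar> > \<epsilon>}) \<longlonglongrightarrow> 0" if "0 < \<epsilon>" for \<epsilon>
  proof cases
    case 1 then show ?thesis using that by (rule width_ratio_in_probability_one_dim)
  next
    case 2 then show ?thesis using that by (rule width_ratio_in_probability)
  qed
  show ?thesis
    by (intro conjI allI impI conv AE_liminf_limsup)
qed

end
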